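(* Let $\Delta\geq 6$, and let $n=k\Delta+1+j$, where $k\geq\Delta-1$ and $0\leq j\leq\Delta-1$ are integers. Then the maximum $\sigma$-irregularity over all trees on $n$ vertices with maximum degree $\Delta$ equals \[ \max\{\sigma',\sigma'',\sigma'''\}, \] where the term $\sigma'''$ is present only when $2\leq j\leq\Delta-2$, and where for $j=0$ this maximum is understood to be the value $\Delta^{3}k-2\Delta^{2}k-3\Delta k+6k+4\Delta-6$ (the common $\sigma$-irregularity of all nice trees on $n=k\Delta+1$ vertices). Moreover, a tree $T$ on $n$ vertices with maximum degree $\Delta$ is maximal if and only if $T\in\mathcal{T}_{n,\Delta}$.
   Context: All graphs are finite and simple. For a graph $G$, $\sigma(G)=\sum_{uv\in E(G)}(d(u)-d(v))^2$, where $d(u)$ is the degree of $u$. A tree $T$ with maximum degree $\Delta$ is maximal if it attains the largest value of $\sigma$ among all trees on $|V(T)|$ vertices with maximum degree $\Delta$. For a tree $T$, $n_i$ is the number of vertices of degree $i$, and $m_{ij}=m_{ji}$ is the number of edges whose end-vertices have degrees $i$ and $j$. An internal leaf of a tree is a vertex of degree at least $2$ having precisely one neighbor of degree greater than $1$. A medium vertex is a vertex whose degree lies in $\{3,\ldots,\Delta-1\}$. A tree with maximum degree $\Delta$ is nice if every edge $uv$ satisfies $(d(u)-d(v))^2\in\{(\Delta-1)^2,(\Delta-2)^2\}$. Let $n=k\Delta+1+j$ with $k\ge\Delta-1$. The three families consist of trees $T$ on $n$ vertices with maximum degree $\Delta$: Family $\mathcal{T}'_{n,\Delta}$ (for $1\le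 j\le\Delta-1$): all such trees with (1) all internal leaves of $T$ have degree $\Delta$; (2) $m_{22}\le 2$ and $m_{\Delta\Delta}=0$; (3) $\sum_{i=3}^{\Delta-1}n_i\le 1$; (4) $m_{22}=0$ if and only if $\sum_{i=3}^{\Delta-1}n_i=n_a=1$ for some $a\in\{3,\ldots,\Delta-1\}$; (5) if $m_{22}=0$, then $m_{a2}=a$, where $a$ is the degree from (4). Family $\mathcal{T}''_{n,\Delta}$ (for $0\le j\le\Delta-1$): all such trees with (1) all internal leaves of $T$ have degree $\Delta$; (2) all vertices have degree in $\{1,2,\Delta\}$; (3) $m_{22}=0$ and $m_{\Delta\Delta}\le\Delta-1$. Family $\mathcal{T}'''_{n,\Delta}$ (for $2\le j\le\Delta-2$): all such trees with (1) all internal leaves of $T$ have degree $\Delta$; (2) all vertices have degree in $\{1,2,\Delta\}$, except precisely one medium vertex $w$, which has degree $j+1$; (3) $m_{22}=0$; (4) $w$ has precisely $j$ neighbors of degree $2$ and one neighbor of degree $\Delta$; (5) $m_{\Delta\Delta}=0$. For other $j$ this family is considered empty. For $1\le j\le\Delta-1$, each of the families $\mathcal{T}'_{n,\Delta}$, $\mathcal{T}''_{n,\Delta}$ (and $\mathcal{T}'''_{n,\Delta}$ when $2\le j\le\Delta-2$) is nonempty and all its trees have the same $\sigma$-irregularity; these common values are denoted $\sigma'$, $\sigma''$, $\sigma'''$ respectively. Let $r(\Delta)=\frac12\left(\sqrt{5\Delta^2-32\Delta+44}-\Delta+4\right)$. The family $\mathcal{T}_{n,\Delta}$ is defined as follows.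 For $j=0$, $\mathcal{T}_{n,\Delta}=\mathcal{T}''_{n,\Delta}$ (which then consists of nice trees). For $1\le j\le\Delta-1$: - $\mathcal{T}_{n,\Delta}=\mathcal{T}'''_{n,\Delta}$ if $j=2$ and $\Delta\ge 7$, or $(\Delta,j)=(8,3)$; - $\mathcal{T}_{n,\Delta}=\mathcal{T}''_{n,\Delta}\cup\mathcal{T}'''_{n,\Delta}$ if $(\Delta,j)=(6,2)$; - $\mathcal{T}_{n,\Delta}=\mathcal{T}'_{n,\Delta}\cup\mathcal{T}'''_{n,\Delta}$ if $(\Delta,j)=(9,3)$; - in all other cases, $\mathcal{T}_{n,\Delta}=\mathcal{T}'_{n,\Delta}$ if $j<r(\Delta)$, $\mathcal{T}_{n,\Delta}=\mathcal{T}'_{n,\Delta}\cup\mathcal{T}''_{n,\Delta}$ if $j=r(\Delta)$, and $\mathcal{T}_{n,\Delta}=\mathcal{T}''_{n,\Delta}$ if $j>r(\Delta)$. *)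

theory Defs
  imports Complex_Main "HOL-Library.Infinite_Typeclass" "Graph_Theory.Graph_Theory"
begin

text \<open>
  Finite simple graphs are the symmetric, loop-free finite pair digraphs of the locale
  \<open>pair_graph\<close>: an undirected edge $uv$ is represented by the two arcs $(u,v)$ and $(v,u)$.
  The library predicate \<open>tree\<close> is meant for directed graphs and counts the closed
  walk $u, v, u$ as a cycle, so no symmetric graph with an edge satisfies it; cycles of an
  undirected graph are the library cycles of length at least 3. The library predicate
  \<open>connected\<close> includes that the vertex set is nonempty.
\<close>

definition ugraph_tree :: "'a pair_pre_digraph \<Rightarrow> bool" where
  "ugraph_tree G \<longleftrightarrow> pair_graph G \<and> connected (with_proj G) \<and>
     \<not> (\<exists>p. pre_digraph.cycle (with_proj G) p \<and> length p \<ge> 3)"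

definition deg :: "'a pair_pre_digraph \<Rightarrow> 'a \<Rightarrow> nat" where
  "deg G v = out_degree (with_proj G) v"

definition max_deg :: "'a pair_pre_digraph \<Rightarrow> nat" where
  "max_deg G = Max (deg G ` pverts G)"

text \<open>Every edge contributes through both of its arcs, hence the (exact) division by 2.\<close>

definition sigma :: "'a pair_pre_digraph \<Rightarrow> int" where
  "sigma G = (\<Sum>(u, v)\<in>parcs G. (int (deg G u) - int (deg G v))\<^sup>2) div 2"

definition trees :: "nat \<Rightarrow> nat \<Rightarrow> 'a pair_pre_digraph set" where
  "trees n \<Delta> = {T. ugraph_tree T \<and> card (pverts T) = n \<and> max_deg T = \<Delta>}"

definition maximal_tree :: "'a pair_pre_digraph \<Rightarrow> bool" where
  "maximal_tree T \<longleftrightarrow> ugraph_tree T \<and>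
     (\<forall>T'\<in>(trees (card (pverts T)) (max_deg T) :: 'a pair_pre_digraph set). sigma T' \<le> sigma T)"

definition n_deg :: "'a pair_pre_digraph \<Rightarrow> nat \<Rightarrow> nat" where
  "n_deg T i = card {v \<in> pverts T. deg T v = i}"

definition m_deg :: "'a pair_pre_digraph \<Rightarrow> nat \<Rightarrow> nat \<Rightarrow> nat" where
  "m_deg T i j = card {{u, v} | u v. (u, v) \<in> parcs T \<and> deg T u = i \<and> deg T v = j}"

definition internal_leaf :: "'a pair_pre_digraph \<Rightarrow> 'a \<Rightarrow> bool" where
  "internal_leaf T v \<longleftrightarrow> v \<in> pverts T \<and> deg T v \<ge> 2 \<and>
     card {u. (v, u) \<in> parcs T \<and> deg T u > 1} = 1"

definition medium_vertex :: "'a pair_pre_digraph \<Rightarrow> 'a \<Rightarrow> bool" where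
  "medium_vertex T v \<longleftrightarrow> v \<in> pverts T \<and> deg T v \<in> {3..<max_deg T}"

definition nice_tree :: "'a pair_pre_digraph \<Rightarrow> bool" where
  "nice_tree T \<longleftrightarrow> ugraph_tree T \<and>
     (\<forall>(u, v)\<in>parcs T. (int (deg T u) - int (deg T v))\<^sup>2
        \<in> {(int (max_deg T) - 1)\<^sup>2, (int (max_deg T) - 2)\<^sup>2})"

text \<open>
  The families are indexed by $\Delta$, $k$ and $j$, which determine the number of vertices
  $n = k\Delta + 1 + j$.
\<close>

definition family1 :: "nat \<Rightarrow> nat \<Rightarrow> nat \<Rightarrow> 'a pair_pre_digraph set" where
  "family1 \<Delta> k j = {T \<in> trees (k * \<Delta> + 1 + j) \<Delta>.
     (\<forall>v. internal_leaf T v \<longrightarrow> deg T v = \<Delta>) \<and>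
     m_deg T 2 2 \<le> 2 \<and> m_deg T \<Delta> \<Delta> = 0 \<and>
     (\<Sum>i\<in>{3..<\<Delta>}. n_deg T i) \<le> 1 \<and>
     (m_deg T 2 2 = 0 \<longleftrightarrow>
        (\<exists>a\<in>{3..<\<Delta>}. (\<Sum>i\<in>{3..<\<Delta>}. n_deg T i) = n_deg T a \<and> n_deg T a = 1)) \<and>
     (m_deg T 2 2 = 0 \<longrightarrow> (\<forall>a\<in>{3..<\<Delta>}. n_deg T a = 1 \<longrightarrow> m_deg T a 2 = a))}"

definition family2 :: "nat \<Rightarrow> nat \<Rightarrow> nat \<Rightarrow> 'a pair_pre_digraph set" where
  "family2 \<Delta> k j = {T \<in> trees (k * \<Delta> + 1 + j) \<Delta>.
     (\<forall>v. internal_leaf T v \<longrightarrow> deg T v = \<Delta>) \<and>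
     (\<forall>v\<in>pverts T. deg T v \<in> {1, 2, \<Delta>}) \<and>
     m_deg T 2 2 = 0 \<and> m_deg T \<Delta> \<Delta> \<le> \<Delta> - 1}"

definition family3 :: "nat \<Rightarrow> nat \<Rightarrow> nat \<Rightarrow> 'a pair_pre_digraph set" where
  "family3 \<Delta> k j = {T \<in> trees (k * \<Delta> + 1 + j) \<Delta>. 2 \<le> j \<and> j \<le> \<Delta> - 2 \<and>
     (\<forall>v. internal_leaf T v \<longrightarrow> deg T v = \<Delta>) \<and>
     m_deg T 2 2 = 0 \<and> m_deg T \<Delta> \<Delta> = 0 \<and>
     (\<exists>w. medium_vertex T w \<and> deg T w = j + 1 \<and>
        (\<forall>v\<in>pverts T - {w}. deg T v \<in> {1, 2, \<Delta>}) \<and>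
        card {u. (w, u) \<in> parcs T \<and> deg T u = 2} = j \<and>
        card {u. (w, u) \<in> parcs T \<and> deg T u = \<Delta>} = 1)}"

text \<open>
  The common value of \<^const>\<open>sigma\<close> on a family, specified only if the family is nonempty and
  \<^const>\<open>sigma\<close> is constant on it.
\<close>

definition common_sigma :: "'a pair_pre_digraph set \<Rightarrow> int" where
  "common_sigma F = (THE s. sigma ` F = {s})"

definition r_threshold :: "nat \<Rightarrow> real" where
  "r_threshold \<Delta> = (sqrt (5 * real \<Delta> ^ 2 - 32 * real \<Delta> + 44) - real \<Delta> + 4) / 2"

definition family :: "nat \<Rightarrow> nat \<Rightarrow> nat \<Rightarrow> 'a pair_pre_digraph set" where
  "family \<Delta> k j =
     (if j = 0 then family2 \<Delta> k j
      else if j = 2 \<and> \<Delta> \<ge> 7 \<or> \<Delta> = 8 \<and> j = 3 then family3 \<Delta> k j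
      else if \<Delta> = 6 \<and> j = 2 then family2 \<Delta> k j \<union> family3 \<Delta> k j
      else if \<Delta> = 9 \<and> j = 3 then family1 \<Delta> k j \<union> family3 \<Delta> k j
      else if real j < r_threshold \<Delta> then family1 \<Delta> k j
      else if real j = r_threshold \<Delta> then family1 \<Delta> k j \<union> family2 \<Delta> k j
      else family2 \<Delta> k j)"

text \<open>The value of \<^const>\<open>sigma\<close> on nice trees with $k\Delta + 1$ vertices.\<close>

definition nice_sigma :: "nat \<Rightarrow> nat \<Rightarrow> int" where
  "nice_sigma \<Delta> k = int \<Delta> ^ 3 * int k - 2 * int \<Delta> ^ 2 * int k - 3 * int \<Delta> * int k
     + 6 * int k + 4 * int \<Delta> - 6"

end

theory Submission
  imports Defs
begin

text \<open>
  Write \<open>P d = (d - 1) (d - 2) (2\<Delta> - 3 - d)\<close>. For a tree of maximum degree \<open>\<Delta>\<close> the sum of \<open>\<sigma>\<close>,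
  of \<open>P (d v)\<close> over all vertices and of \<open>2 (\<Delta> - d u) (\<Delta> - d v)\<close> over all edges depends on the number of
  vertices only, so maximal trees minimise a sum of nonnegative costs, which vertices of degree 1 and 2
  and edges with an end of degree \<open>\<Delta>\<close> do not enter. Counting edges by their ends of degree \<open>\<Delta>\<close> shows
  that a tree with \<open>k - t\<close> vertices of degree \<open>\<Delta>\<close>, \<open>t \<ge> 0\<close>, has at least \<open>t\<Delta> + j\<close> edges without such
  an end. With at least \<open>k + 1\<close> vertices of degree \<open>\<Delta>\<close> the optimum is visibly the family \<open>T''\<close>. For
  \<open>t = 0\<close>, rooting the tree at a medium vertex of largest degree shows that at most one medium vertex,
  lying on all these edges, is best. For \<open>t > 0\<close> each such edge is assigned to its end of larger degree, and a
  vertex with at least about \<open>2\<Delta>/3\<close> assigned edges already costs more than the vertex of degree \<open>\<Delta>\<close> it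
  replaces, while all the others pay too much per edge.
\<close>

subsection \<open>The cost polynomials\<close>

text \<open>\<open>vertex_cost D\<close> is P. With x = D - d(u) and y = D - d(v), the square (d(u)
  - d(v))^2 is x^2 + y^2 - 2xy, so \<sigma> is the vertex sum of d (D - d)^2 minus the edge terms
  2xy. The sum of a linear function of the degrees depends on the number of vertices only. P is the
  line that agrees with d (D - d)^2 at d = 1 and d = 2, minus this cubic; the coefficient -2D of d^2
  puts the third root at 2D - 3. Equality cases have to be tracked, and single edges do not decide
  them: an edge joining two medium vertices is cheaper than the edges of an optimal tree. Rooting
  helps because every vertex other than the root has one parent edge, so its own cost can make up
  for the defect of that edge. The threshold near 2D/3 comes with a price per edge:
  \<open>vertex_cost D D\<close> = (D - 1)(D - 2)(D - 3) spread over (2D - 2)/3 edges is 3(D - 2)(D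
  - 3)/2 for each. The D edges forced by a missing vertex of degree D cost more than that vertex at
  this price.\<close>

definition vertex_cost :: "int \<Rightarrow> int \<Rightarrow> int" where
  "vertex_cost D d = (d - 1) * (d - 2) * (2 * D - 3 - d)"

text \<open>
  The cost of one vertex of degree \<open>a\<close> with \<open>z\<close> neighbours of degree 2 and the others of degree \<open>D\<close>.
  An edge between two medium vertices is cheaper than one between a medium vertex and a vertex of
  degree 2; the difference is charged to the child end, whose degree is \<open>b\<close> in \<open>charged_cost\<close>.
\<close>

definition star_cost :: "int \<Rightarrow> int \<Rightarrow> int \<Rightarrow> int" where
  "star_cost D a z = vertex_cost D a + 2 * z * (D - a) * (D - 2)"

definition charged_cost :: "int \<Rightarrow> int \<Rightarrow> int \<Rightarrow> int" where
  "charged_cost D b z = star_cost D b z - 2 * (D - b) * (b - 2)"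

text \<open>
  For \<open>j = 1\<close> there is no vertex of degree \<open>j\<close> to take as centre: the only lean edge of a tree of the
  first family then joins two vertices of degree 2, and either of them serves as centre.
\<close>

definition family1_cost :: "int \<Rightarrow> int \<Rightarrow> int" where
  "family1_cost D j = star_cost D (max 2 j) j"

definition family2_cost :: "int \<Rightarrow> int \<Rightarrow> int" where
  "family2_cost D j = (if j = 0 then 0 else vertex_cost D D)"

text \<open>Where the third family is absent, its entry repeats the cost of the second, which leaves
  the minimum unchanged.\<close>

definition best_cost :: "int \<Rightarrow> int \<Rightarrow> int" where
  "best_cost D j = (if j = 0 then 0 else
     min (min (family1_cost D j) (family2_cost D j)) (if 2 \<le> j \<and> j \<le> D - 2 then star_cost D (j + 1) j else vertex_cost D D))"

text \<open>At a = D the edge term vanishes and the star costs \<open>vertex_cost D D\<close>,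
  whence the factor D - a. The sign of the cofactor compares a star with the second family, and that
  in \<open>star_cost_minus_diag\<close> compares it with the first.\<close>

lemma star_cost_minus_vertex_cost:
  "star_cost D a z - vertex_cost D D = (D - a) * (a^2 - D * a - D^2 + 6 * D - 7 + 2 * z * (D - 2))"
  unfolding star_cost_def vertex_cost_def by (simp add: algebra_simps power2_eq_square)

lemma star_cost_minus_diag:
  "star_cost D a z - star_cost D z z = (a - z) * (2 * D * a - a^2 - a * z - z^2 + 4 * z - 6 * D + 7)"
  unfolding star_cost_def vertex_cost_def by (simp add: algebra_simps power2_eq_square)

lemma family1_cost_diag: "1 \<le> j \<Longrightarrow> family1_cost D j = (if j = 1 then 2 * (D - 2)^2 else star_cost D j j)"
  unfolding family1_cost_def star_cost_def vertex_cost_def by (auto simp: max_def power2_eq_square)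

lemma best_cost_le:
  assumes "1 \<le> j"
  shows "best_cost D j \<le> family1_cost D j" "best_cost D j \<le> vertex_cost D D" "2 \<le> j \<Longrightarrow> j \<le> D - 2 \<Longrightarrow> best_cost D j \<le> star_cost D (j + 1) j"
  using assms by (auto simp: best_cost_def family2_cost_def)

lemma vertex_cost_top_pos: "4 \<le> D \<Longrightarrow> 0 < vertex_cost D D"
  unfolding vertex_cost_def by simp

text \<open>X and Y are the two cofactors; if either is positive, the star loses against a family.
  Their sum (D - j)(a + j - D) settles a + j > D. Below that Y is positive by direct estimate,
  except for D = 6, j = 2, a = 4, which is evaluated. For j = 1 the cost of the first family is not
  \<open>star_cost D j j\<close> and is compared separately.\<close>

lemma best_cost_less_off_diagonal:
  assumes D: "6 \<le> D" and a: "3 \<le> a" "a < D" and j: "1 \<le> j" "j \<le> a"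
    and off: "a \<noteq> j" "\<not> (a = j + 1 \<and> 2 \<le> j)"
  shows "best_cost D j < star_cost D a j"
proof -
  define X where "X = a^2 - D * a - D^2 + 6 * D - 7 + 2 * j * (D - 2)"
  define Y where "Y = 2 * D * a - a^2 - a * j - j^2 + 4 * j - 6 * D + 7"
  have XY: "X + Y = (D - j) * (a + j - D)"
    unfolding X_def Y_def by (simp add: algebra_simps power2_eq_square)
  have X: "best_cost D j < star_cost D a j" if "0 < X"
  proof -
    have "0 < (D - a) * X" using that a by simp
    then show ?thesis using star_cost_minus_vertex_cost[of D a j] best_cost_le(2)[OF j(1), of D]
      unfolding X_def by linarith
  qed
  have aj: "j + 1 \<le> a" using j off by simp
  have Y: "best_cost D j < star_cost D a j" if "0 < Y" "2 \<le> j"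
  proof -
    have "0 < (a - j) * Y" using that aj by simp
    then show ?thesis using star_cost_minus_diag[of D a j] best_cost_le(1)[OF j(1), of D] that(2)
      unfolding Y_def family1_cost_def by (simp add: max_def split: if_splits)
  qed
  show ?thesis
  proof (cases "j = 1")
    case True
    have "star_cost D a 1 - 2 * (D - 2)^2 = (a - 2) * ((a - 3) * (2 * D - a - 5) + 2 * D - 8)"
      unfolding star_cost_def vertex_cost_def by (simp add: algebra_simps power2_eq_square)
    moreover have "0 < (a - 2) * ((a - 3) * (2 * D - a - 5) + 2 * D - 8)"
    proof (rule mult_pos_pos)
      have "0 \<le> (a - 3) * (2 * D - a - 5)" using a D by (intro mult_nonneg_nonneg) auto
      then show "0 < (a - 3) * (2 * D - a - 5) + 2 * D - 8" using D by simp
    qed (use a in simp)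
    ultimately show ?thesis using True best_cost_le(1)[OF j(1), of D] family1_cost_diag[of 1 D] by simp
  next
    case False
    then have j2: "2 \<le> j" using j by simp
    then have a2: "j + 2 \<le> a" using off aj by auto
    show ?thesis
    proof (cases "D < a + j")
      case True
      then have "0 < X + Y" unfolding XY using a j by simp
      then show ?thesis using X Y j2 by linarith
    next
      case False
      \<comment> \<open>The last bracket is the value of Y at a = j + 2, the smallest degree left.
        It increases with D, whose smallest value here is 2j + 2.\<close>
      have Yeq: "Y = (a - j - 2) * (2 * D - 2 * j - 2 - a) + (2 * D * (j - 1) - 3 * j^2 - 2 * j + 3)"
        unfolding Y_def by (simp add: algebra_simps power2_eq_square)
      have n1: "0 \<le> (a - j - 2) * (2 * D - 2 * j - 2 - a)"
        using a a2 False by (intro mult_nonneg_nonneg) auto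
      show ?thesis
      proof (cases "j = 2")
        case True
        show ?thesis
        proof (cases "D = 6")
          case True
          then have "a = 4" using \<open>j = 2\<close> a2 False by auto
          then show ?thesis using True \<open>j = 2\<close>
            by (simp add: best_cost_def family1_cost_def family2_cost_def star_cost_def vertex_cost_def)
        next
          case False
          then have "0 < 2 * D * (j - 1) - 3 * j^2 - 2 * j + 3" using D True by simp
          then show ?thesis using Y j2 n1 Yeq by linarith
        qed
      next
        case False
        have "0 \<le> (2 * (D - 2 * j - 2)) * (j - 1)"
          using a2 \<open>\<not> D < a + j\<close> j2 by (intro mult_nonneg_nonneg) auto
        moreover have "0 \<le> (j - 3) * (j + 1)" using False j2 by (intro mult_nonneg_nonneg) auto
        moreover have "2 * D * (j - 1) - 3 * j^2 - 2 * j + 3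
            = (2 * (D - 2 * j - 2)) * (j - 1) + (j - 3) * (j + 1) + 2"
          by (simp add: algebra_simps power2_eq_square)
        ultimately show ?thesis using Y j2 n1 Yeq by linarith
      qed
    qed
  qed
qed

lemma star_cost_nonneg: "3 \<le> a \<Longrightarrow> a < D \<Longrightarrow> 0 \<le> z \<Longrightarrow> 0 \<le> star_cost D a z"
  unfolding star_cost_def vertex_cost_def by (intro add_nonneg_nonneg mult_nonneg_nonneg) auto

lemma best_cost_le_star_cost:
  assumes D: "6 \<le> D" and a: "3 \<le> a" "a < D" and j: "0 \<le> j" "j \<le> a"
  shows "best_cost D j \<le> star_cost D a j"
proof -
  consider "j = 0" | "j = a" | "2 \<le> j" "a = j + 1" | "1 \<le> j" "j \<noteq> a" "\<not> (a = j + 1 \<and> 2 \<le> j)"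
    using j by linarith
  then show ?thesis
  proof cases
    case 1
    then show ?thesis using star_cost_nonneg[OF a, of 0] by (simp add: best_cost_def)
  next
    case 2
    then show ?thesis using best_cost_le(1)[of j D] a by (simp add: family1_cost_def max_def)
  next
    case 3
    then show ?thesis using best_cost_le(3)[of j D] a by simp
  next
    case 4
    then show ?thesis using best_cost_less_off_diagonal[OF D a, of j] j by auto
  qed
qed

section \<open>Medium vertices charged with lean edges\<close>

lemma charged_cost_pos:
  assumes "3 \<le> b" "b < D" "0 \<le> z"
  shows "0 < charged_cost D b z"
proof -
  have "charged_cost D b z = (b - 2) * ((b - 3) * (2 * D - 3 - b) + 2 * (D - 3)) + 2 * z * (D - b) * (D - 2)"
    unfolding charged_cost_def star_cost_def vertex_cost_def by (simp add: algebra_simps)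
  moreover have "0 < (b - 2) * ((b - 3) * (2 * D - 3 - b) + 2 * (D - 3))"
    using assms by (intro mult_pos_pos add_nonneg_pos mult_nonneg_nonneg) auto
  moreover have "0 \<le> 2 * z * (D - b) * (D - 2)" using assms by (intro mult_nonneg_nonneg) auto
  ultimately show ?thesis by linarith
qed

text \<open>One more lean edge adds 2(D - b)(D - 2), the charge takes back 2(D - b)(b - 2), and 2(D
  - b)^2 remains. So a vertex with z + 1 edges still costs more after its charge than an uncharged
  star with z.\<close>

lemma charged_cost_succ: "charged_cost D b (z + 1) = star_cost D b z + 2 * (D - b)^2"
  unfolding charged_cost_def star_cost_def by (simp add: algebra_simps power2_eq_square)

lemma charged_cost_mono: "b < D \<Longrightarrow> 2 \<le> D \<Longrightarrow> z \<le> z' \<Longrightarrow> charged_cost D b z \<le> charged_cost D b z'"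
  unfolding charged_cost_def star_cost_def by (simp add: mult_right_mono mult_left_mono)

text \<open>An expansion around b and z near 2D/3, with 9 clearing the denominators. The factor D -
  b appears because edge term and charge both vanish at b = D.\<close>

lemma charged_cost_minus_vertex_cost:
  "9 * (charged_cost D b z - vertex_cost D D) = (D - b) *
    ((3 * b - 2 * D + 2) * (3 * b - D - 8) + (6 * (D - 2)) * (3 * z - 2 * D + 3) + D^2 - 2 * D + 25)"
  unfolding charged_cost_def star_cost_def vertex_cost_def by (simp add: algebra_simps power2_eq_square)

text \<open>For e = 3b - 2D + 2 this is the product (3b - 2D + 2)(3b - D - 8) of the expansion. It
  is negative only for e + D < 10, which leaves finitely many cases; the term D^2 - 2D + 25 absorbs
  the deficit.\<close>

lemma charged_cost_gap:
  assumes e: "0 \<le> (e::int)" and D: "6 \<le> D"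
  shows "-9 \<le> e * (e + D - 10)"
proof (cases "10 \<le> e + D")
  case True
  then show ?thesis using e by (smt (verit) mult_nonneg_nonneg)
next
  case False
  then have "e \<in> {0..3}" "D \<in> {6..9}" using e D by auto
  moreover have "{0..3::int} = {0,1,2,3}" "{6..9::int} = {6,7,8,9}" by auto
  ultimately show ?thesis by auto
qed

lemma charged_cost_gt_vertex_cost:
  assumes D: "6 \<le> D" and b: "b < D" and z: "2 * D - 2 \<le> 3 * z" "z \<le> b"
  shows "vertex_cost D D < charged_cost D b z"
proof -
  define e where "e = 3 * b - 2 * D + 2"
  have e: "0 \<le> e" using z by (simp add: e_def)
  have "-9 \<le> e * (e + D - 10)" using e D by (rule charged_cost_gap)
  moreover have "(3 * b - 2 * D + 2) * (3 * b - D - 8) = e * (e + D - 10)" unfolding e_def by simp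
  moreover have "0 \<le> (6 * (D - 2)) * (3 * z - 2 * D + 3)" using D z by (intro mult_nonneg_nonneg) auto
  moreover have "D^2 - 2 * D + 25 = D * (D - 2) + 25" by (simp add: algebra_simps power2_eq_square)
  moreover have "0 \<le> D * (D - 2)" using D by simp
  ultimately have "0 < (3 * b - 2 * D + 2) * (3 * b - D - 8) + (6 * (D - 2)) * (3 * z - 2 * D + 3)
      + D^2 - 2 * D + 25" by linarith
  then have "0 < 9 * (charged_cost D b z - vertex_cost D D)"
    unfolding charged_cost_minus_vertex_cost using b by simp
  then show ?thesis by simp
qed

text \<open>The cost is affine in z. As its value at z = 0 is positive for medium degrees, the cost
  per edge falls with growing z, and lower bounds for it need checking at the largest z
  only.\<close>

lemma charged_cost_interpolate:
  "y * charged_cost D b z = (y - z) * charged_cost D b 0 + z * charged_cost D b y"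
  unfolding charged_cost_def star_cost_def by (simp add: algebra_simps)

text \<open>By interpolation it is enough to treat the largest admissible z: b itself if 3b \<le> 2D
  - 3, and (2D - 3)/3 otherwise.\<close>

lemma charged_cost_rate:
  assumes D: "6 \<le> D" and b: "3 \<le> b" "b < D" and z: "0 \<le> z" "z \<le> b" "3 * z \<le> 2 * D - 3"
  shows "3 * (D - 2) * (D - 3) * z \<le> 2 * charged_cost D b z"
proof (cases "3 * b \<le> 2 * D - 3")
  case True
  have "3 * (D - 2) * (D - 3) * b \<le> 2 * charged_cost D b b"
  proof -
    have eq: "2 * charged_cost D b b - 3 * (D - 2) * (D - 3) * b
      = b * (D^2 - 5 * D + 4 - 2 * (b - 2)^2) + 2 * (4 * D - 6) - 4 * (D - b) * (b - 2)"
      unfolding charged_cost_def star_cost_def vertex_cost_def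
        by (simp add: algebra_simps power2_eq_square)
    \<comment> \<open>\<open>u\<close> and \<open>v\<close> are the slacks of 3 \<le> b and 3b \<le>
      2D - 3. In them 4E has nonnegative coefficients only; the factor 4 lets D enter through 2D = v
      + 3u + 12.\<close>
    define u where "u = b - 3"
    define v where "v = 2 * D - 3 - 3 * b"
    have uv: "0 \<le> u" "0 \<le> v" using b True by (auto simp: u_def v_def)
    have b': "b = u + 3" and D2: "2 * D = v + 3 * u + 12" by (auto simp: u_def v_def)
    define E where "E = b * (D^2 - 5 * D + 4 - 2 * (b - 2)^2) + 2 * (4 * D - 6) - 4 * (D - b) * (b - 2)"
    have "4 * E = 4 * (b * (D^2 - 5 * D + 4 - 2 * (b - 2)^2) + 2 * (4 * D - 6) - 4 * (D - b) * (b - 2))"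
      unfolding E_def ..
    also have "\<dots> = b * ((2 * D)^2 - 10 * (2 * D) + 16 - 8 * (b - 2)^2) + 16 * (2 * D) - 48 - 8 * (2 * D - 2 * b) * (b - 2)"
      by (simp add: algebra_simps power2_eq_square)
    also have "\<dots> = (u + 3) * (v^2 + 6*u*v + u^2 + 14*v + 26*u + 32) + 16 * (v + 3*u + 12) - 48 - 8 * (v + u + 6) * (u + 1)"
      unfolding D2 b' by (simp add: algebra_simps power2_eq_square)
    also have "\<dots> = u * v^2 + 3 * v^2 + 6 * u^2 * v + 24 * u * v + 50 * v + u^3 + 21 * u^2 + 102 * u + 192"
      by (simp add: algebra_simps power2_eq_square power3_eq_cube)
    also have "\<dots> \<ge> 0" using uv by (intro add_nonneg_nonneg mult_nonneg_nonneg zero_le_power) auto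
    finally have "0 \<le> E" by simp
    then show ?thesis using eq unfolding E_def by (metis diff_ge_0_iff_ge)
  qed
  then have "z * (3 * (D - 2) * (D - 3) * b) \<le> z * (2 * charged_cost D b b)"
    using z by (intro mult_left_mono) auto
  moreover have "0 \<le> (b - z) * charged_cost D b 0" using charged_cost_pos[of b D 0] b z by simp
  moreover have "b * (2 * charged_cost D b z) = 2 * ((b - z) * charged_cost D b 0) + z * (2 * charged_cost D b b)"
    using charged_cost_interpolate[of b D b z] by (simp add: algebra_simps)
  ultimately have "b * (3 * (D - 2) * (D - 3) * z) \<le> b * (2 * charged_cost D b z)"
    by (simp add: mult.commute mult.left_commute)
  then show ?thesis using b by (simp add: mult_le_cancel_left)
next
  case False
  define e where "e = 3 * b - 2 * D + 2"
  \<comment> \<open>Three times the charged cost at z = (2D - 3)/3, which need not be an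
    integer.\<close>
  define w where "w = 3 * charged_cost D b 0 + 2 * (2 * D - 3) * (D - b) * (D - 2)"
  have "0 \<le> e" using False by (simp add: e_def)
  then have e: "-9 \<le> e * (e + D - 10)" using D by (rule charged_cost_gap)
  have "3 * (w - 3 * vertex_cost D D) = (D - b) * (e * (e + D - 10) + D * (D - 2) + 25)"
    unfolding w_def e_def charged_cost_def star_cost_def vertex_cost_def
      by (simp add: algebra_simps power2_eq_square)
  moreover have "0 \<le> (D - b) * (e * (e + D - 10) + D * (D - 2) + 25)"
  proof (rule mult_nonneg_nonneg)
    have "0 \<le> D * (D - 2)" using D by simp
    then show "0 \<le> e * (e + D - 10) + D * (D - 2) + 25" using e by linarith
  qed (use b in simp)
  ultimately have "0 \<le> 3 * (w - 3 * vertex_cost D D)" by simp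
  then have "3 * vertex_cost D D \<le> w" by simp
  moreover have "6 * vertex_cost D D = 3 * (D - 2) * (D - 3) * (2 * D - 3) + 3 * (D - 2) * (D - 3)"
    unfolding vertex_cost_def by (simp add: algebra_simps)
  moreover have "0 \<le> 3 * (D - 2) * (D - 3)" using D by simp
  ultimately have "3 * (D - 2) * (D - 3) * (2 * D - 3) \<le> 2 * w" by linarith
  then have "z * (3 * (D - 2) * (D - 3) * (2 * D - 3)) \<le> z * (2 * w)"
    using z by (intro mult_left_mono) auto
  moreover have "0 \<le> (2 * D - 3 - 3 * z) * charged_cost D b 0"
    using charged_cost_pos[of b D 0] b z by simp
  moreover have "(2 * D - 3) * (2 * charged_cost D b z) = 2 * ((2 * D - 3 - 3 * z) * charged_cost D b 0) + z * (2 * w)"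
    unfolding w_def charged_cost_def star_cost_def by (simp add: algebra_simps)
  ultimately have "(2 * D - 3) * (3 * (D - 2) * (D - 3) * z) \<le> (2 * D - 3) * (2 * charged_cost D b z)"
    by (simp add: mult.commute mult.left_commute)
  then show ?thesis using D by (simp add: mult_le_cancel_left)
qed

lemma small_edge_rate: "6 \<le> D \<Longrightarrow> 3 * (D - 2) * (D - 3) \<le> 2 * (2 * (D - 2)^2)" for D :: int
proof -
  assume D: "6 \<le> D"
  have "2 * (2 * (D - 2)^2) - 3 * (D - 2) * (D - 3) = (D - 2) * (D + 1)"
    by (simp add: algebra_simps power2_eq_square)
  moreover have "0 \<le> (D - 2) * (D + 1)" using D by simp
  ultimately show ?thesis by linarith
qed

text \<open>The bound is the cost of j edges between vertices of degree 2, formally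
  \<open>star_cost D 2 j\<close>. Passing to a centre of degree j saves a multiple of j - 2, which
  is why \<open>best_cost_less_edges\<close> is strict from j = 3 on.\<close>

lemma best_cost_le_edges:
  assumes D: "6 \<le> D" and j: "0 \<le> j" "j < D"
  shows "best_cost D j \<le> 2 * j * (D - 2)^2"
proof -
  consider "j = 0" | "j = 1" | "2 \<le> j" using j by linarith
  then show ?thesis
  proof cases
    case 3
    have "2 * j * (D - 2)^2 - star_cost D j j = (j - 2) * (2 * j * (D - 2) - (j - 1) * (2 * D - 3 - j))"
      unfolding star_cost_def vertex_cost_def by (simp add: algebra_simps power2_eq_square)
    also have "2 * j * (D - 2) - (j - 1) * (2 * D - 3 - j) = j * (j - 2) + 2 * D - 3"
      by (simp add: algebra_simps)
    also have "0 \<le> (j - 2) * (j * (j - 2) + 2 * D - 3)"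
      using 3 D j by (intro mult_nonneg_nonneg) (auto simp: add_increasing)
    finally show ?thesis
      using best_cost_le(1)[of j D] 3 by (simp add: family1_cost_def max_def split: if_splits)
  qed (use best_cost_le(1)[of j D] family1_cost_diag[of j D] in \<open>auto simp: best_cost_def\<close>)
qed

lemma best_cost_less_edges:
  assumes D: "6 \<le> D" and j: "3 \<le> j" "j < D"
  shows "best_cost D j < 2 * j * (D - 2)^2"
proof -
  have "2 * j * (D - 2)^2 - star_cost D j j = (j - 2) * (j * (j - 2) + 2 * D - 3)"
    unfolding star_cost_def vertex_cost_def by (simp add: algebra_simps power2_eq_square)
  moreover have "0 \<le> j * (j - 2)" using j by simp
  ultimately have "star_cost D j j < 2 * j * (D - 2)^2" using D j
    by (smt (verit) mult_pos_pos)
  then show ?thesis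
    using best_cost_le(1)[of j D] j by (simp add: family1_cost_def max_def split: if_splits)
qed

text \<open>If one vertex of degree D is missing, the D + j lean edges it forces are, even at the
  coarse price, dearer than the saving and the optimum together. The optimum is estimated by
  \<open>vertex_cost D D\<close> if j is at least D/3 and by 2j (D - 2)^2 if not.\<close>

lemma rate_excess:
  assumes D: "6 \<le> D" and j: "0 \<le> j" "j < D"
  shows "2 * (vertex_cost D D + best_cost D j) < 3 * (D - 2) * (D - 3) * (D + j)"
proof (cases "D \<le> 3 * j")
  case True
  have "0 < (D - 2) * (D - 3) * (3 * (D + j) - 4 * (D - 1))" using D True by simp
  moreover have "3 * (D - 2) * (D - 3) * (D + j) - 4 * vertex_cost D D = (D - 2) * (D - 3) * (3 * (D + j) - 4 * (D - 1))"
    unfolding vertex_cost_def by (simp add: algebra_simps)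
  ultimately show ?thesis using best_cost_le(2)[of j D] True D by (smt (verit))
next
  case False
  define E where "E = (D - 2) * (D^2 - D - 6 - j * (D + 1))"
  have eq: "3 * (D - 2) * (D - 3) * (D + j) = 2 * (vertex_cost D D + 2 * j * (D - 2)^2) + E"
    unfolding vertex_cost_def E_def by (simp add: algebra_simps power2_eq_square)
  have "3 * (j * (D + 1)) \<le> (D - 1) * (D + 1)"
    unfolding mult.assoc[symmetric] using False D by (intro mult_right_mono) auto
  moreover have "3 * (D^2 - D - 6) - (D - 1) * (D + 1) = D * (2 * D - 3) - 17"
    by (simp add: algebra_simps power2_eq_square)
  moreover have "6 * 9 \<le> D * (2 * D - 3)" using D by (intro mult_mono) auto
  ultimately have "0 < 3 * (D^2 - D - 6 - j * (D + 1))" by (smt (verit))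
  then have "0 < D^2 - D - 6 - j * (D + 1)" by simp
  then have "0 < E" using D by (simp add: E_def)
  moreover have "2 * (vertex_cost D D + best_cost D j) \<le> 2 * (vertex_cost D D + 2 * j * (D - 2)^2)"
    using best_cost_le_edges[OF D j] by simp
  ultimately show ?thesis unfolding eq by (smt (verit))
qed

text \<open>Makes room for charges: by \<open>charge_bound\<close> a charge is at most (D - 2)^2 /
  2, so j + 1 charges together do not exceed the best cost.\<close>

lemma best_cost_lower:
  assumes D: "6 \<le> D" and j: "1 \<le> j" "3 * (j + 1) \<le> 2 * D - 3"
  shows "(j + 1) * (D - 2)^2 \<le> 2 * best_cost D j"
proof -
  have P: "(j + 1) * (D - 2)^2 \<le> 2 * vertex_cost D D"
  proof -
    have "6 * vertex_cost D D - 3 * (j + 1) * (D - 2)^2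
       = (D - 2) * ((D - 2) * (2 * D - 3 - 3 * (j + 1)) + D * (4 * D - 17) + 12)"
      unfolding vertex_cost_def by (simp add: algebra_simps power2_eq_square)
    also have "0 \<le> \<dots>" using D j by (intro mult_nonneg_nonneg add_nonneg_nonneg) auto
    finally show ?thesis by linarith
  qed
  have F: "(j + 1) * (D - 2)^2 \<le> 2 * star_cost D a j" if "j \<le> a" "a \<le> j + 1" "2 \<le> j" "a < D" for a
  proof -
    have "0 \<le> vertex_cost D a" unfolding vertex_cost_def using that j by (intro mult_nonneg_nonneg) auto
    then have "4 * j * (D - a) * (D - 2) \<le> 2 * star_cost D a j" unfolding star_cost_def by simp
    moreover have "(j + 1) * (D - 2) \<le> 4 * j * (D - (j + 1))"
    proof -
      define E where "E = 4 * j * (D - (j + 1)) - (j + 1) * (D - 2)"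
      have "2 * E = (2 * D - 3 * j - 6) * (3 * j - 1) + j * j + 11 * j - 2"
        unfolding E_def by (simp add: algebra_simps)
      moreover have "0 \<le> (2 * D - 3 * j - 6) * (3 * j - 1)" using j by (intro mult_nonneg_nonneg) auto
      moreover have "0 \<le> j * j" by simp
      ultimately have "0 \<le> E" using j by linarith
      then show ?thesis unfolding E_def by simp
    qed
    moreover have "4 * j * (D - (j + 1)) \<le> 4 * j * (D - a)" using that by (intro mult_left_mono) auto
    ultimately have "(j + 1) * (D - 2) * (D - 2) \<le> 4 * j * (D - a) * (D - 2)" using D
      by (intro mult_right_mono) auto
    then show ?thesis
      using \<open>4 * j * (D - a) * (D - 2) \<le> 2 * star_cost D a j\<close> by (simp add: power2_eq_square mult.assoc)
  qed
  have V: "(j + 1) * (D - 2)^2 \<le> 2 * family1_cost D j"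
  proof (cases "j = 1")
    case True
    then show ?thesis using family1_cost_diag[OF j(1), of D] by simp
  next
    case False
    then show ?thesis using F[of j] j D by (simp add: family1_cost_def max_def)
  qed
  show ?thesis unfolding best_cost_def family2_cost_def using P V F[of "j + 1"] j by (auto simp: min_def)
qed

text \<open>The inequality of arithmetic and geometric means for D - b and b - 2, whose sum is D -
  2.\<close>

lemma charge_bound: "2 * ((D - b) * (b - 2)) * 2 \<le> (D - 2)^2" for D b :: int
proof -
  have "(D - 2)^2 - 2 * ((D - b) * (b - 2)) * 2 = (D - 2 * b + 2)^2"
    by (simp add: algebra_simps power2_eq_square)
  then show ?thesis by (smt (verit) zero_le_power2)
qed

text \<open>A price of \<open>best_cost D j\<close> / (j + 1) per edge is what j + 1 edges must
  yield to pay for the optimum. By interpolation only the largest z matters: z = b for b \<le> j,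
  compared with the star of degree j, and z = j otherwise, where the star bound loses one charge and
  \<open>best_cost_lower\<close> covers it.\<close>

lemma charged_cost_fine_rate:
  assumes D: "6 \<le> D" and b: "3 \<le> b" "b < D" and z: "0 \<le> z" "z \<le> b" "z \<le> j"
    and j: "1 \<le> j" "3 * (j + 1) \<le> 2 * D - 3"
  shows "z * best_cost D j \<le> (j + 1) * charged_cost D b z"
proof -
  have *: ?thesis if "z \<le> y" "0 < y" "y * best_cost D j \<le> (j + 1) * charged_cost D b y" for y
  proof -
    have "z * (y * best_cost D j) \<le> z * ((j + 1) * charged_cost D b y)"
      using that z by (intro mult_left_mono) auto
    moreover have "0 \<le> (j + 1) * ((y - z) * charged_cost D b 0)"
      using charged_cost_pos[of b D 0] b j that by simp
    moreover have "y * ((j + 1) * charged_cost D b z) = (j + 1) * ((y - z) * charged_cost D b 0) + z * ((j + 1) * charged_cost D b y)"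
    proof -
      have "y * ((j + 1) * charged_cost D b z) = (j + 1) * (y * charged_cost D b z)"
        by (simp add: mult.left_commute)
      also have "\<dots> = (j + 1) * ((y - z) * charged_cost D b 0 + z * charged_cost D b y)"
        using charged_cost_interpolate[of y D b z] by simp
      finally show ?thesis by (simp add: algebra_simps)
    qed
    ultimately have "y * (z * best_cost D j) \<le> y * ((j + 1) * charged_cost D b z)"
      by (simp add: mult.left_commute)
    then show ?thesis using that by (simp add: mult_le_cancel_left)
  qed
  show ?thesis
  proof (cases "b \<le> j")
    case True
    have eq: "(j + 1) * charged_cost D b b - b * star_cost D j j
        = (j + 1 - b) * (4 * D - 6) + b * j * ((j - 2)^2 - (b - 2)^2) + 4 * (j + 1) * (D - b)
          + b * (2 * D^2 - 10 * D + 11 - (b - 2)^2 - 2 * (j + 1) * (D - b))"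
      unfolding charged_cost_def star_cost_def vertex_cost_def
        by (simp add: algebra_simps power2_eq_square)
    have "0 \<le> 2 * D^2 - 10 * D + 11 - (b - 2)^2 - 2 * (j + 1) * (D - b)"
    proof -
      define w where "w = (j + 1) * (D - b)"
      define E where "E = 2 * D^2 - 10 * D + 11 - (b - 2)^2"
      have "3 * w \<le> (2 * D - 3) * (D - b)"
        unfolding w_def mult.assoc[symmetric] using j b by (intro mult_right_mono) auto
      moreover have "3 * E - 2 * ((2 * D - 3) * (D - b))
          = 2 * D * (D - 6) + 12 + (b - 3) * (4 * D - 12 - 3 * (b - 3))"
        unfolding E_def by (simp add: algebra_simps power2_eq_square)
      moreover have "0 \<le> 2 * D * (D - 6)" using D by simp
      moreover have "0 \<le> (b - 3) * (4 * D - 12 - 3 * (b - 3))"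
        using b D by (intro mult_nonneg_nonneg) auto
      ultimately have "2 * w \<le> E" by linarith
      then show ?thesis unfolding E_def w_def by (simp only: mult.assoc diff_ge_0_iff_ge)
    qed
    moreover have "0 \<le> (j - 2)^2 - (b - 2)^2" using True b by (simp add: power_mono)
    ultimately have "b * star_cost D j j \<le> (j + 1) * charged_cost D b b"
      using eq True b j D by (smt (verit) mult_nonneg_nonneg)
    moreover have "b * best_cost D j \<le> b * star_cost D j j"
      using best_cost_le(1)[OF j(1), of D] True b by (intro mult_left_mono) (auto simp: family1_cost_def)
    ultimately have "b * best_cost D j \<le> (j + 1) * charged_cost D b b" by linarith
    then show ?thesis using *[of b] z b by linarith
  next
    case False
    have "best_cost D j \<le> star_cost D b j" using best_cost_le_star_cost[OF D b, of j] False j by simp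
    then have "(j + 1) * (best_cost D j - 2 * (D - b) * (b - 2)) \<le> (j + 1) * charged_cost D b j"
      unfolding charged_cost_def using j by (intro mult_left_mono) auto
    moreover have "(j + 1) * (4 * ((D - b) * (b - 2))) \<le> (j + 1) * (D - 2)^2"
      using charge_bound[of D b] j by (intro mult_left_mono) auto
    moreover have "(j + 1) * (best_cost D j - 2 * (D - b) * (b - 2)) = j * best_cost D j + best_cost D j - (j + 1) * (4 * ((D - b) * (b - 2))) div 2"
      by (simp add: algebra_simps)
    ultimately have "j * best_cost D j \<le> (j + 1) * charged_cost D b j"
      using best_cost_lower[OF D j] by linarith
    then show ?thesis using *[of j] z j by simp
  qed
qed


text \<open>\<open>t\<close> counts the missing vertices of degree D, \<open>z\<close> the edges
  assigned to medium vertices and \<open>A\<close> the lean edges without a medium end. Each of the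
  s vertices with z at least (2D - 2)/3 stands for one missing vertex; it takes at most D - 1 edges,
  so (t - s) D + j + s edges remain. For s > t the large vertices alone cost enough, for s < t the
  coarse price suffices, and for s = t the remaining j + 1 or more edges still have to pay
  \<open>best_cost D j\<close>.\<close>

lemma sum_charged_cost_gt:
  fixes b z :: "'v \<Rightarrow> int" and A t j D :: int
  assumes D: "6 \<le> D" and fin: "finite mediums"
    and mediums: "\<And>v. v \<in> mediums \<Longrightarrow> 3 \<le> b v \<and> b v < D \<and> 0 \<le> z v \<and> z v \<le> b v"
    and A: "0 \<le> A" and j: "0 \<le> j" "j < D" and t: "1 \<le> t"
    and total: "t * D + j \<le> (\<Sum>v\<in>mediums. z v) + A"
  shows "t * vertex_cost D D + best_cost D j < (\<Sum>v\<in>mediums. charged_cost D (b v) (z v)) + 2 * (D - 2)^2 * A"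
proof -
  define big where "big = {v \<in> mediums. 2 * D - 2 \<le> 3 * z v}"
  define small where "small = mediums - big"
  define s where "s = int (card big)"
  define Cs where "Cs = (\<Sum>v\<in>small. charged_cost D (b v) (z v)) + 2 * (D - 2)^2 * A"
  define m where "m = (\<Sum>v\<in>small. z v) + A"
  let ?R = "3 * (D - 2) * (D - 3)"
  have split: "(\<Sum>v\<in>mediums. f v) = (\<Sum>v\<in>big. f v) + (\<Sum>v\<in>small. f v)" for f :: "'v \<Rightarrow> int"
    unfolding small_def by (subst sum.subset_diff[of big mediums]) (auto simp: big_def fin)
  have finb: "finite big" "finite small" using fin by (auto simp: big_def small_def)
  \<comment> \<open>The 1 is strictness over the integers; its sum s makes the final inequality
    strict when s = t.\<close>
  have "(\<Sum>v\<in>big. vertex_cost D D + 1) \<le> (\<Sum>v\<in>big. charged_cost D (b v) (z v))"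
  proof (rule sum_mono)
    fix v assume "v \<in> big"
    then have "v \<in> mediums" "2 * D - 2 \<le> 3 * z v" by (auto simp: big_def)
    then show "vertex_cost D D + 1 \<le> charged_cost D (b v) (z v)"
      using charged_cost_gt_vertex_cost[OF D, of "b v" "z v"] mediums[of v] by simp
  qed
  then have Cb: "s * (vertex_cost D D + 1) \<le> (\<Sum>v\<in>big. charged_cost D (b v) (z v))" by (simp add: s_def)
  have "(\<Sum>v\<in>big. z v) \<le> (\<Sum>v\<in>big. D - 1)"
    by (rule sum_mono) (use mediums in \<open>force simp: big_def\<close>)
  then have m: "(t - s) * D + j + s \<le> m"
    using total split[of z] by (simp add: s_def m_def algebra_simps)
  have P: "0 < vertex_cost D D" using D vertex_cost_top_pos by simp
  have A2: "0 \<le> 2 * (D - 2)^2 * A" using A by simp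
  have Cs0: "0 \<le> Cs" unfolding Cs_def
    by (intro add_nonneg_nonneg sum_nonneg A2) (use mediums charged_cost_pos in \<open>force simp: small_def\<close>)
  have s0: "0 \<le> s" by (simp add: s_def)
  have smallD: "v \<in> mediums" "3 * z v \<le> 2 * D - 3" if "v \<in> small" for v
    using that by (auto simp: small_def big_def)
  have rate: "?R * m \<le> 2 * Cs"
  proof -
    have "(\<Sum>v\<in>small. ?R * z v) \<le> (\<Sum>v\<in>small. 2 * charged_cost D (b v) (z v))"
      by (rule sum_mono) (use smallD mediums charged_cost_rate[OF D] in blast)
    moreover have "?R * A \<le> 2 * (2 * (D - 2)^2) * A"
      using small_edge_rate[OF D] A by (intro mult_right_mono) auto
    moreover have "?R * m = (\<Sum>v\<in>small. ?R * z v) + ?R * A"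
      by (simp only: m_def distrib_left sum_distrib_left)
    moreover have "2 * Cs = (\<Sum>v\<in>small. 2 * charged_cost D (b v) (z v)) + 2 * (2 * (D - 2)^2) * A"
      by (simp add: Cs_def sum_distrib_left)
    ultimately show ?thesis by linarith
  qed
  have best_cost: "best_cost D j \<le> vertex_cost D D"
    using P by (cases "j = 0") (auto simp: best_cost_def family2_cost_def)
  have "(t - s) * vertex_cost D D + best_cost D j < s + Cs"
  proof -
    consider "t < s" | "s < t" | "s = t" by linarith
    then show ?thesis
    proof cases
      case 1
      then have "(t - s) * vertex_cost D D \<le> (-1) * vertex_cost D D"
        using P by (intro mult_right_mono) auto
      then show ?thesis using best_cost Cs0 1 t by linarith
    next
      case 2
      \<comment> \<open>One missing vertex is kept together with the j extra edges for
        \<open>rate_excess\<close>; each of the other t - s - 1 is paid for by its own D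
        edges.\<close>
      have "?R * ((t - s - 1) * D + (D + j)) \<le> ?R * m"
      proof (rule mult_left_mono)
        show "(t - s - 1) * D + (D + j) \<le> m" using m s0 by (simp add: algebra_simps)
      qed (use D in simp)
      moreover have "2 * ((t - s - 1) * vertex_cost D D) \<le> ?R * ((t - s - 1) * D)"
      proof -
        have "?R * D - 2 * vertex_cost D D = (D - 2) * (D - 3) * (D + 2)"
          unfolding vertex_cost_def by (simp add: algebra_simps)
        moreover have "0 \<le> (D - 2) * (D - 3) * (D + 2)" using D by simp
        ultimately have "(t - s - 1) * (2 * vertex_cost D D) \<le> (t - s - 1) * (?R * D)"
          using 2 by (intro mult_left_mono) auto
        then show ?thesis by (simp only: ac_simps)
      qed
      moreover have "2 * (vertex_cost D D + best_cost D j) < ?R * (D + j)" by (rule rate_excess[OF D j])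
      moreover have "?R * ((t - s - 1) * D + (D + j)) = ?R * ((t - s - 1) * D) + ?R * (D + j)"
        by (simp only: distrib_left)
      ultimately have "2 * ((t - s - 1) * vertex_cost D D) + 2 * (vertex_cost D D + best_cost D j) < 2 * Cs" using rate by linarith
      then have "2 * ((t - s) * vertex_cost D D + best_cost D j) < 2 * Cs" by (simp add: algebra_simps)
      then have "(t - s) * vertex_cost D D + best_cost D j < Cs" by simp
      then show ?thesis using s0 by simp
    next
      case 3
      then have m1: "j + 1 \<le> m" using m t by simp
      have "best_cost D j \<le> Cs"
      proof -
        \<comment> \<open>A small vertex with more than j edges alone exceeds a star with j lean
          edges. If j + 1 reaches the threshold, the coarse price already yields
          \<open>vertex_cost D D\<close>. Otherwise the fine price applies to all small
          vertices.\<close>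
        consider "j = 0" | v where "v \<in> small" "j + 1 \<le> z v" | "1 \<le> j" "2 * D - 2 \<le> 3 * (j + 1)"
          | "1 \<le> j" "3 * (j + 1) \<le> 2 * D - 3" "\<And>v. v \<in> small \<Longrightarrow> z v \<le> j"
          using j by (smt (verit))
        then show ?thesis
        proof cases
          case 1
          then show ?thesis using Cs0 by (simp add: best_cost_def)
        next
          case (2 v)
          have Mv: "3 \<le> b v" "b v < D" "z v \<le> b v" using mediums smallD(1)[OF 2(1)] by auto
          have "best_cost D j \<le> star_cost D (b v) j"
            using best_cost_le_star_cost[OF D Mv(1,2)] 2 j Mv by simp
          also have "\<dots> \<le> charged_cost D (b v) (j + 1)" unfolding charged_cost_succ by simp
          also have "\<dots> \<le> charged_cost D (b v) (z v)" using charged_cost_mono Mv 2 D by simp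
          also have "\<dots> \<le> (\<Sum>v\<in>small. charged_cost D (b v) (z v))"
            by (rule member_le_sum) (use 2 finb mediums smallD charged_cost_pos in \<open>force+\<close>)
          finally show ?thesis unfolding Cs_def using A2 by linarith
        next
          case 3
          have "(D - 2) * (D - 3) * (2 * D - 2) \<le> (D - 2) * (D - 3) * (3 * (j + 1))"
            using 3 D by (intro mult_left_mono) auto
          moreover have "?R * (j + 1) \<le> ?R * m" using m1 D by (intro mult_left_mono) auto
          moreover have "2 * vertex_cost D D = (D - 2) * (D - 3) * (2 * D - 2)"
            unfolding vertex_cost_def by (simp add: algebra_simps)
          moreover have "(D - 2) * (D - 3) * (3 * (j + 1)) = ?R * (j + 1)" by (simp only: ac_simps)
          ultimately show ?thesis using rate best_cost by linarith
        next
          case 4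
          have "best_cost D j * m \<le> (j + 1) * Cs"
          proof -
            have "(\<Sum>v\<in>small. z v * best_cost D j) \<le> (\<Sum>v\<in>small. (j + 1) * charged_cost D (b v) (z v))"
              by (rule sum_mono) (use 4 smallD mediums charged_cost_fine_rate[OF D] in blast)
            moreover have "best_cost D j * A \<le> (j + 1) * (2 * (D - 2)^2) * A"
            proof (rule mult_right_mono)
              have "j * (2 * (D - 2)^2) \<le> (j + 1) * (2 * (D - 2)^2)" by (intro mult_right_mono) auto
              then show "best_cost D j \<le> (j + 1) * (2 * (D - 2)^2)"
                using best_cost_le_edges[OF D j] by (simp add: mult.left_commute)
            qed (use A in simp)
            ultimately show ?thesis unfolding m_def Cs_def
              by (simp add: sum_distrib_left sum_distrib_right algebra_simps)
          qed
          moreover have "0 \<le> best_cost D j"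
            using best_cost_lower[OF D 4(1,2)] 4(1) by (smt (verit) mult_nonneg_nonneg zero_le_power2)
          then have "best_cost D j * (j + 1) \<le> best_cost D j * m" using m1 by (intro mult_left_mono) auto
          ultimately have "(j + 1) * best_cost D j \<le> (j + 1) * Cs" by (simp add: mult.commute)
          then show ?thesis using 4 by (simp add: mult_le_cancel_left)
        qed
      qed
      then show ?thesis using 3 t by simp
    qed
  qed
  then have "t * vertex_cost D D + best_cost D j < s * (vertex_cost D D + 1) + Cs"
    by (simp add: algebra_simps)
  then show ?thesis using Cb split[of "\<lambda>v. charged_cost D (b v) (z v)"] unfolding Cs_def by linarith
qed

section \<open>Comparison of the three families\<close>

text \<open>\<open>q\<close> is a quadratic in j whose larger root is \<open>r_threshold\<close>.
  For j = 1 the difference of the costs is not (D - j) q, but it and q are both negative.\<close>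

lemma family1_cost_minus_vertex_cost:
  assumes D: "6 \<le> D" and j: "1 \<le> j" "j < D"
  defines "q \<equiv> j^2 + (D - 4) * j - D^2 + 6 * D - 7"
  shows "family1_cost D j < vertex_cost D D \<longleftrightarrow> q < 0" "family1_cost D j = vertex_cost D D \<longleftrightarrow> q = 0"
proof -
  have "family1_cost D j < vertex_cost D D \<and> q < 0 \<or> (family1_cost D j - vertex_cost D D = (D - j) * q)"
  proof (cases "j = 1")
    case True
    have "q = - ((D - 2) * (D - 5))" "vertex_cost D D - family1_cost D j = (D - 2) * ((D - 5) * (D - 1) + 2)"
      using True family1_cost_diag[of 1 D]
        unfolding q_def vertex_cost_def by (simp_all add: algebra_simps power2_eq_square)
    moreover have "0 < (D - 2) * (D - 5)" "0 < (D - 2) * ((D - 5) * (D - 1) + 2)"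
      using D by (auto intro!: mult_pos_pos add_pos_pos)
    ultimately show ?thesis by linarith
  next
    case False
    then show ?thesis using star_cost_minus_vertex_cost[of D j j] j
      by (simp add: family1_cost_def max_def q_def algebra_simps power2_eq_square)
  qed
  then show "family1_cost D j < vertex_cost D D \<longleftrightarrow> q < 0" "family1_cost D j = vertex_cost D D \<longleftrightarrow> q = 0"
    using j by (smt (verit) mult_neg_pos mult_pos_pos mult_eq_0_iff mult_nonneg_nonneg mult_pos_neg)+
qed

text \<open>The cofactors X and Y again, now at a = j + 1. For j = 3 one has Y = 2D - 18, so the
  first family loses against the third at D = 8 and ties with it at D = 9: these are the excluded
  pairs. At D = 7 the second family beats the third.\<close>

lemma family3_cost_not_best:
  assumes D: "6 \<le> D" and j: "3 \<le> j" "j \<le> D - 2" and ex: "\<not> (D = 8 \<and> j = 3)" "\<not> (D = 9 \<and> j = 3)"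
  shows "min (family1_cost D j) (vertex_cost D D) < star_cost D (j + 1) j"
proof -
  let ?a = "j + 1"
  define X where "X = ?a^2 - D * ?a - D^2 + 6 * D - 7 + 2 * j * (D - 2)"
  define Y where "Y = 2 * D * ?a - ?a^2 - ?a * j - j^2 + 4 * j - 6 * D + 7"
  have XY: "X + Y = (D - j) * (2 * j + 1 - D)"
    unfolding X_def Y_def by (simp add: algebra_simps power2_eq_square)
  have X: ?thesis if "0 < X"
  proof -
    have "0 < (D - ?a) * X" using that j by simp
    then show ?thesis using star_cost_minus_vertex_cost[of D ?a j] unfolding X_def by linarith
  qed
  have Y: ?thesis if "0 < Y"
    using star_cost_minus_diag[of D ?a j] that j unfolding Y_def family1_cost_def by (simp add: max_def)
  have Yeq: "Y = 2 * ((D - 2 * j - 1) * (j - 2)) + j * (j - 5) + 2"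
    unfolding Y_def by (simp add: algebra_simps power2_eq_square)
  consider "D < 2 * j + 1" | "2 * j + 1 \<le> D" "5 \<le> j" | "2 * j + 1 \<le> D" "j = 3" | "2 * j + 1 \<le> D" "j = 4"
    using j by linarith
  then show ?thesis
  proof cases
    case 1
    then have "0 < X + Y" unfolding XY using j by simp
    then show ?thesis using X Y by linarith
  next
    case 2
    have "0 \<le> (D - 2 * j - 1) * (j - 2)" "0 \<le> j * (j - 5)" using 2 by (auto intro!: mult_nonneg_nonneg)
    then show ?thesis using Y Yeq by linarith
  next
    case 3
    then consider "D = 7" | "10 \<le> D" using ex by fastforce
    then show ?thesis
      using 3 Y Yeq by cases (simp_all add: family1_cost_def star_cost_def vertex_cost_def)
  next
    case 4
    then consider "D = 9" | "10 \<le> D" by fastforce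
    then show ?thesis
      using 4 Y Yeq by cases (simp_all add: family1_cost_def star_cost_def vertex_cost_def)
  qed
qed

text \<open>The difference to the second family is -(D - 3)(D - 1)(D - 6); its zero at D = 6 is the
  tie behind the exceptional pair D = 6, j = 2.\<close>

lemma family3_cost_at_two:
  assumes D: "7 \<le> D"
  shows "star_cost D 3 2 < family1_cost D 2" "star_cost D 3 2 < vertex_cost D D"
proof -
  show "star_cost D 3 2 < family1_cost D 2"
    unfolding family1_cost_def star_cost_def vertex_cost_def by (simp add: algebra_simps)
  have "star_cost D 3 2 - vertex_cost D D = - ((D - 3) * ((D - 1) * (D - 6)))"
    unfolding star_cost_def vertex_cost_def by (simp add: algebra_simps)
  moreover have "0 < (D - 3) * ((D - 1) * (D - 6))" using D by simp
  ultimately show "star_cost D 3 2 < vertex_cost D D" by linarith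
qed

subsection \<open>Trees as parent functions\<close>

text \<open>The heights witness acyclicity. They are only required to decrease towards the root, so
  distances in a given tree and ad hoc numberings of a constructed one both fit.\<close>

definition rooted :: "'a set \<Rightarrow> 'a rel \<Rightarrow> 'a \<Rightarrow> ('a \<Rightarrow> 'a) \<Rightarrow> ('a \<Rightarrow> nat) \<Rightarrow> bool" where
  "rooted V E r p h \<longleftrightarrow> finite V \<and> r \<in> V \<and> (\<forall>v\<in>V - {r}. p v \<in> V \<and> h (p v) < h v) \<and>
     E = (\<lambda>v. (v, p v)) ` (V - {r}) \<union> (\<lambda>v. (p v, v)) ` (V - {r})"

lemma pair_graph_iff:
  "pair_graph T \<longleftrightarrow> finite (pverts T) \<and> parcs T \<subseteq> pverts T \<times> pverts T \<and> sym (parcs T) \<and> irrefl (parcs T)"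
proof
  assume "pair_graph T"
  then interpret pair_graph T .
  show "finite (pverts T) \<and> parcs T \<subseteq> pverts T \<times> pverts T \<and> sym (parcs T) \<and> irrefl (parcs T)"
    using pair_finite_verts arc_fst_in_verts arc_snd_in_verts pair_no_loops arcs_symmetric
    by (force simp: sym_def irrefl_def)
next
  assume *: "finite (pverts T) \<and> parcs T \<subseteq> pverts T \<times> pverts T \<and> sym (parcs T) \<and> irrefl (parcs T)"
  then have "finite (parcs T)" by (meson finite_SigmaI finite_subset)
  then show "pair_graph T"
    using * by unfold_locales (auto simp: irrefl_def symmetric_def)
qed

lemma pawalk_verts_snoc: "pcas u q w \<Longrightarrow> pawalk_verts u (q @ [(w, x)]) = pawalk_verts u q @ [x]"
  by (induct q arbitrary: u) auto

text \<open>A path between two neighbours of v that avoids v closes up through v; it is nonempty as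
  the neighbours differ, so the cycle has length at least 3.\<close>

lemma cycle_through_vertex:
  assumes T: "pair_graph T" and u: "(v, u1) \<in> parcs T" "(v, u2) \<in> parcs T" "u1 \<noteq> u2"
    and walk: "(u1, u2) \<in> rtrancl_on (pverts T - {v}) (parcs T)"
  shows "\<exists>c. pre_digraph.cycle (with_proj T) c \<and> 3 \<le> length c"
proof -
  interpret pair_graph T by (rule T)
  \<comment> \<open>Deleting v before the walk is shortened to a path keeps the path away from
    v.\<close>
  define H where "H = \<lparr>pverts = pverts T - {v}, parcs = parcs T \<inter> (pverts T - {v}) \<times> (pverts T - {v})\<rparr>"
  interpret H: pair_wf_digraph H by unfold_locales (auto simp: H_def)
  have sub: "subgraph (with_proj H) (with_proj T)"
    by (auto simp: subgraph_def H_def compatible_def H.wf_digraph_axioms[unfolded H_def] wf_digraph_axioms)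
  have "(u1, u2) \<in> rtrancl_on (pverts H) (parcs H)"
    using walk by (induct rule: rtrancl_on_induct)
      (auto simp: H_def intro: rtrancl_on_into_rtrancl_on)
  then have "u1 \<rightarrow>\<^sup>*\<^bsub>with_proj H\<^esub> u2" by (simp add: reachable_def)
  then obtain q where q: "H.apath u1 q u2" using H.reachable_apath by blast
  then have Tq: "apath u1 q u2" using subgraph_apath_imp_apath sub by blast
  have qne: "q \<noteq> []" using q u(3) by (auto simp: H.apath_Nil_iff)
  have Hq: "H.awalk u1 q u2" using q by (simp add: H.apath_def)
  have vnot: "v \<notin> set (pawalk_verts u1 q)"
  proof
    assume "v \<in> set (pawalk_verts u1 q)"
    then have "v \<in> pverts H" using H.awalk_verts_in_verts[of u1 q v] Hq unfolding H.awalk_def by blast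
    then show False by (simp add: H_def)
  qed
  have sym: "(u2, v) \<in> parcs T" using u arcs_symmetric by blast
  have vV: "v \<in> pverts T" using u in_arcsD1 by blast
  let ?c = "(v, u1) # q @ [(u2, v)]"
  have aw: "awalk u1 q u2" "distinct (pawalk_verts u1 q)" using Tq by (auto simp: apath_def)
  have w: "awalk v ?c v"
    using aw u sym vV by (auto simp: awalk_Cons_iff awalk_Nil_iff)
  have "pawalk_verts v ?c = v # pawalk_verts u1 (q @ [(u2, v)])" by simp
  moreover have "pawalk_verts u1 (q @ [(u2, v)]) = pawalk_verts u1 q @ [v]"
    by (rule pawalk_verts_snoc) (use aw in \<open>simp add: awalk_def\<close>)
  ultimately have "distinct (tl (pawalk_verts v ?c))" using aw(2) vnot by simp
  then have "cycle ?c" using w unfolding cycle_def by blast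
  moreover have "3 \<le> length ?c" using qne by (cases q) auto
  ultimately show ?thesis by blast
qed


text \<open>Heights are distances from r. The descent to r from a vertex other than v and not higher
  than v never meets v. Two neighbours of v that are not higher than v would thus be joined outside
  v and lie with v on a cycle.\<close>

lemma ugraph_tree_imp_rooted:
  assumes T: "ugraph_tree T" and r: "r \<in> pverts T"
  shows "\<exists>p h. rooted (pverts T) (parcs T) r p h"
proof -
  let ?V = "pverts T" and ?E = "parcs T"
  have pg: "pair_graph T" using T by (simp add: ugraph_tree_def)
  have fin: "finite ?V" and EV: "?E \<subseteq> ?V \<times> ?V" and sym: "sym ?E" and irr: "irrefl ?E"
    using pg by (auto simp: pair_graph_iff)
  have nocyc: "\<not> (\<exists>c. pre_digraph.cycle (with_proj T) c \<and> 3 \<le> length c)"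
    using T by (auto simp: ugraph_tree_def)
  have symE: "symcl ?E = ?E" using sym by (auto simp: symcl_def sym_def)
  have reach: "(r, v) \<in> ?E\<^sup>*" if "v \<in> ?V" for v
  proof -
    have "(r, v) \<in> rtrancl_on ?V ?E"
      using T r that unfolding ugraph_tree_def connected_conv by (simp add: symE)
    then show ?thesis by (induct rule: rtrancl_on_induct) (auto intro: rtrancl.rtrancl_into_rtrancl)
  qed
  define h where "h v = (LEAST n. (r, v) \<in> ?E ^^ n)" for v
  have h: "(r, v) \<in> ?E ^^ h v" if "v \<in> ?V" for v
    using reach[OF that] unfolding h_def rtrancl_power by (rule LeastI_ex)
  have h_le: "h v \<le> n" if "(r, v) \<in> ?E ^^ n" for v n
    unfolding h_def using that by (rule Least_le)
  have h0: "v = r" if "v \<in> ?V" "h v = 0" for v using h[OF that(1)] that(2) by simp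
  have hr: "h r = 0" using h_le[of r 0] by simp
  have par: "\<exists>u. (v, u) \<in> ?E \<and> h u < h v" if v: "v \<in> ?V" "v \<noteq> r" for v
  proof -
    obtain n where n: "h v = Suc n" using h0 v by (cases "h v") auto
    then obtain u where "(r, u) \<in> ?E ^^ n" "(u, v) \<in> ?E" using h[OF v(1)] by auto
    then have "(v, u) \<in> ?E \<and> h u < h v" using h_le n sym by (simp add: sym_def less_Suc_eq_le)
    then show ?thesis by blast
  qed
  have avoid: "(u, r) \<in> rtrancl_on (?V - {v}) ?E" if "u \<in> ?V" "u \<noteq> v" "h u \<le> h v" for u v
    using that
  proof (induct "h u" arbitrary: u rule: less_induct)
    case less
    show ?case
    proof (cases "u = r")
      case True
      then show ?thesis using less.prems by simp
    next
      case False
      then obtain w where w: "(u, w) \<in> ?E" "h w < h u" using par less.prems by blast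
      have "w \<in> ?V" "w \<noteq> v" "h w \<le> h v" using w less.prems EV by auto
      then have "(w, r) \<in> rtrancl_on (?V - {v}) ?E" using w less.hyps by blast
      then show ?thesis
        using w less.prems by (intro converse_rtrancl_on_into_rtrancl_on[of u w]) simp_all
    qed
  qed
  \<comment> \<open>Allowing equal heights also excludes edges within a level: such an edge would
    give v a second neighbour besides its parent that is not higher.\<close>
  have unique: "u1 = u2" if "(v, u1) \<in> ?E" "(v, u2) \<in> ?E" "h u1 \<le> h v" "h u2 \<le> h v" for v u1 u2
  proof (rule ccontr)
    assume ne: "u1 \<noteq> u2"
    have u: "u1 \<in> ?V" "u2 \<in> ?V" "u1 \<noteq> v" "u2 \<noteq> v" using that EV irr by (auto simp: irrefl_def)
    have "(u1, r) \<in> rtrancl_on (?V - {v}) ?E" "(u2, r) \<in> rtrancl_on (?V - {v}) ?E"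
      using avoid u that by auto
    moreover have "sym (rtrancl_on (?V - {v}) ?E)" by (rule rtrancl_on_sym) (rule sym)
    ultimately have "(u1, u2) \<in> rtrancl_on (?V - {v}) ?E"
      by (meson rtrancl_on_trans symD)
    then show False using cycle_through_vertex[OF pg that(1,2) ne] nocyc by blast
  qed
  define p where "p v = (SOME u. (v, u) \<in> ?E \<and> h u < h v)" for v
  have p: "(v, p v) \<in> ?E" "h (p v) < h v" if "v \<in> ?V - {r}" for v
    using someI_ex[OF par[of v]] that by (auto simp: p_def)
  have child: "v \<in> ?V - {r} \<and> u = p v" if "(v, u) \<in> ?E" "h u \<le> h v" for v u
  proof -
    have "v \<noteq> r" using that h0[of u] hr EV irr by (auto simp: irrefl_def)
    then have "v \<in> ?V - {r}" using that EV by auto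
    then show ?thesis using unique[OF that(1) p(1)] p(2) that by (simp add: less_imp_le)
  qed
  have "?E = (\<lambda>v. (v, p v)) ` (?V - {r}) \<union> (\<lambda>v. (p v, v)) ` (?V - {r})"
  proof (intro equalityI subsetI)
    fix e assume "e \<in> ?E"
    moreover obtain u v where "e = (u, v)" by force
    ultimately have e: "e = (u, v)" "(u, v) \<in> ?E" "(v, u) \<in> ?E" using sym by (auto simp: sym_def)
    show "e \<in> (\<lambda>v. (v, p v)) ` (?V - {r}) \<union> (\<lambda>v. (p v, v)) ` (?V - {r})"
      using child[of u v] child[of v u] e by (cases "h u \<le> h v") auto
  next
    fix e assume "e \<in> (\<lambda>v. (v, p v)) ` (?V - {r}) \<union> (\<lambda>v. (p v, v)) ` (?V - {r})"
    then show "e \<in> ?E" using p(1) sym by (auto simp: sym_def)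
  qed
  moreover have "p v \<in> ?V" if "v \<in> ?V - {r}" for v using p(1)[OF that] EV by auto
  ultimately have "rooted ?V ?E r p h" unfolding rooted_def using fin r p(2) by simp
  then show ?thesis by blast
qed

lemma pcas_nth:
  assumes "pcas u c v" "i < length c"
  shows "c ! i = (pawalk_verts u c ! i, pawalk_verts u c ! Suc i)"
  using assms
proof (induct c arbitrary: u i)
  case (Cons e c)
  then have e: "fst e = u" "pcas (snd e) c v" by auto
  have "pawalk_verts (snd e) c ! 0 = snd e" using e(2) by (cases c) auto
  then show ?case using Cons(1)[OF e(2)] Cons(3) e by (cases i) (auto simp: prod_eq_iff)
qed simp

lemma pcas_ends:
  assumes "pcas u c v"
  shows "pawalk_verts u c ! 0 = u" "pawalk_verts u c ! length c = v" "length (pawalk_verts u c) = Suc (length c)"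
proof -
  show "pawalk_verts u c ! 0 = u" using assms by (cases c) auto
  show "pawalk_verts u c ! length c = v" using assms by (induct c arbitrary: u) auto
  show "length (pawalk_verts u c) = Suc (length c)" by (induct c arbitrary: u) auto
qed

text \<open>A highest vertex of a cycle has two cycle neighbours that are not higher, so both are
  its parent; on a cycle of length at least 3 they are different. Connectedness is the descent to
  r.\<close>

lemma rooted_imp_ugraph_tree:
  assumes R: "rooted V E r p h"
  shows "ugraph_tree \<lparr>pverts = V, parcs = E\<rparr>"
proof -
  let ?T = "\<lparr>pverts = V, parcs = E\<rparr>"
  have fin: "finite V" and r: "r \<in> V" and p: "\<And>v. v \<in> V - {r} \<Longrightarrow> p v \<in> V \<and> h (p v) < h v"
    and E: "E = (\<lambda>v. (v, p v)) ` (V - {r}) \<union> (\<lambda>v. (p v, v)) ` (V - {r})"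
    using R by (auto simp: rooted_def)
  have sym: "sym E" unfolding E by (auto simp: sym_def)
  have "irrefl E" unfolding E irrefl_def using p by force
  moreover have "E \<subseteq> V \<times> V" unfolding E using p by auto
  ultimately have pg: "pair_graph ?T" using fin sym by (simp add: pair_graph_iff)
  interpret pair_graph ?T by (rule pg)
  have to_r: "(v, r) \<in> rtrancl_on V E" if "v \<in> V" for v
    using that
  proof (induct "h v" arbitrary: v rule: less_induct)
    case less
    show ?case
    proof (cases "v = r")
      case False
      then have "(v, p v) \<in> E" "(p v, r) \<in> rtrancl_on V E" using less p unfolding E by auto
      then show ?thesis using less(2) by (rule converse_rtrancl_on_into_rtrancl_on)
    qed (use r in simp)
  qed
  have "sym (rtrancl_on V E)" by (rule rtrancl_on_sym) (rule sym)
  then have "(u, v) \<in> rtrancl_on V E" if "u \<in> V" "v \<in> V" for u v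
    using to_r[OF that(1)] to_r[OF that(2)] by (meson rtrancl_on_trans symD)
  moreover have "symcl E = E" using sym by (auto simp: symcl_def sym_def)
  ultimately have conn: "connected (with_proj ?T)" unfolding connected_conv using r by auto
  have up: "b = p a" if "(a, b) \<in> E \<or> (b, a) \<in> E" "h b \<le> h a" for a b
    using that p unfolding E by (auto dest: leD)
  have "\<not> (cycle c \<and> 3 \<le> length c)" for c
  proof
    assume c: "cycle c \<and> 3 \<le> length c"
    then obtain u where u: "awalk u c u" "distinct (tl (pawalk_verts u c))" by (auto simp: cycle_def)
    define w where "w = pawalk_verts u c"
    define L where "L = length c"
    have L: "3 \<le> L" using c by (simp add: L_def)
    have cas: "pcas u c u" using u by (auto simp: awalk_def)
    note ends = pcas_ends[OF cas, folded w_def L_def]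
    have arc: "(w ! i, w ! Suc i) \<in> E" if "i < L" for i
      using pcas_nth[OF cas, of i] that u(1) nth_mem[of i c] by (auto simp: w_def L_def awalk_def)
    have inj: "i = k" if "w ! i = w ! k" "1 \<le> i" "i \<le> L" "1 \<le> k" "k \<le> L" for i k
    proof -
      have "tl w ! (i - 1) = tl w ! (k - 1)" using that ends(3) by (simp add: nth_tl)
      moreover have "distinct (tl w)" using u by (simp add: w_def)
      ultimately show ?thesis using that ends(3) by (subst (asm) nth_eq_iff_index_eq) auto
    qed
    have "Max ((\<lambda>i. h (w ! i)) ` {1..L}) \<in> (\<lambda>i. h (w ! i)) ` {1..L}" using L by (intro Max_in) auto
    then obtain i where "i \<in> {1..L}" "h (w ! i) = Max ((\<lambda>i. h (w ! i)) ` {1..L})" by auto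
    then have i: "1 \<le> i" "i \<le> L" and max: "\<And>k. 1 \<le> k \<Longrightarrow> k \<le> L \<Longrightarrow> h (w ! k) \<le> h (w ! i)" by auto
    have max0: "h (w ! k) \<le> h (w ! i)" if "k \<le> L" for k
      using max[of k] max[of L] ends L that by (cases "k = 0") auto
    \<comment> \<open>Index L repeats the vertex at index 0 and only the indices 1 to L are known to
      be distinct, so the successor of L is 1.\<close>
    define nxt where "nxt = (if i = L then 1 else i + 1)"
    have "(w ! i, w ! nxt) \<in> E" using arc[of i] arc[of 0] i L ends by (auto simp: nxt_def)
    then have n: "w ! nxt = p (w ! i)" using up max0[of nxt] i L by (auto simp: nxt_def)
    have "(w ! (i - 1), w ! i) \<in> E" using arc[of "i - 1"] i by simp
    then have "w ! (i - 1) = p (w ! i)" using up max0[of "i - 1"] i by auto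
    then have eq: "w ! (i - 1) = w ! nxt" using n by simp
    show False
    proof (cases "i = 1")
      case True
      then have "w ! L = w ! 2" using eq L ends by (simp add: nxt_def numeral_2_eq_2)
      then show False using inj[of L 2] L by simp
    next
      case False
      then have "i - 1 = nxt" using i L by (intro inj[OF eq]) (auto simp: nxt_def)
      then show False using i L by (simp add: nxt_def split: if_splits)
    qed
  qed
  then show ?thesis unfolding ugraph_tree_def using pg conn by blast
qed

lemma sum_arcs_rooted:
  assumes R: "rooted V E r p h"
  shows "sum f E = (\<Sum>v\<in>V - {r}. f (v, p v) + f (p v, v))"
proof -
  have fin: "finite V" and p: "\<And>v. v \<in> V - {r} \<Longrightarrow> h (p v) < h v"
    and E: "E = (\<lambda>v. (v, p v)) ` (V - {r}) \<union> (\<lambda>v. (p v, v)) ` (V - {r})"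
    using R by (auto simp: rooted_def)
  have "sum f E = sum f ((\<lambda>v. (v, p v)) ` (V - {r})) + sum f ((\<lambda>v. (p v, v)) ` (V - {r}))"
    unfolding E
  proof (rule sum.union_disjoint)
    show "(\<lambda>v. (v, p v)) ` (V - {r}) \<inter> (\<lambda>v. (p v, v)) ` (V - {r}) = {}"
    proof (rule ccontr)
      assume "\<not> ?thesis"
      then obtain u v where "u \<in> V - {r}" "v \<in> V - {r}" "(v, p v) = (p u, u)" by blast
      then show False using p[of u] p[of v] by auto
    qed
  qed (use fin in auto)
  then show ?thesis
    by (simp add: sum.reindex inj_on_def sum.distrib)
qed

subsection \<open>Degree costs of a tree\<close>

lemma deg_eq_card: "deg T v = card {u. (v, u) \<in> parcs T}"
proof -
  have "out_arcs (with_proj T) v = (\<lambda>u. (v, u)) ` {u. (v, u) \<in> parcs T}"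
    by (auto simp: out_arcs_def)
  then show ?thesis unfolding deg_def out_degree_def by (simp add: card_image inj_on_def)
qed

locale degree_tree =
  fixes T :: "'a pair_pre_digraph" and \<Delta> :: nat
  assumes tree: "ugraph_tree T" and maxdeg: "max_deg T = \<Delta>" and six: "6 \<le> \<Delta>"
begin

abbreviation V where "V \<equiv> pverts T"
abbreviation E where "E \<equiv> parcs T"
text \<open>
  Fat vertices are those of degree \<open>\<Delta>\<close>, lean edges have no fat end. Sums range over arcs, so every
  edge occurs twice, which absorbs the factor 2 in front of its cost.
\<close>

definition d where "d v = int (deg T v)"
definition D where "D = int \<Delta>"
definition mediums where "mediums = {v \<in> V. 3 \<le> d v \<and> d v < D}"
definition lean_arcs where "lean_arcs = {(u, v) \<in> E. d u \<noteq> D \<and> d v \<noteq> D}"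
definition fat_arcs where "fat_arcs = {(u, v) \<in> E. d u = D \<and> d v = D}"
definition num_fat where "num_fat = int (card {v \<in> V. d v = D})"
definition W where "W e = (D - d (fst e)) * (D - d (snd e))"
definition lean_cost where "lean_cost = (\<Sum>v\<in>mediums. vertex_cost D (d v)) + (\<Sum>e\<in>lean_arcs. W e)"

lemma D6: "6 \<le> D" using six by (simp add: D_def)

lemma graph_basics: "finite V" "E \<subseteq> V \<times> V" "sym E" "irrefl E" "V \<noteq> {}" "finite E"
  using tree unfolding ugraph_tree_def pair_graph_iff connected_conv
  by (auto intro: finite_subset[of E "V \<times> V"])

lemma symE: "(u, v) \<in> E \<Longrightarrow> (v, u) \<in> E" using graph_basics(3) by (auto simp: sym_def)

lemma loopless: "(v, v) \<notin> E" using graph_basics(4) by (auto simp: irrefl_def)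

lemma arc_in: "(u, v) \<in> E \<Longrightarrow> u \<in> V \<and> v \<in> V" using graph_basics(2) by auto

lemma d_card: "d v = int (card {u. (v, u) \<in> E})" by (simp add: d_def deg_eq_card)

lemma finite_nbrs: "finite {u. (v, u) \<in> E}"
  by (rule finite_subset[OF _ graph_basics(1)]) (use arc_in in auto)

lemma d_le: "v \<in> V \<Longrightarrow> d v \<le> D"
  using maxdeg graph_basics(1) unfolding max_deg_def d_def D_def by auto

lemma d_max: "\<exists>v\<in>V. d v = D"
proof -
  have "Max (deg T ` V) \<in> deg T ` V" using graph_basics by (intro Max_in) auto
  then show ?thesis using maxdeg unfolding max_deg_def d_def D_def by auto
qed

lemma rooted_exists: "r \<in> V \<Longrightarrow> \<exists>p h. rooted V E r p h"
  using ugraph_tree_imp_rooted[OF tree] .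

lemma d_ge1: "1 \<le> d v" if v: "v \<in> V"
proof -
  obtain x where x: "x \<in> V" "d x = D" using d_max by blast
  then have "card {u. (x, u) \<in> E} \<noteq> 0" using D6 d_card[of x] by auto
  then have "{u. (x, u) \<in> E} \<noteq> {}" by (metis card.empty)
  then obtain y where y: "(x, y) \<in> E" by blast
  then obtain r where r: "r \<in> V" "r \<noteq> v" using x arc_in loopless by (metis)
  obtain p h where "rooted V E r p h" using rooted_exists r by blast
  then have "(v, p v) \<in> E" using v r unfolding rooted_def by blast
  then have "card {u. (v, u) \<in> E} \<noteq> 0" using finite_nbrs by auto
  then show ?thesis by (simp add: d_card)
qed

lemma sum_arcs: "(\<Sum>e\<in>E. f (fst e)) = (\<Sum>v\<in>V. d v * f v)" for f :: "'a \<Rightarrow> int"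
proof -
  have "E = Sigma V (\<lambda>v. {u. (v, u) \<in> E})" using arc_in by auto
  then have "(\<Sum>e\<in>E. f (fst e)) = (\<Sum>e\<in>Sigma V (\<lambda>v. {u. (v, u) \<in> E}). f (fst e))" by simp
  also have "\<dots> = (\<Sum>v\<in>V. \<Sum>u\<in>{u. (v, u) \<in> E}. f v)"
    using sum.Sigma[of V "\<lambda>v. {u. (v, u) \<in> E}" "\<lambda>v u. f v"] graph_basics(1) finite_nbrs
    by (simp add: case_prod_beta)
  also have "\<dots> = (\<Sum>v\<in>V. d v * f v)" by (simp add: d_card)
  finally show ?thesis .
qed

lemma sum_arcs_swap: "(\<Sum>e\<in>E. g (snd e) (fst e)) = (\<Sum>e\<in>E. g (fst e) (snd e))" for g :: "'a \<Rightarrow> 'a \<Rightarrow> 'b::comm_monoid_add"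
  by (rule sum.reindex_bij_witness[of _ prod.swap prod.swap]) (auto intro: symE)

lemma card_E: "int (card E) = 2 * (int (card V) - 1)"
proof -
  obtain r where r: "r \<in> V" using graph_basics by blast
  obtain p h where "rooted V E r p h" using rooted_exists r by blast
  from sum_arcs_rooted[OF this, of "\<lambda>_. 1::int"] have "int (card E) = 2 * int (card (V - {r}))" by simp
  moreover have "card V = card (V - {r}) + 1" using r graph_basics(1)
    by (metis Suc_eq_plus1 card.remove)
  ultimately show ?thesis by simp
qed

lemma sum_vertex_cost: "(\<Sum>v\<in>V. vertex_cost D (d v)) = num_fat * vertex_cost D D + (\<Sum>v\<in>mediums. vertex_cost D (d v))"
proof -
  have "(\<Sum>v\<in>V. vertex_cost D (d v)) = (\<Sum>v\<in>{v \<in> V. d v = D} \<union> mediums. vertex_cost D (d v))"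
  proof (rule sum.mono_neutral_right)
    show "\<forall>v\<in>V - ({v \<in> V. d v = D} \<union> mediums). vertex_cost D (d v) = 0"
    proof
      fix v assume "v \<in> V - ({v \<in> V. d v = D} \<union> mediums)"
      then have "d v = 1 \<or> d v = 2" using d_ge1[of v] d_le[of v] by (auto simp: mediums_def)
      then show "vertex_cost D (d v) = 0" by (auto simp: vertex_cost_def)
    qed
  qed (use graph_basics(1) in \<open>auto simp: mediums_def\<close>)
  also have "\<dots> = (\<Sum>v\<in>{v \<in> V. d v = D}. vertex_cost D (d v)) + (\<Sum>v\<in>mediums. vertex_cost D (d v))"
    by (rule sum.union_disjoint) (use graph_basics(1) in \<open>auto simp: mediums_def\<close>)
  finally show ?thesis by (simp add: num_fat_def)
qed

lemma sum_W: "(\<Sum>e\<in>E. W e) = (\<Sum>e\<in>lean_arcs. W e)"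
  by (rule sum.mono_neutral_right) (use graph_basics(6) in \<open>auto simp: lean_arcs_def W_def\<close>)

lemma sigma_eq:
  "sigma T = 2 * (D^2 - 6 * D + 7) * (int (card V) - 1) + (4 * D - 6) * int (card V) - (num_fat * vertex_cost D D + lean_cost)"
proof -
  let ?S = "\<Sum>e\<in>E. (d (fst e) - d (snd e))^2"
  have "?S + 2 * (\<Sum>e\<in>E. W e) = (\<Sum>e\<in>E. (d (fst e)^2 - 2 * D * d (fst e) + D^2) + (d (snd e)^2 - 2 * D * d (snd e) + D^2))"
    unfolding sum_distrib_left sum.distrib[symmetric]
    by (rule sum.cong) (auto simp: W_def algebra_simps power2_eq_square)
  also have "\<dots> = 2 * (\<Sum>e\<in>E. d (fst e)^2 - 2 * D * d (fst e) + D^2)"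
    using sum_arcs_swap[of "\<lambda>u v. d u^2 - 2 * D * d u + D^2"]
    by (simp only: sum.distrib[of "\<lambda>e. d (fst e)^2 - 2 * D * d (fst e) + D^2"])
  also have "(\<Sum>e\<in>E. d (fst e)^2 - 2 * D * d (fst e) + D^2) = (\<Sum>v\<in>V. d v * (d v^2 - 2 * D * d v + D^2))"
    by (rule sum_arcs)
  finally have 1: "?S + 2 * (\<Sum>e\<in>E. W e) = 2 * (\<Sum>v\<in>V. d v * (d v^2 - 2 * D * d v + D^2))" .
  have "(\<Sum>v\<in>V. d v * (d v^2 - 2 * D * d v + D^2)) + (\<Sum>v\<in>V. vertex_cost D (d v))
      = (\<Sum>v\<in>V. (D^2 - 6 * D + 7) * d v + (4 * D - 6))"
    unfolding sum.distrib[symmetric]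
    by (rule sum.cong) (auto simp: vertex_cost_def algebra_simps power2_eq_square)
  also have "\<dots> = (D^2 - 6 * D + 7) * (\<Sum>v\<in>V. d v) + (4 * D - 6) * int (card V)"
    by (simp add: sum.distrib sum_distrib_left)
  also have "(\<Sum>v\<in>V. d v) = 2 * (int (card V) - 1)"
    using sum_arcs[of "\<lambda>_. 1"] card_E by simp
  finally have 2: "(\<Sum>v\<in>V. d v * (d v^2 - 2 * D * d v + D^2)) + (\<Sum>v\<in>V. vertex_cost D (d v))
    = (D^2 - 6 * D + 7) * (2 * (int (card V) - 1)) + (4 * D - 6) * int (card V)" .
  have "?S = 2 * (2 * (D^2 - 6 * D + 7) * (int (card V) - 1) + (4 * D - 6) * int (card V) - (num_fat * vertex_cost D D + lean_cost))"
    using 1 2 unfolding sum_vertex_cost sum_W lean_cost_def by (simp add: algebra_simps)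
  moreover have "sigma T = ?S div 2" unfolding sigma_def d_def by (simp add: case_prod_beta)
  ultimately show ?thesis by simp
qed

text \<open>\<open>D * num_fat\<close> arcs leave vertices of degree D and as many enter them. The
  union of the two sets is the complement of the lean arcs, the intersection consists of the fat
  arcs, and a tree on n vertices has 2(n - 1) arcs.\<close>

lemma arc_count: "int (card fat_arcs) - int (card lean_arcs) = 2 * (D * num_fat - (int (card V) - 1))"
proof -
  have XD: "D * num_fat = int (card {e \<in> E. d (fst e) = D})"
  proof -
    have "int (card {e \<in> E. d (fst e) = D}) = (\<Sum>e\<in>E. if d (fst e) = D then 1 else 0)"
      using graph_basics(6) by (simp add: sum.If_cases Int_def)
    also have "\<dots> = (\<Sum>v\<in>V. d v * (if d v = D then 1 else 0))"
      by (rule sum_arcs)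
    also have "\<dots> = (\<Sum>v\<in>V. if d v = D then D else 0)" by (rule sum.cong) auto
    also have "\<dots> = D * num_fat" using graph_basics(1) by (simp add: sum.If_cases Int_def num_fat_def)
    finally show ?thesis by simp
  qed
  have "bij_betw prod.swap {e \<in> E. d (fst e) = D} {e \<in> E. d (snd e) = D}"
    by (rule bij_betwI[where g = prod.swap]) (auto intro: symE)
  then have sw: "card {e \<in> E. d (fst e) = D} = card {e \<in> E. d (snd e) = D}" by (rule bij_betw_same_card)
  have "fat_arcs = {e \<in> E. d (fst e) = D} \<inter> {e \<in> E. d (snd e) = D}" by (auto simp: fat_arcs_def)
  moreover have "E - lean_arcs = {e \<in> E. d (fst e) = D} \<union> {e \<in> E. d (snd e) = D}"
    by (auto simp: lean_arcs_def)
  ultimately have "card {e \<in> E. d (fst e) = D} + card {e \<in> E. d (snd e) = D} = card (E - lean_arcs) + card fat_arcs"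
    using card_Un_Int[of "{e \<in> E. d (fst e) = D}" "{e \<in> E. d (snd e) = D}"] graph_basics(6) by simp
  moreover have "lean_arcs \<subseteq> E" by (auto simp: lean_arcs_def)
  then have "card E = card (E - lean_arcs) + card lean_arcs" using graph_basics(6)
    by (metis add.commute card_Diff_subset card_mono finite_subset le_add_diff_inverse)
  ultimately show ?thesis using XD sw card_E by simp
qed

text \<open>Connectedness makes the tree a star around v, and then only v can be the vertex of
  maximum degree.\<close>

lemma star_centre_degree:
  assumes v: "v \<in> V" and leaves: "\<And>u. (v, u) \<in> E \<Longrightarrow> d u = 1"
  shows "d v = D"
proof (rule ccontr)
  assume ne: "d v \<noteq> D"
  obtain p h where R: "rooted V E v p h" using rooted_exists v by blast
  have arc: "(u, p u) \<in> E" if "u \<in> V" "u \<noteq> v" for u using R that by (auto simp: rooted_def)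
  have ph: "p u \<in> V" "h (p u) < h u" if "u \<in> V" "u \<noteq> v" for u using R that by (auto simp: rooted_def)
  have "p u = v" if "u \<in> V" "u \<noteq> v" for u
    using that
  proof (induct "h u" arbitrary: u rule: less_induct)
    case less
    show ?case
    proof (rule ccontr)
      assume pu: "p u \<noteq> v"
      then have ppu: "p (p u) = v" using less.hyps ph less.prems by blast
      then have "(v, p u) \<in> E" using arc[of "p u"] pu ph less.prems symE by auto
      then have "card {w. (p u, w) \<in> E} = 1" using leaves by (simp add: d_card)
      moreover have "{u, v} \<subseteq> {w. (p u, w) \<in> E}"
        using symE arc less.prems \<open>(v, p u) \<in> E\<close> by auto
      then have "card {u, v} \<le> card {w. (p u, w) \<in> E}" by (intro card_mono finite_nbrs)
      ultimately show False using less.prems by simp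
    qed
  qed
  then have "d u = 1" if "u \<in> V" "u \<noteq> v" for u using leaves arc that symE by metis
  moreover obtain x where "x \<in> V" "d x = D" using d_max by blast
  ultimately show False using ne D6 by fastforce
qed


text \<open>\<open>S\<close> names every lean edge by its child end, which turns sums over lean
  edges into sums over vertices.\<close>

lemma rooted_lean_arcs:
  assumes R: "rooted V E r p h"
  defines "S \<equiv> {v \<in> V - {r}. d v \<noteq> D \<and> d (p v) \<noteq> D}"
  shows "int (card lean_arcs) = 2 * int (card S)"
    and "(\<Sum>e\<in>lean_arcs. W e) = (\<Sum>v\<in>S. 2 * ((D - d v) * (D - d (p v))))"
proof -
  have arc: "(v, p v) \<in> E" "(p v, v) \<in> E" if "v \<in> V - {r}" for v using R that by (auto simp: rooted_def)
  have lean_arcs: "lean_arcs \<subseteq> E" by (auto simp: lean_arcs_def)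
  have gen: "(\<Sum>e\<in>lean_arcs. f e) = (\<Sum>v\<in>S. f (v, p v) + f (p v, v))" for f :: "'a \<times> 'a \<Rightarrow> int"
  proof -
    have "(\<Sum>e\<in>lean_arcs. f e) = (\<Sum>e\<in>E. if e \<in> lean_arcs then f e else 0)"
      using lean_arcs graph_basics(6) by (simp add: sum.If_cases inf.absorb2 Int_absorb1)
    also have "\<dots> = (\<Sum>v\<in>V - {r}. (if (v, p v) \<in> lean_arcs then f (v, p v) else 0) + (if (p v, v) \<in> lean_arcs then f (p v, v) else 0))"
      by (rule sum_arcs_rooted[OF R])
    also have "\<dots> = (\<Sum>v\<in>V - {r}. if v \<in> S then f (v, p v) + f (p v, v) else 0)"
      by (rule sum.cong) (use arc in \<open>auto simp: lean_arcs_def S_def\<close>)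
    also have "\<dots> = (\<Sum>v\<in>S. f (v, p v) + f (p v, v))"
      using graph_basics(1) by (subst sum.inter_filter[symmetric]) (auto simp: S_def intro: sum.cong)
    finally show ?thesis .
  qed
  show "int (card lean_arcs) = 2 * int (card S)" using gen[of "\<lambda>_. 1"] by simp
  show "(\<Sum>e\<in>lean_arcs. W e) = (\<Sum>v\<in>S. 2 * ((D - d v) * (D - d (p v))))"
    unfolding gen by (rule sum.cong) (auto simp: W_def algebra_simps)
qed

lemma not_mediums_degree: "v \<in> V \<Longrightarrow> d v \<noteq> D \<Longrightarrow> v \<notin> mediums \<Longrightarrow> d v = 1 \<or> d v = 2"
  using d_ge1[of v] d_le[of v] by (auto simp: mediums_def)

lemma finite_mediums: "finite mediums" using graph_basics(1) by (simp add: mediums_def)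

lemma finite_lean_arcs: "finite lean_arcs"
  using graph_basics(6) by (rule rev_finite_subset) (auto simp: lean_arcs_def)

lemma vertex_cost_pos: "v \<in> mediums \<Longrightarrow> 0 < vertex_cost D (d v)"
  by (auto simp: mediums_def vertex_cost_def)

lemma W_pos: "e \<in> lean_arcs \<Longrightarrow> 0 < W e"
  using d_le arc_in unfolding lean_arcs_def W_def by (auto intro!: mult_pos_pos simp: less_le)

lemma lean_cost_nonneg: "0 \<le> lean_cost" and lean_cost_0: "lean_cost = 0 \<Longrightarrow> mediums = {} \<and> lean_arcs = {}"
proof -
  have nn: "0 \<le> (\<Sum>v\<in>mediums. vertex_cost D (d v))" "0 \<le> (\<Sum>e\<in>lean_arcs. W e)"
    by (auto intro!: sum_nonneg simp: vertex_cost_pos W_pos less_imp_le)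
  then show "0 \<le> lean_cost" by (simp add: lean_cost_def)
  assume "lean_cost = 0"
  then have "(\<Sum>v\<in>mediums. vertex_cost D (d v)) = 0" "(\<Sum>e\<in>lean_arcs. W e) = 0"
    using nn by (auto simp: lean_cost_def)
  then show "mediums = {} \<and> lean_arcs = {}"
    using vertex_cost_pos W_pos finite_mediums finite_lean_arcs
    by (metis (no_types, lifting) less_irrefl less_imp_le sum_nonneg_eq_0_iff equals0I)
qed

end

section \<open>A single medium vertex as centre\<close>

text \<open>\<open>x\<close> and \<open>y\<close> are the degrees of child and parent on a lean
  edge, \<open>a\<close> is the largest medium degree. \<open>f\<close> is the cost of child and
  edge beyond that of an edge from the centre to degree 2. A medium child can make the edge cheaper,
  but its own vertex cost outweighs this.\<close>

lemma single_centre_aux: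
  fixes D a x y :: int
  assumes "6 \<le> D" "3 \<le> a" "a < D" "1 \<le> x" "x \<le> a" "1 \<le> y" "y \<le> a"
  defines "f \<equiv> (if 3 \<le> x then vertex_cost D x else 0) + 2 * ((D - x) * (D - y)) - 2 * ((D - a) * (D - 2))"
  shows "0 \<le> f" "f = 0 \<Longrightarrow> x = 2 \<and> y = a"
proof -
  have y: "(D - x) * (D - a) \<le> (D - x) * (D - y)" using assms by (intro mult_left_mono) auto
  consider "x = 1" | "x = 2" | "3 \<le> x" using assms by linarith
  then have "0 \<le> f \<and> (f = 0 \<longrightarrow> x = 2 \<and> y = a)"
  proof cases
    case 1
    have "(D - 1) * (D - a) = (D - a) * (D - 2) + (D - a)" by (simp add: algebra_simps)
    then have "0 < f" using y 1 assms(1-3) unfolding f_def by simp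
    then show ?thesis by simp
  next
    case 2
    then have "f = 2 * ((D - 2) * (a - y))" unfolding f_def by (simp add: algebra_simps)
    then show ?thesis using assms 2 by simp
  next
    case 3
    have "2 * ((x - 2) * (D - a)) < (x - 1) * ((x - 2) * (2 * D - 3 - x))"
    proof -
      have "2 * ((x - 2) * (D - a)) < 2 * ((x - 2) * (2 * D - 3 - x))" using 3 assms by simp
      also have "\<dots> \<le> (x - 1) * ((x - 2) * (2 * D - 3 - x))"
        using 3 assms by (intro mult_right_mono mult_nonneg_nonneg) auto
      finally show ?thesis .
    qed
    moreover have "f = (x - 1) * ((x - 2) * (2 * D - 3 - x)) - 2 * ((x - 2) * (D - a))
        + 2 * ((D - x) * (D - y) - (D - x) * (D - a))"
      using 3 unfolding f_def vertex_cost_def by (simp add: algebra_simps)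
    moreover have "0 \<le> 2 * ((D - x) * (D - y) - (D - x) * (D - a))" using y by simp
    ultimately have "0 < f" by (smt (verit))
    then show ?thesis by simp
  qed
  then show "0 \<le> f" "f = 0 \<Longrightarrow> x = 2 \<and> y = a" by auto
qed

context degree_tree
begin

text \<open>With w as root, \<open>lean_cost\<close> exceeds the star by the sum of the local
  excesses \<open>f v\<close>. Each medium vertex other than w pays for its parent edge only, so no
  vertex cost is spent twice, and equality makes every excess vanish.\<close>

lemma single_centre_bound:
  assumes w: "w \<in> mediums" and top: "\<And>v. v \<in> mediums \<Longrightarrow> d v \<le> d w" and A: "int (card lean_arcs) = 2 * A"
  shows "star_cost D (d w) A \<le> lean_cost"
    and "lean_cost = star_cost D (d w) A \<Longrightarrow> mediums = {w} \<and> (\<forall>(u, v)\<in>lean_arcs. u = w \<and> d v = 2 \<or> v = w \<and> d u = 2)"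
proof -
  define a where "a = d w"
  have wV: "w \<in> V" and a: "3 \<le> a" "a < D" using w by (auto simp: mediums_def a_def)
  obtain p h where R: "rooted V E w p h" using rooted_exists wV by blast
  define S where "S = {v \<in> V - {w}. d v \<noteq> D \<and> d (p v) \<noteq> D}"
  define f where "f v = (if v \<in> mediums then vertex_cost D (d v) else 0) + (if v \<in> S then 2 * ((D - d v) * (D - d (p v))) - 2 * ((D - a) * (D - 2)) else 0)" for v
  have S: "S \<subseteq> V - {w}" "finite S" using graph_basics(1) by (auto simp: S_def)
  have pV: "p v \<in> V" if "v \<in> V - {w}" for v using R that by (auto simp: rooted_def)
  have A': "A = int (card S)" using rooted_lean_arcs(1)[OF R] A unfolding S_def by simp
  have le_a: "d v \<le> a" if "v \<in> V" "d v \<noteq> D" for v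
    using not_mediums_degree[OF that] top[of v] a by (cases "v \<in> mediums") (auto simp: a_def)
  have "lean_cost = vertex_cost D a + (\<Sum>v\<in>mediums - {w}. vertex_cost D (d v)) + (\<Sum>v\<in>S. 2 * ((D - d v) * (D - d (p v))))"
    unfolding lean_cost_def rooted_lean_arcs(2)[OF R] S_def a_def
      using w finite_mediums by (simp add: sum.remove)
  also have "(\<Sum>v\<in>mediums - {w}. vertex_cost D (d v)) = (\<Sum>v\<in>V - {w}. if v \<in> mediums then vertex_cost D (d v) else 0)"
    using graph_basics(1)
      by (subst sum.inter_filter[symmetric]) (auto simp: mediums_def intro!: sum.cong)
  also have "(\<Sum>v\<in>S. 2 * ((D - d v) * (D - d (p v)))) = (\<Sum>v\<in>S. 2 * ((D - d v) * (D - d (p v))) - 2 * ((D - a) * (D - 2))) + 2 * A * (D - a) * (D - 2)"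
    by (simp add: sum_subtractf A')
  also have "(\<Sum>v\<in>S. 2 * ((D - d v) * (D - d (p v))) - 2 * ((D - a) * (D - 2)))
     = (\<Sum>v\<in>V - {w}. if v \<in> S then 2 * ((D - d v) * (D - d (p v))) - 2 * ((D - a) * (D - 2)) else 0)"
    using graph_basics(1) S by (subst sum.inter_filter[symmetric]) (auto intro!: sum.cong)
  finally have lean_cost: "lean_cost = star_cost D a A + (\<Sum>v\<in>V - {w}. f v)"
    unfolding f_def sum.distrib star_cost_def by simp
  have f: "0 \<le> f v" "f v = 0 \<Longrightarrow> v \<notin> mediums \<and> (v \<in> S \<longrightarrow> d v = 2 \<and> d (p v) = a)" if v: "v \<in> V - {w}" for v
  proof -
    have "0 \<le> f v \<and> (f v = 0 \<longrightarrow> v \<notin> mediums \<and> (v \<in> S \<longrightarrow> d v = 2 \<and> d (p v) = a))"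
    proof (cases "v \<in> S")
      case True
      then have dv: "1 \<le> d v" "d v \<le> a" "1 \<le> d (p v)" "d (p v) \<le> a" and pv: "p v \<in> V"
        using d_ge1 le_a pV by (auto simp: S_def)
      have "v \<in> mediums \<longleftrightarrow> 3 \<le> d v" using v dv a by (auto simp: mediums_def)
      then show ?thesis using single_centre_aux[OF D6 a dv] True unfolding f_def by auto
    next
      case False
      then show ?thesis unfolding f_def using vertex_cost_pos[of v] by auto
    qed
    then show "0 \<le> f v" "f v = 0 \<Longrightarrow> v \<notin> mediums \<and> (v \<in> S \<longrightarrow> d v = 2 \<and> d (p v) = a)" by auto
  qed
  have fs: "0 \<le> (\<Sum>v\<in>V - {w}. f v)" using f by (intro sum_nonneg)
  then show "star_cost D (d w) A \<le> lean_cost" using lean_cost a_def by simp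
  assume "lean_cost = star_cost D (d w) A"
  then have "(\<Sum>v\<in>V - {w}. f v) = 0" using lean_cost a_def by simp
  then have "\<forall>v\<in>V - {w}. f v = 0" using f graph_basics(1) by (subst (asm) sum_nonneg_eq_0_iff) auto
  then have eq: "v \<notin> mediums" "v \<in> S \<Longrightarrow> d v = 2 \<and> d (p v) = a" if "v \<in> V - {w}" for v
    using f(2) that by auto
  have Mw: "mediums = {w}" using eq(1) w by (auto simp: mediums_def)
  have "p v = w" if "v \<in> S" for v
  proof -
    have "p v \<in> mediums" using eq(2)[of v] pV that S a by (auto simp: mediums_def)
    then show ?thesis using Mw by simp
  qed
  then have "v \<in> S \<Longrightarrow> d v = 2 \<and> p v = w" for v using eq(2) S by auto
  moreover have "(u \<in> S \<and> v = p u) \<or> (v \<in> S \<and> u = p v)" if "(u, v) \<in> lean_arcs" for u v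
    using that R unfolding lean_arcs_def S_def rooted_def by auto
  ultimately show "mediums = {w} \<and> (\<forall>(u, v)\<in>lean_arcs. u = w \<and> d v = 2 \<or> v = w \<and> d u = 2)"
    using Mw by blast
qed

end

text \<open>The price per edge of a centre all of whose edges are lean:
  \<open>star_cost D a a\<close> is 4D - 6 plus a times this rate. It decreases for a \<ge>
  2.\<close>

definition edge_rate :: "int \<Rightarrow> int \<Rightarrow> int" where
  "edge_rate D a = 2 * D^2 - 10 * D + 11 - (a - 2)^2"

text \<open>At 3 the polynomial has the value \<open>-2\<close>, which would make arcs into vertices of degree \<open>D\<close> count negatively.\<close>

definition half_edge :: "int \<Rightarrow> int \<Rightarrow> int" where
  "half_edge D x = (if x = 3 then 0 else 2 * D * x - x^2 - 6 * D + 7)"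

lemma half_edge_nonneg:
  assumes "3 \<le> x" "x < D" shows "0 \<le> half_edge D x"
proof (cases "x = 3")
  case False
  have "0 \<le> (x - 4) * (2 * D - 4 - x)" using False assms by (intro mult_nonneg_nonneg) auto
  moreover have "2 * D * x - x^2 - 6 * D + 7 = (x - 4) * (2 * D - 4 - x) + (2 * D - 9)"
    by (simp add: algebra_simps power2_eq_square)
  ultimately have "0 \<le> 2 * D * x - x^2 - 6 * D + 7" using False assms by linarith
  then show ?thesis using False by (simp add: half_edge_def)
qed (simp add: half_edge_def)

lemma half_edge_ge: "2 * D * x - x^2 - 6 * D + 7 \<le> half_edge D x"
  by (simp add: half_edge_def)

text \<open>The vertex cost of degree x is 4D - 6 + x (2Dx - x^2 - 6D + 7), a fixed part and a share
  for each incident edge. As \<open>half_edge\<close> raises the share at degree 3 from -2 to 0, the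
  fixed part there is 4D - 12, the amount credited to every medium child. A lean edge collects the
  fixed part of its child, a share from each medium end, and its own cost.\<close>

lemma edge_rate_aux:
  fixes D a x y :: int
  assumes "6 \<le> D" "4 \<le> a" "a < D" "1 \<le> x" "x \<le> a" "1 \<le> y" "y \<le> a"
  shows "edge_rate D a \<le> (if 3 \<le> x then 4 * D - 12 + half_edge D x else 0)
    + (if 3 \<le> y then half_edge D y else 0) + 2 * ((D - x) * (D - y))"
proof -
  have one: "edge_rate D a \<le> half_edge D x + 2 * ((D - x) * (D - y))"
    if "3 \<le> x" "x \<le> a" "1 \<le> y" "y \<le> 2" for x y
  proof -
    have "(D - x) * (D - 2) \<le> (D - x) * (D - y)" using that assms by (intro mult_left_mono) auto
    moreover have "(x - 2)^2 \<le> (a - 2)^2" using that by (intro power_mono) auto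
    moreover have "2 * D * x - x^2 - 6 * D + 7 + 2 * ((D - x) * (D - 2)) = 2 * D^2 - 10 * D + 11 - (x - 2)^2"
      by (simp add: algebra_simps power2_eq_square)
    ultimately show ?thesis using half_edge_ge[of D x] unfolding edge_rate_def by linarith
  qed
  consider "3 \<le> x" "3 \<le> y" | "3 \<le> x" "y \<le> 2" | "x \<le> 2" "3 \<le> y" | "x \<le> 2" "y \<le> 2" by linarith
  then show ?thesis
  proof cases
    case 1
    have "\<bar>x - y\<bar> \<le> \<bar>a - 2\<bar>" using 1 assms by auto
    then have "(x - y)^2 \<le> (a - 2)^2" by (rule abs_le_square_iff[THEN iffD1])
    moreover have "2 * D * x - x^2 - 6 * D + 7 + (2 * D * y - y^2 - 6 * D + 7) + 2 * ((D - x) * (D - y))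
        = 2 * D^2 - 12 * D + 14 - (x - y)^2"
      by (simp add: algebra_simps power2_eq_square)
    ultimately show ?thesis using 1 assms(1) half_edge_ge[of D x] half_edge_ge[of D y]
      unfolding edge_rate_def by simp
  next
    case 2
    then show ?thesis using one[of x y] assms by simp
  next
    case 3
    then show ?thesis using one[of y x] assms by (simp add: mult.commute[of "D - x"])
  next
    case 4
    have "2 * ((D - 2) * (D - 2)) \<le> 2 * ((D - x) * (D - y))" using 4 assms by (intro mult_mono) auto
    moreover have "2 * ((D - 2) * (D - 2)) = 2 * D^2 - 8 * D + 8"
      by (simp add: algebra_simps power2_eq_square)
    moreover have "0 \<le> (a - 2)^2" by simp
    ultimately have "edge_rate D a \<le> 2 * ((D - x) * (D - y))"
      unfolding edge_rate_def using assms(1) by linarith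
    then show ?thesis using 4 by simp
  qed
qed

text \<open>The end of smaller degree is priced as if its degree were 2. The charge is always taken
  from the child x, even when x is the larger end, so that a vertex is charged for its parent edge
  only.\<close>

lemma owner_aux:
  fixes D x y :: int
  assumes "1 \<le> x" "x < D" "1 \<le> y" "y < D"
  shows "3 \<le> max x y \<Longrightarrow> 2 * ((D - max x y) * (D - 2)) \<le> 2 * ((D - x) * (D - y)) + (if 3 \<le> x then 2 * ((D - x) * (x - 2)) else 0)"
    and "max x y \<le> 2 \<Longrightarrow> 2 * (D - 2)^2 \<le> 2 * ((D - x) * (D - y))"
proof -
  assume 3: "3 \<le> max x y"
  show "2 * ((D - max x y) * (D - 2)) \<le> 2 * ((D - x) * (D - y)) + (if 3 \<le> x then 2 * ((D - x) * (x - 2)) else 0)"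
  proof (cases "3 \<le> x")
    case True
    show ?thesis
    proof (cases "x < y")
      case True
      have "(D - y) * (x - 2) \<le> (D - x) * (x - 2)" using True \<open>3 \<le> x\<close> by (intro mult_right_mono) auto
      moreover have "(D - y) * (D - 2) = (D - x) * (D - y) + (D - y) * (x - 2)"
        by (simp add: algebra_simps)
      ultimately show ?thesis using True \<open>3 \<le> x\<close> by (simp add: max_def mult.assoc)
    next
      case False
      have "(D - x) * (D - 2) \<le> (D - x) * (D - y + (x - 2))"
        using False assms by (intro mult_left_mono) auto
      then show ?thesis using False True by (simp add: max_def mult.assoc distrib_left)
    qed
  next
    case False
    then have "(D - y) * (D - 2) \<le> (D - y) * (D - x)" using assms by (intro mult_left_mono) auto
    moreover have "max x y = y" using False 3 by auto
    ultimately show ?thesis using False by (simp add: mult.commute)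
  qed
next
  assume "max x y \<le> 2"
  then have "(D - 2) * (D - 2) \<le> (D - x) * (D - y)" using assms by (intro mult_mono) auto
  then show "2 * (D - 2)^2 \<le> 2 * ((D - x) * (D - y))" by (simp add: power2_eq_square mult.assoc)
qed


context degree_tree
begin

text \<open>For the case of more lean edges than the degree of w. The root is nobody's child and
  keeps its fixed part; degree at least 4 makes this 4D - 6 rather than 4D - 12.\<close>

lemma edge_rate_bound:
  assumes w: "w \<in> mediums" and top: "\<And>v. v \<in> mediums \<Longrightarrow> d v \<le> d w" and A: "int (card lean_arcs) = 2 * A" and four: "4 \<le> d w"
  shows "4 * D - 6 + A * edge_rate D (d w) \<le> lean_cost"
proof -
  define a where "a = d w"
  have wV: "w \<in> V" and a: "4 \<le> a" "a < D" using w four by (auto simp: mediums_def a_def)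
  obtain p h where R: "rooted V E w p h" using rooted_exists wV by blast
  define S where "S = {v \<in> V - {w}. d v \<noteq> D \<and> d (p v) \<noteq> D}"
  define q where "q v = (if v \<in> mediums then half_edge D (d v) else 0)" for v
  define b where "b v = (if v \<in> mediums then 4 * D - 12 else 0)" for v
  have S: "S \<subseteq> V - {w}" "finite S" using graph_basics(1) by (auto simp: S_def)
  have pV: "p v \<in> V" if "v \<in> V - {w}" for v using R that by (auto simp: rooted_def)
  have A': "A = int (card S)" using rooted_lean_arcs(1)[OF R] A unfolding S_def by simp
  have le_a: "d v \<le> a" if "v \<in> V" "d v \<noteq> D" for v
    using not_mediums_degree[OF that] top[of v] a by (cases "v \<in> mediums") (auto simp: a_def)
  have q0: "0 \<le> q v" for v using half_edge_nonneg by (auto simp: q_def mediums_def)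
  have b0: "0 \<le> b v" for v using D6 by (simp add: b_def)
  have vertex_cost_eq: "vertex_cost D x = 4 * D - 6 + x * (2 * D * x - x^2 - 6 * D + 7)" for x
    unfolding vertex_cost_def by (simp add: algebra_simps power2_eq_square)
  have P: "b v + d v * q v \<le> vertex_cost D (d v)" if "v \<in> mediums" for v
  proof (cases "d v = 3")
    case True
    then show ?thesis using that by (simp add: b_def q_def half_edge_def vertex_cost_def)
  next
    case False
    then show ?thesis using that vertex_cost_eq[of "d v"] by (simp add: b_def q_def half_edge_def)
  qed
  have Pw: "4 * D - 6 + d w * q w \<le> vertex_cost D (d w)"
    using w four vertex_cost_eq[of "d w"] by (simp add: q_def half_edge_def)
  have qs: "(\<Sum>v\<in>V. d v * q v) = (\<Sum>v\<in>V - {w}. q v + q (p v))"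
    using sum_arcs_rooted[OF R, of "\<lambda>e. q (fst e)"] sum_arcs[of q] by simp
  have "4 * D - 6 + (\<Sum>v\<in>V - {w}. b v) + (\<Sum>v\<in>V - {w}. q v + q (p v)) \<le> (\<Sum>v\<in>mediums. vertex_cost D (d v))"
  proof -
    have "(\<Sum>v\<in>V - {w}. b v) = (\<Sum>v\<in>mediums - {w}. b v)"
      by (rule sum.mono_neutral_right) (use graph_basics(1) in \<open>auto simp: b_def mediums_def\<close>)
    moreover have "(\<Sum>v\<in>V. d v * q v) = (\<Sum>v\<in>mediums. d v * q v)"
      by (rule sum.mono_neutral_right) (use graph_basics(1) in \<open>auto simp: q_def mediums_def\<close>)
    moreover have "(\<Sum>v\<in>mediums. d v * q v) = d w * q w + (\<Sum>v\<in>mediums - {w}. d v * q v)"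
      using w finite_mediums by (simp add: sum.remove)
    moreover have "(\<Sum>v\<in>mediums. vertex_cost D (d v)) = vertex_cost D (d w) + (\<Sum>v\<in>mediums - {w}. vertex_cost D (d v))"
      using w finite_mediums by (simp add: sum.remove)
    moreover have "(\<Sum>v\<in>mediums - {w}. b v + d v * q v) \<le> (\<Sum>v\<in>mediums - {w}. vertex_cost D (d v))"
      using P by (intro sum_mono) auto
    ultimately show ?thesis using qs Pw by (simp add: sum.distrib)
  qed
  moreover have "(\<Sum>v\<in>S. edge_rate D a) \<le> (\<Sum>v\<in>S. b v + (q v + q (p v)) + 2 * ((D - d v) * (D - d (p v))))"
  proof (rule sum_mono)
    fix v assume v: "v \<in> S"
    then have vV: "v \<in> V" "p v \<in> V" "d v \<noteq> D" "d (p v) \<noteq> D" using pV by (auto simp: S_def)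
    then have dv: "1 \<le> d v" "d v \<le> a" "1 \<le> d (p v)" "d (p v) \<le> a" using d_ge1 le_a by auto
    have "v \<in> mediums \<longleftrightarrow> 3 \<le> d v" "p v \<in> mediums \<longleftrightarrow> 3 \<le> d (p v)" using vV dv a by (auto simp: mediums_def)
    then show "edge_rate D a \<le> b v + (q v + q (p v)) + 2 * ((D - d v) * (D - d (p v)))"
      using edge_rate_aux[OF D6 a dv] by (auto simp: b_def q_def)
  qed
  moreover have "(\<Sum>v\<in>S. b v + (q v + q (p v))) \<le> (\<Sum>v\<in>V - {w}. b v + (q v + q (p v)))"
    by (rule sum_mono2) (use graph_basics(1) S q0 b0 in \<open>auto intro: add_nonneg_nonneg\<close>)
  ultimately show ?thesis
    unfolding lean_cost_def rooted_lean_arcs(2)[OF R] S_def[symmetric]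
      using A' by (simp add: sum.distrib a_def)
qed

text \<open>Each lean edge belongs to its end of larger degree, in a tie to the parent.
  \<open>z\<close> counts the edges of a medium owner, \<open>A0\<close> those whose owner has
  degree at most 2.\<close>

lemma owner_bound:
  assumes A: "int (card lean_arcs) = 2 * A"
  shows "\<exists>z A0. (\<forall>v\<in>mediums. 0 \<le> z v \<and> z v \<le> d v) \<and> 0 \<le> A0 \<and> (\<Sum>v\<in>mediums. z v) + A0 = A \<and>
    (\<Sum>v\<in>mediums. charged_cost D (d v) (z v)) + 2 * (D - 2)^2 * A0 \<le> lean_cost"
proof -
  obtain r where "r \<in> V" using graph_basics by blast
  then obtain p h where R: "rooted V E r p h" using rooted_exists by blast
  define S where "S = {v \<in> V - {r}. d v \<noteq> D \<and> d (p v) \<noteq> D}"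
  define own where "own v = (if d (p v) < d v then v else p v)" for v
  define z where "z x = int (card {v \<in> S. own v = x})" for x
  define S1 where "S1 = {v \<in> S. own v \<in> mediums}"
  define S0 where "S0 = S - S1"
  define A0 where "A0 = int (card S0)"
  define c where "c v = (if v \<in> mediums then 2 * ((D - d v) * (d v - 2)) else 0)" for v
  have S: "S \<subseteq> V - {r}" "finite S" using graph_basics(1) by (auto simp: S_def)
  have p: "p v \<in> V" "h (p v) < h v" "(v, p v) \<in> E" "(p v, v) \<in> E" if "v \<in> V - {r}" for v
    using R that by (auto simp: rooted_def)
  have A': "A = int (card S)" using rooted_lean_arcs(1)[OF R] A unfolding S_def by simp
  have group: "(\<Sum>x\<in>mediums. \<Sum>v\<in>{v \<in> S. own v = x}. g v) = (\<Sum>v\<in>S1. g v)" for g :: "'a \<Rightarrow> int"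
  proof -
    have "(\<Sum>x\<in>mediums. \<Sum>v\<in>{v \<in> S1. own v = x}. g v) = (\<Sum>v\<in>S1. g v)"
      by (rule sum.group) (use S finite_mediums in \<open>auto simp: S1_def\<close>)
    moreover have "{v \<in> S1. own v = x} = {v \<in> S. own v = x}" if "x \<in> mediums" for x
      using that by (auto simp: S1_def)
    ultimately show ?thesis by simp
  qed
  have S01: "S1 \<subseteq> S" "S0 \<subseteq> S" "S = S1 \<union> S0" "S1 \<inter> S0 = {}" "finite S1" "finite S0"
    using S(2) by (auto simp: S0_def S1_def)
  have cardS: "int (card S) = int (card S1) + A0"
    using card_Un_disjoint[of S1 S0] S01 by (simp add: A0_def)
  have total: "(\<Sum>v\<in>mediums. z v) + A0 = A"
    using group[of "\<lambda>_. 1"] A' cardS by (simp add: z_def)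
  have zd: "0 \<le> z x \<and> z x \<le> d x" for x
  proof -
    \<comment> \<open>Edges are named by their child. The parent edge of x, if x owns it, is sent to
      \<open>p x\<close>, every other edge to its child; this yields distinct neighbours of
      x.\<close>
    let ?g = "\<lambda>v. if v = x then p x else v"
    have "inj_on ?g {v \<in> S. own v = x}"
    proof (rule inj_onI)
      fix u v assume uv: "u \<in> {v \<in> S. own v = x}" "v \<in> {v \<in> S. own v = x}" "?g u = ?g v"
      have no: False if "x \<in> S" "v' \<in> S" "own v' = x" "v' \<noteq> x" "p x = v'" for v'
      proof -
        have "x \<in> V - {r}" "v' \<in> V - {r}" using that S by auto
        moreover have "p v' = x" using that by (auto simp: own_def split: if_splits)
        ultimately show False using p(2)[of x] p(2)[of v'] that by simp
      qed
      show "u = v" using uv no by (auto split: if_splits)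
    qed
    moreover have "?g ` {v \<in> S. own v = x} \<subseteq> {u. (x, u) \<in> E}"
    proof
      fix y assume "y \<in> ?g ` {v \<in> S. own v = x}"
      then obtain v where v: "v \<in> S" "own v = x" "y = ?g v" by blast
      then have "v \<in> V - {r}" using S by blast
      then show "y \<in> {u. (x, u) \<in> E}" using p(3,4)[of v] v by (simp add: own_def split: if_splits)
    qed
    ultimately have "card {v \<in> S. own v = x} \<le> card {u. (x, u) \<in> E}"
      using finite_nbrs by (rule card_inj_on_le)
    then show ?thesis by (simp add: z_def d_card)
  qed
  have ptw: "v \<in> S1 \<Longrightarrow> 2 * ((D - d (own v)) * (D - 2)) \<le> 2 * ((D - d v) * (D - d (p v))) + c v"
    "v \<in> S0 \<Longrightarrow> 2 * (D - 2)^2 \<le> 2 * ((D - d v) * (D - d (p v)))" if v: "v \<in> S" for v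
  proof -
    have "v \<in> V - {r}" using v S by blast
    then have vV: "v \<in> V" "p v \<in> V" "d v \<noteq> D" "d (p v) \<noteq> D" using p(1)[of v] v by (auto simp: S_def)
    then have dv: "1 \<le> d v" "d v < D" "1 \<le> d (p v)" "d (p v) < D"
      using d_ge1 d_le by (auto simp: less_le)
    have own: "d (own v) = max (d v) (d (p v))" "own v \<in> V" using vV by (auto simp: own_def)
    have Mv: "v \<in> mediums \<longleftrightarrow> 3 \<le> d v" "own v \<in> mediums \<longleftrightarrow> 3 \<le> d (own v)"
      using vV dv own by (auto simp: mediums_def)
    show "v \<in> S1 \<Longrightarrow> 2 * ((D - d (own v)) * (D - 2)) \<le> 2 * ((D - d v) * (D - d (p v))) + c v"
      using owner_aux(1)[OF dv] Mv own(1) by (simp add: S1_def c_def)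
    assume "v \<in> S0"
    then have "\<not> 3 \<le> max (d v) (d (p v))" using Mv own(1) by (auto simp: S0_def S1_def)
    then have "max (d v) (d (p v)) \<le> 2" by linarith
    then show "2 * (D - 2)^2 \<le> 2 * ((D - d v) * (D - d (p v)))" by (rule owner_aux(2)[OF dv])
  qed
  have c0: "0 \<le> c v" for v by (auto simp: c_def mediums_def)
  have "(\<Sum>v\<in>S1. 2 * ((D - d (own v)) * (D - 2))) \<le> (\<Sum>v\<in>S1. 2 * ((D - d v) * (D - d (p v)))) + (\<Sum>v\<in>S1. c v)"
    unfolding sum.distrib[symmetric] using ptw(1) S01 by (intro sum_mono) auto
  moreover have "(\<Sum>v\<in>S1. c v) \<le> (\<Sum>v\<in>V. c v)"
    by (rule sum_mono2) (use graph_basics(1) S S01 c0 in auto)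
  moreover have "(\<Sum>v\<in>V. c v) = (\<Sum>v\<in>mediums. c v)"
    by (rule sum.mono_neutral_right) (use graph_basics(1) in \<open>auto simp: c_def mediums_def\<close>)
  moreover have "(\<Sum>v\<in>S0. 2 * (D - 2)^2) \<le> (\<Sum>v\<in>S0. 2 * ((D - d v) * (D - d (p v))))"
    using ptw(2) S01 by (intro sum_mono) auto
  moreover have "(\<Sum>v\<in>S. 2 * ((D - d v) * (D - d (p v)))) = (\<Sum>v\<in>S1. 2 * ((D - d v) * (D - d (p v)))) + (\<Sum>v\<in>S0. 2 * ((D - d v) * (D - d (p v))))"
    unfolding S01(3) by (rule sum.union_disjoint) (use S01 in auto)
  moreover have "(\<Sum>v\<in>S1. 2 * ((D - d (own v)) * (D - 2))) = (\<Sum>x\<in>mediums. 2 * z x * (D - d x) * (D - 2))"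
    unfolding group[symmetric] by (rule sum.cong) (auto simp: z_def)
  moreover have "(\<Sum>v\<in>mediums. charged_cost D (d v) (z v)) = (\<Sum>v\<in>mediums. vertex_cost D (d v)) + (\<Sum>x\<in>mediums. 2 * z x * (D - d x) * (D - 2)) - (\<Sum>v\<in>mediums. c v)"
    unfolding sum.distrib[symmetric] sum_subtractf[symmetric]
    by (rule sum.cong) (auto simp: charged_cost_def star_cost_def c_def)
  moreover have "(\<Sum>v\<in>S0. 2 * (D - 2)^2) = 2 * (D - 2)^2 * A0" by (simp add: A0_def)
  ultimately have "(\<Sum>v\<in>mediums. charged_cost D (d v) (z v)) + 2 * (D - 2)^2 * A0 \<le> lean_cost"
    unfolding lean_cost_def rooted_lean_arcs(2)[OF R] S_def[symmetric] by linarith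
  then show ?thesis using zd total by (intro exI[of _ z] exI[of _ A0]) (simp add: A0_def)
qed

end

section \<open>The total cost and its minimum\<close>

locale sized_degree_tree = degree_tree +
  fixes k j :: nat
  assumes card_V: "card (pverts T) = k * \<Delta> + 1 + j" and j_less: "j < \<Delta>"
begin

definition K where "K = int k"
definition J where "J = int j"
definition total_cost where "total_cost = num_fat * vertex_cost D D + lean_cost"

text \<open>
  The optimal configurations: \<open>subdivided\<close> trees form the second family, \<open>doubled\<close> ones the first
  family for \<open>j \<le> 2\<close>, and those \<open>centred\<close> at \<open>w\<close> the first or third family, according to whether \<open>w\<close>
  has degree \<open>j\<close> or \<open>j + 1\<close>.
\<close>

definition subdivided where
  "subdivided \<longleftrightarrow> mediums = {} \<and> lean_arcs = {} \<and> num_fat = K + (if J = 0 then 0 else 1)"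

definition doubled where
  "doubled \<longleftrightarrow> mediums = {} \<and> num_fat = K \<and> (\<forall>(u, v)\<in>lean_arcs. d u = 2 \<and> d v = 2) \<and> int (card lean_arcs) = 2 * J"

definition centred where
  "centred w \<longleftrightarrow> mediums = {w} \<and> num_fat = K \<and> (\<forall>(u, v)\<in>lean_arcs. u = w \<and> d v = 2 \<or> v = w \<and> d u = 2) \<and> int (card lean_arcs) = 2 * J"

lemma J: "0 \<le> J" "J < D" using j_less by (auto simp: J_def D_def)

lemma sigma_total_cost:
  "sigma T = 2 * (D^2 - 6 * D + 7) * (K * D + J) + (4 * D - 6) * (K * D + J + 1) - total_cost"
  unfolding sigma_eq total_cost_def card_V by (simp add: K_def J_def D_def)

lemma arc_balance: "int (card fat_arcs) - int (card lean_arcs) = 2 * (D * (num_fat - K) - J)"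
  using arc_count unfolding card_V by (simp add: K_def J_def D_def algebra_simps)

lemma even_lean_arcs: "\<exists>A. int (card lean_arcs) = 2 * A"
proof -
  obtain r where "r \<in> V" using graph_basics by blast
  then obtain p h where "rooted V E r p h" using rooted_exists by blast
  from rooted_lean_arcs(1)[OF this] show ?thesis by blast
qed

lemma total_cost_subdivided: "subdivided \<Longrightarrow> total_cost = K * vertex_cost D D + family2_cost D J"
  by (auto simp: subdivided_def total_cost_def lean_cost_def family2_cost_def algebra_simps)

lemma total_cost_doubled: "doubled \<Longrightarrow> total_cost = K * vertex_cost D D + 2 * J * (D - 2)^2"
proof -
  assume *: "doubled"
  have "(\<Sum>e\<in>lean_arcs. W e) = (\<Sum>e\<in>lean_arcs. (D - 2)^2)"
    by (rule sum.cong) (use * in \<open>auto simp: doubled_def W_def power2_eq_square\<close>)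
  then show ?thesis using * by (simp add: total_cost_def doubled_def lean_cost_def)
qed

lemma total_cost_centred: "centred w \<Longrightarrow> total_cost = K * vertex_cost D D + star_cost D (d w) J"
proof -
  assume *: "centred w"
  have "(\<Sum>e\<in>lean_arcs. W e) = (\<Sum>e\<in>lean_arcs. (D - d w) * (D - 2))"
  proof (rule sum.cong[OF refl])
    fix e assume "e \<in> lean_arcs"
    then show "W e = (D - d w) * (D - 2)" using * unfolding centred_def W_def
      by (cases e) (auto simp: mult.commute)
  qed
  then show ?thesis using * by (simp add: total_cost_def centred_def lean_cost_def star_cost_def)
qed

text \<open>The ends of lean edges have degree 1 or 2 here, and an end of degree 1 makes
  \<open>W\<close> larger than (D - 2)^2.\<close>

lemma no_mediums_bound:
  assumes mediums: "mediums = {}" and A: "int (card lean_arcs) = 2 * A"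
  shows "2 * A * (D - 2)^2 \<le> lean_cost" "lean_cost = 2 * A * (D - 2)^2 \<Longrightarrow> (u, v) \<in> lean_arcs \<Longrightarrow> d u = 2 \<and> d v = 2"
proof -
  have W: "(D - 2)^2 \<le> W e \<and> (W e = (D - 2)^2 \<longrightarrow> d (fst e) = 2 \<and> d (snd e) = 2)" if "e \<in> lean_arcs" for e
  proof -
    have "fst e \<in> V" "snd e \<in> V" "d (fst e) \<noteq> D" "d (snd e) \<noteq> D"
      using that arc_in[of "fst e" "snd e"] by (auto simp: lean_arcs_def)
    then have "d (fst e) = 1 \<or> d (fst e) = 2" "d (snd e) = 1 \<or> d (snd e) = 2"
      using mediums not_mediums_degree by blast+
    moreover have "(D - 2) * (D - 1) = (D - 2)^2 + (D - 2)" "(D - 1) * (D - 1) = (D - 2)^2 + (2 * D - 3)"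
      by (simp_all add: algebra_simps power2_eq_square)
    ultimately show ?thesis using D6 by (auto simp: W_def power2_eq_square mult.commute)
  qed
  have lean_cost: "lean_cost - 2 * A * (D - 2)^2 = (\<Sum>e\<in>lean_arcs. W e - (D - 2)^2)"
    unfolding lean_cost_def mediums using A by (simp add: sum_subtractf)
  have "0 \<le> (\<Sum>e\<in>lean_arcs. W e - (D - 2)^2)" using W by (intro sum_nonneg) simp
  then show "2 * A * (D - 2)^2 \<le> lean_cost" using lean_cost by simp
  assume "lean_cost = 2 * A * (D - 2)^2" and uv: "(u, v) \<in> lean_arcs"
  then have "(\<Sum>e\<in>lean_arcs. W e - (D - 2)^2) = 0" using lean_cost by simp
  then have "W (u, v) - (D - 2)^2 = 0"
    using W finite_lean_arcs uv by (subst (asm) sum_nonneg_eq_0_iff) auto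
  then show "d u = 2 \<and> d v = 2" using W[OF uv] by simp
qed

lemma total_cost_bound:
  "K * vertex_cost D D + best_cost D J \<le> total_cost" (is ?A)
  and total_cost_optimal: "total_cost = K * vertex_cost D D + best_cost D J \<Longrightarrow> subdivided \<or> (doubled \<and> 1 \<le> J \<and> J \<le> 2) \<or>
    (\<exists>w. centred w \<and> 1 \<le> J \<and> (d w = J \<or> d w = J + 1 \<and> 2 \<le> J))" (is "?L \<Longrightarrow> ?R")
proof -
  have P: "0 < vertex_cost D D" using D6 vertex_cost_top_pos by simp
  have best_cost: "best_cost D J \<le> vertex_cost D D"
    using P by (cases "J = 0") (auto simp: best_cost_def family2_cost_def)
  obtain A where A: "int (card lean_arcs) = 2 * A" using even_lean_arcs by blast
  have A0: "0 \<le> A" using A by simp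
  \<comment> \<open>The number of fat arcs is nonnegative, so every vertex of degree D short of K
    forces D further lean edges.\<close>
  have bal: "D * (K - num_fat) + J \<le> A" using arc_balance A by (simp add: algebra_simps)
  have "?A \<and> (?L \<longrightarrow> ?R)"
  proof -
    consider "K < num_fat" | "num_fat = K" | "num_fat < K" by linarith
    then show ?thesis
    proof cases
      case 1
      then have "(K + 1) * vertex_cost D D \<le> num_fat * vertex_cost D D"
        using P by (intro mult_right_mono) auto
      then have le: "K * vertex_cost D D + vertex_cost D D \<le> num_fat * vertex_cost D D"
        by (simp add: algebra_simps)
      then have A: ?A using best_cost lean_cost_nonneg unfolding total_cost_def by linarith
      moreover have ?R if ?L
      proof -
        have eq: "best_cost D J = vertex_cost D D" "lean_cost = 0" "num_fat * vertex_cost D D = K * vertex_cost D D + vertex_cost D D"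
          using that le best_cost lean_cost_nonneg unfolding total_cost_def by linarith+
        then have "num_fat * vertex_cost D D = (K + 1) * vertex_cost D D" by (simp add: algebra_simps)
        then have "num_fat = K + 1" using P by simp
        moreover have "J \<noteq> 0" using eq(1) P by (auto simp: best_cost_def)
        ultimately show ?R using lean_cost_0 eq by (simp add: subdivided_def)
      qed
      ultimately show ?thesis by blast
    next
      case 2
      then have JA: "J \<le> A" using bal by simp
      have th: "total_cost = K * vertex_cost D D + lean_cost" using 2 by (simp add: total_cost_def)
      have "best_cost D J \<le> lean_cost \<and> (lean_cost = best_cost D J \<longrightarrow> ?R)"
      proof (cases "J = 0")
        case True
        then show ?thesis
          using lean_cost_nonneg lean_cost_0 2 by (auto simp: best_cost_def subdivided_def)
      next
        case False
        then have J1: "1 \<le> J" using J by simp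
        show ?thesis
        proof (cases "mediums = {}")
          case True
          have mono: "2 * J * (D - 2)^2 \<le> 2 * A * (D - 2)^2" using JA by (intro mult_right_mono) auto
          have "best_cost D J \<le> 2 * J * (D - 2)^2" using best_cost_le_edges[OF D6 J] .
          moreover have "2 * A * (D - 2)^2 \<le> lean_cost" by (rule no_mediums_bound(1)[OF True A])
          moreover have ?R if "lean_cost = best_cost D J"
          proof -
            have "2 * J * (D - 2)^2 = 2 * A * (D - 2)^2" "lean_cost = 2 * A * (D - 2)^2" "best_cost D J = 2 * J * (D - 2)^2"
              using that calculation mono by linarith+
            moreover have "J \<le> 2" using calculation(3) best_cost_less_edges[OF D6, of J] J by force
            ultimately have "doubled" "J \<le> 2"
              using no_mediums_bound(2)[OF True A] True 2 A D6 by (auto simp: doubled_def)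
            then show ?R using J1 by blast
          qed
          ultimately show ?thesis using mono by (meson order_trans)
        next
          case False
          then have "Max (d ` mediums) \<in> d ` mediums" using finite_mediums by (intro Max_in) auto
          then obtain w where w: "w \<in> mediums" "d w = Max (d ` mediums)" by auto
          then have top: "\<And>v. v \<in> mediums \<Longrightarrow> d v \<le> d w" using finite_mediums by auto
          have dw: "3 \<le> d w" "d w < D" using w(1) by (auto simp: mediums_def)
          have single: "star_cost D (d w) A \<le> lean_cost"
            "lean_cost = star_cost D (d w) A \<Longrightarrow> mediums = {w} \<and> (\<forall>(u, v)\<in>lean_arcs. u = w \<and> d v = 2 \<or> v = w \<and> d u = 2)"
            by (rule single_centre_bound[OF w(1) _ A]; (erule top | assumption))+
          have mono: "star_cost D (d w) J \<le> star_cost D (d w) A" "star_cost D (d w) A = star_cost D (d w) J \<Longrightarrow> A = J"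
          proof -
            have "star_cost D (d w) A - star_cost D (d w) J = (A - J) * (2 * ((D - d w) * (D - 2)))"
              unfolding star_cost_def by (simp add: algebra_simps)
            moreover have "0 < 2 * ((D - d w) * (D - 2))" using dw by simp
            ultimately show "star_cost D (d w) J \<le> star_cost D (d w) A" "star_cost D (d w) A = star_cost D (d w) J \<Longrightarrow> A = J"
              using JA by (smt (verit) mult_nonneg_nonneg mult_pos_pos)+
          qed
          \<comment> \<open>For J \<le> \<open>d w\<close> the star at w decides. For larger J the
            vertex w cannot be an end of all lean edges, and the star of degree J is strictly
            cheaper than the tree.\<close>
          show ?thesis
          proof (cases "J \<le> d w")
            case True
            have "best_cost D J \<le> star_cost D (d w) J" using best_cost_le_star_cost[OF D6 dw J(1) True] .
            moreover have ?R if "lean_cost = best_cost D J"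
            proof -
              have eq: "lean_cost = star_cost D (d w) A" "star_cost D (d w) A = star_cost D (d w) J" "star_cost D (d w) J = best_cost D J"
                using that calculation single(1) mono(1) by linarith+
              then have "centred w" using single(2) mono(2) 2 A by (auto simp: centred_def)
              moreover have "d w = J \<or> d w = J + 1 \<and> 2 \<le> J"
                using best_cost_less_off_diagonal[OF D6 dw J1 True] eq(3) by auto
              ultimately show ?R using J1 by blast
            qed
            ultimately show ?thesis using single(1) mono(1) by (meson order_trans)
          next
            case False
            have V: "best_cost D J \<le> star_cost D J J"
              using best_cost_le(1)[OF J1, of D] False dw by (simp add: family1_cost_def)
            \<comment> \<open>Degree 3 is not covered by \<open>edge_rate_bound\<close>. There J
              \<ge> 4, and \<open>star_cost D 3 J\<close> exceeds \<open>star_cost D J J\<close> by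
              an amount that does not involve D.\<close>
            have "star_cost D J J < lean_cost"
            proof (cases "d w = 3")
              case True
              have "star_cost D 3 J - star_cost D J J = J * (1 + (J - 2)^2) - 6"
                unfolding star_cost_def vertex_cost_def by (simp add: algebra_simps power2_eq_square)
              moreover have "4 * (1 + 2^2) \<le> J * (1 + (J - 2)^2)"
                using False True by (intro mult_mono add_left_mono power_mono) auto
              ultimately show ?thesis using single(1) mono(1) True by simp
            next
              case 4: False
              have "4 * D - 6 + A * edge_rate D (d w) \<le> lean_cost"
                by (rule edge_rate_bound[OF w(1) _ A]) (use top 4 dw in auto)
              moreover have "star_cost D J J = 4 * D - 6 + J * edge_rate D J"
                unfolding star_cost_def vertex_cost_def edge_rate_def
                  by (simp add: algebra_simps power2_eq_square)
              moreover have "edge_rate D J < edge_rate D (d w)"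
                using False dw unfolding edge_rate_def by (simp add: power_strict_mono)
              moreover have "0 \<le> edge_rate D J"
              proof -
                have "(J - 2)^2 \<le> (D - 3)^2" using J False dw by (intro power_mono) auto
                moreover have "2 * D^2 - 10 * D + 11 - (D - 3)^2 = D * (D - 4) + 2"
                  by (simp add: algebra_simps power2_eq_square)
                moreover have "0 \<le> D * (D - 4)" using D6 by simp
                ultimately show ?thesis unfolding edge_rate_def by linarith
              qed
              ultimately show ?thesis using JA J1
                by (smt (verit) mult_strict_left_mono mult_right_mono)
            qed
            then show ?thesis using V by linarith
          qed
        qed
      qed
      then show ?thesis using th by simp
    next
      case 3
      obtain z A0 where z: "\<forall>v\<in>mediums. 0 \<le> z v \<and> z v \<le> d v" "0 \<le> A0" "(\<Sum>v\<in>mediums. z v) + A0 = A"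
        "(\<Sum>v\<in>mediums. charged_cost D (d v) (z v)) + 2 * (D - 2)^2 * A0 \<le> lean_cost"
        using owner_bound[OF A] by blast
      have "(K - num_fat) * vertex_cost D D + best_cost D J < (\<Sum>v\<in>mediums. charged_cost D (d v) (z v)) + 2 * (D - 2)^2 * A0"
        by (rule sum_charged_cost_gt[OF D6 finite_mediums _ z(2) J])
          (use z 3 bal in \<open>auto simp: mediums_def mult.commute\<close>)
      then have "K * vertex_cost D D + best_cost D J < total_cost"
        using z(4) unfolding total_cost_def by (simp add: algebra_simps)
      then show ?thesis by simp
    qed
  qed
  then show ?A "?L \<Longrightarrow> ?R" by blast+
qed

end

subsection \<open>The families as optimal configurations\<close>

context sized_degree_tree
begin

definition fat_ends where "fat_ends \<longleftrightarrow> (\<forall>v. internal_leaf T v \<longrightarrow> deg T v = \<Delta>)"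

lemma deg_d: "deg T v = i \<longleftrightarrow> d v = int i" "deg T v = \<Delta> \<longleftrightarrow> d v = D" "1 < deg T v \<longleftrightarrow> 1 < d v" "Suc 0 < deg T v \<longleftrightarrow> 1 < d v"
  "2 \<le> deg T v \<longleftrightarrow> 2 \<le> d v"
  by (auto simp: d_def D_def)

lemma internal_leaf_d:
  "internal_leaf T v \<longleftrightarrow> v \<in> V \<and> 2 \<le> d v \<and> card {u. (v, u) \<in> E \<and> 1 < d u} = 1"
  by (simp add: internal_leaf_def deg_d)

lemma in_trees: "T \<in> trees (k * \<Delta> + 1 + j) \<Delta>"
  using tree maxdeg card_V by (simp add: trees_def)

lemma card_sym_edges:
  assumes X: "X \<subseteq> E" "\<And>u v. (u, v) \<in> X \<Longrightarrow> (v, u) \<in> X"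
  shows "card X = 2 * card {{u, v} | u v. (u, v) \<in> X}"
proof -
  let ?f = "\<lambda>e. {fst e, snd e}"
  have fin: "finite X" using X graph_basics(6) finite_subset by blast
  have im: "{{u, v} | u v. (u, v) \<in> X} = ?f ` X" by force
  have "card X = (\<Sum>s\<in>?f ` X. card {e \<in> X. ?f e = s})"
    using fin sum.group[of X "?f ` X" ?f "\<lambda>_. 1::nat"] by simp
  also have "\<dots> = (\<Sum>s\<in>?f ` X. 2)"
  proof (rule sum.cong[OF refl])
    fix s assume "s \<in> ?f ` X"
    then obtain u v where uv: "(u, v) \<in> X" "s = {u, v}" by auto
    then have "u \<noteq> v" using X loopless by auto
    moreover have "{e \<in> X. ?f e = s} = {(u, v), (v, u)}"
      using uv X(2) by (auto simp: doubleton_eq_iff)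
    ultimately show "card {e \<in> X. ?f e = s} = 2" by simp
  qed
  finally show ?thesis using im by simp
qed

lemma m_deg_same: "2 * m_deg T i i = card {(u, v) \<in> E. d u = int i \<and> d v = int i}"
proof -
  have "card {(u, v) \<in> E. d u = int i \<and> d v = int i} = 2 * card {{u, v} | u v. (u, v) \<in> {(u, v) \<in> E. d u = int i \<and> d v = int i}}"
    by (rule card_sym_edges) (auto intro: symE)
  then show ?thesis by (simp add: m_deg_def deg_d)
qed

lemma m_deg_top: "2 * m_deg T \<Delta> \<Delta> = card fat_arcs"
  unfolding m_deg_same fat_arcs_def by (simp add: D_def)

lemma m_deg_22: "2 * m_deg T 2 2 = card {(u, v) \<in> E. d u = 2 \<and> d v = 2}"
  using m_deg_same[of 2] by simp

lemma m_deg_22_0: "m_deg T 2 2 = 0 \<longleftrightarrow> (\<forall>(u, v)\<in>E. \<not> (d u = 2 \<and> d v = 2))"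
proof -
  have "finite {(u, v) \<in> E. d u = 2 \<and> d v = 2}" using graph_basics(6) by (rule rev_finite_subset) auto
  then have "card {(u, v) \<in> E. d u = 2 \<and> d v = 2} = 0 \<longleftrightarrow> (\<forall>(u, v)\<in>E. \<not> (d u = 2 \<and> d v = 2))" by auto
  moreover have "m_deg T 2 2 = 0 \<longleftrightarrow> card {(u, v) \<in> E. d u = 2 \<and> d v = 2} = 0" using m_deg_22 by linarith
  ultimately show ?thesis by (simp only:)
qed

lemma m_deg_top_0: "m_deg T \<Delta> \<Delta> = 0 \<longleftrightarrow> fat_arcs = {}"
proof -
  have "finite fat_arcs" using graph_basics(6) by (rule rev_finite_subset) (auto simp: fat_arcs_def)
  then have "card fat_arcs = 0 \<longleftrightarrow> fat_arcs = {}" by (rule card_0_eq)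
  moreover have "m_deg T \<Delta> \<Delta> = 0 \<longleftrightarrow> card fat_arcs = 0" using m_deg_top by linarith
  ultimately show ?thesis by (simp only:)
qed

lemma sum_n_deg: "(\<Sum>i\<in>{3..<\<Delta>}. n_deg T i) = card mediums"
proof -
  have "mediums = (\<Union>i\<in>{3..<\<Delta>}. {v \<in> V. deg T v = i})" by (auto simp: mediums_def d_def D_def)
  also have "card \<dots> = (\<Sum>i\<in>{3..<\<Delta>}. card {v \<in> V. deg T v = i})"
    by (rule card_UN_disjoint) (use graph_basics(1) in auto)
  finally show ?thesis by (simp add: n_deg_def)
qed

text \<open>By \<open>star_centre_degree\<close> v also has a neighbour that is not a leaf. It then
  has no third one and is an internal leaf of degree 2, against \<open>fat_ends\<close>.\<close>

lemma leaf_next_to_small: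
  assumes fe: "fat_ends" and uv: "(u, v) \<in> E" "d u = 1" "d v \<le> 2"
  shows False
proof -
  have v: "v \<in> V" using uv arc_in by blast
  have vu: "u \<in> {x. (v, x) \<in> E}" using uv symE by blast
  have ne: "d v \<noteq> D" using uv D6 by simp
  then obtain x where x: "(v, x) \<in> E" "d x \<noteq> 1" using star_centre_degree[OF v] by blast
  then have "1 < d x" using d_ge1 arc_in by force
  moreover have "x \<noteq> u" using x uv by auto
  have sub: "{u, x} \<subseteq> {x. (v, x) \<in> E}" using vu x by auto
  have "card {x. (v, x) \<in> E} \<le> card {u, x}" using uv(3) \<open>x \<noteq> u\<close> d_card[of v] by simp
  then have "{x. (v, x) \<in> E} = {u, x}" using sub finite_nbrs by (metis card_seteq)
  then have "{y. (v, y) \<in> E \<and> 1 < d y} = {y \<in> {u, x}. 1 < d y}" by blast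
  moreover have "{y \<in> {u, x}. 1 < d y} = {x}" using \<open>1 < d x\<close> uv(2) by auto
  moreover have "d v = 2" using \<open>{x. (v, x) \<in> E} = {u, x}\<close> \<open>x \<noteq> u\<close> d_card[of v] by simp
  ultimately have "internal_leaf T v" using v by (simp add: internal_leaf_d)
  then show False using fe ne by (auto simp: fat_ends_def deg_d D_def)
qed

lemma fat_ends_lean_arcs:
  assumes fe: "fat_ends" and uv: "(u, v) \<in> lean_arcs" "u \<notin> mediums" "v \<notin> mediums"
  shows "d u = 2 \<and> d v = 2"
proof -
  have E: "(u, v) \<in> E" "(v, u) \<in> E" using uv symE by (auto simp: lean_arcs_def)
  then have "d u = 1 \<or> d u = 2" "d v = 1 \<or> d v = 2"
    using uv not_mediums_degree arc_in by (auto simp: lean_arcs_def)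
  then show ?thesis using leaf_next_to_small[OF fe] E by fastforce
qed

text \<open>An internal leaf of degree below D would have degree at least 2 and no leaf next to it,
  hence more than one neighbour of degree greater than 1.\<close>

lemma fat_endsI:
  assumes two: "\<And>v u. (v, u) \<in> E \<Longrightarrow> d v = 2 \<Longrightarrow> d u \<noteq> 1"
    and med: "\<And>v. v \<in> mediums \<Longrightarrow> \<forall>u. (v, u) \<in> E \<longrightarrow> d u \<noteq> 1"
  shows "fat_ends"
  unfolding fat_ends_def
proof (intro allI impI)
  fix v assume "internal_leaf T v"
  then have v: "v \<in> V" "2 \<le> d v" "card {u. (v, u) \<in> E \<and> 1 < d u} = 1" by (auto simp: internal_leaf_d)
  show "deg T v = \<Delta>"
  proof (rule ccontr)
    assume "deg T v \<noteq> \<Delta>"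
    then have "v \<in> mediums \<or> d v = 2" using v d_le[of v] by (auto simp: mediums_def deg_d D_def)
    then have "d u \<noteq> 1" if "(v, u) \<in> E" for u using that two med by blast
    then have "{u. (v, u) \<in> E \<and> 1 < d u} = {u. (v, u) \<in> E}" using d_ge1 arc_in by force
    then show False using v(2,3) by (simp add: d_card)
  qed
qed

text \<open>The balance makes a and J congruent modulo D, and both lie between 0 and D - 1.\<close>

lemma balance_unique:
  assumes "fat_arcs = {}" "int (card lean_arcs) = 2 * a" "0 \<le> a" "a < D"
  shows "num_fat = K \<and> a = J"
proof -
  have "a - J = D * (K - num_fat)" using arc_balance assms by (simp add: algebra_simps)
  moreover have "\<bar>a - J\<bar> < D" using assms J by auto
  ultimately have "K - num_fat = 0"
    by (smt (verit) D6 mult_le_cancel_left1 mult_minus_right)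
  then show ?thesis using \<open>a - J = D * (K - num_fat)\<close> by simp
qed

lemma centred_lean_arcs:
  assumes lean_arcs: "\<forall>(u, v)\<in>lean_arcs. u = w \<and> d v = 2 \<or> v = w \<and> d u = 2" and w: "w \<in> mediums"
  shows "card lean_arcs = 2 * card {u. (w, u) \<in> E \<and> d u = 2}"
proof -
  let ?N = "{u. (w, u) \<in> E \<and> d u = 2}"
  have dw: "3 \<le> d w" "d w < D" using w by (auto simp: mediums_def)
  have "lean_arcs = (\<lambda>u. (w, u)) ` ?N \<union> (\<lambda>u. (u, w)) ` ?N"
    using lean_arcs dw symE by (fastforce simp: lean_arcs_def)
  moreover have "(\<lambda>u. (w, u)) ` ?N \<inter> (\<lambda>u. (u, w)) ` ?N = {}" using loopless by auto
  moreover have "finite ?N" by (rule finite_subset[OF _ finite_nbrs[of w]]) auto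
  ultimately show ?thesis by (simp add: card_Un_disjoint card_image inj_on_def)
qed

text \<open>Without lean edges the balance equates the number of fat edges with D
  (\<open>num_fat\<close> - K) - J. Requiring this to lie between 0 and D - 1 determines
  \<open>num_fat\<close>.\<close>

lemma family2_iff: "T \<in> family2 \<Delta> k j \<longleftrightarrow> subdivided"
proof -
  have fam: "T \<in> family2 \<Delta> k j \<longleftrightarrow> fat_ends \<and> (\<forall>v\<in>V. d v \<in> {1, 2, D}) \<and> m_deg T 2 2 = 0 \<and> m_deg T \<Delta> \<Delta> \<le> \<Delta> - 1"
    using in_trees unfolding family2_def fat_ends_def by (auto simp: d_def D_def)
  have top: "m_deg T \<Delta> \<Delta> \<le> \<Delta> - 1 \<longleftrightarrow> int (card fat_arcs) \<le> 2 * (D - 1)"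
    using m_deg_top six by (simp add: D_def) linarith
  show ?thesis
  proof
    assume *: "T \<in> family2 \<Delta> k j"
    then have mediums: "mediums = {}" using fam D6 by (auto simp: mediums_def)
    have lean_arcs: "lean_arcs = {}"
      using fat_ends_lean_arcs mediums m_deg_22_0 * fam by (fastforce simp: lean_arcs_def)
    have "0 \<le> D * (num_fat - K) - J" "D * (num_fat - K) - J \<le> D - 1"
      using arc_balance lean_arcs top * fam by auto
    then have "num_fat = K + (if J = 0 then 0 else 1)"
    proof -
      assume b: "0 \<le> D * (num_fat - K) - J" "D * (num_fat - K) - J \<le> D - 1"
      have "D * (num_fat - K) < D * 2" "D * (-1) < D * (num_fat - K)" using b J D6 by linarith+
      moreover have "0 < D" using D6 by simp
      ultimately have x: "num_fat - K < 2" "-1 < num_fat - K" using mult_less_cancel_left_pos by blast+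
      consider "num_fat - K = 0" | "num_fat - K = 1" using x by linarith
      then show ?thesis using b J by cases (auto split: if_splits)
    qed
    then show "subdivided" using mediums lean_arcs by (simp add: subdivided_def)
  next
    assume *: "subdivided"
    have "fat_ends"
    proof (rule fat_endsI)
      fix v u assume "(v, u) \<in> E" "d v = 2"
      then show "d u \<noteq> 1" using * D6 by (force simp: subdivided_def lean_arcs_def)
    qed (use * in \<open>auto simp: subdivided_def\<close>)
    moreover have "\<forall>v\<in>V. d v \<in> {1, 2, D}" using * not_mediums_degree by (auto simp: subdivided_def)
    moreover have "m_deg T 2 2 = 0"
      unfolding m_deg_22_0 using * D6 by (force simp: subdivided_def lean_arcs_def)
    moreover have "int (card fat_arcs) \<le> 2 * (D - 1)"
      using * arc_balance J D6 by (auto simp: subdivided_def)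
    ultimately show "T \<in> family2 \<Delta> k j" using fam top by blast
  qed
qed

lemma centred_nbrs:
  assumes c: "centred w"
  shows "w \<in> mediums" "int (card {u. (w, u) \<in> E \<and> d u = 2}) = J" "fat_arcs = {}" "m_deg T 2 2 = 0" "m_deg T \<Delta> \<Delta> = 0"
    "(w, u) \<in> E \<Longrightarrow> d u = 2 \<or> d u = D" "fat_ends"
proof -
  show w: "w \<in> mediums" using c by (simp add: centred_def)
  then have dw: "3 \<le> d w" "d w < D" by (auto simp: mediums_def)
  have lean_arcs: "\<forall>(u, v)\<in>lean_arcs. u = w \<and> d v = 2 \<or> v = w \<and> d u = 2"
    using c by (simp add: centred_def)
  show "int (card {u. (w, u) \<in> E \<and> d u = 2}) = J"
    using centred_lean_arcs[OF lean_arcs w] c by (simp add: centred_def)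
  have "int (card fat_arcs) = 0" using arc_balance c by (simp add: centred_def)
  then show "m_deg T \<Delta> \<Delta> = 0" using m_deg_top by simp
  then show fat_arcs: "fat_arcs = {}" using m_deg_top_0 by simp
  show "m_deg T 2 2 = 0" unfolding m_deg_22_0 using lean_arcs dw D6 by (fastforce simp: lean_arcs_def)
  show nb: "d u = 2 \<or> d u = D" if "(w, u) \<in> E" for u
    using lean_arcs dw that by (fastforce simp: lean_arcs_def)
  show "fat_ends"
  proof (rule fat_endsI)
    fix v u assume vu: "(v, u) \<in> E" "d v = 2"
    show "d u \<noteq> 1"
    proof
      assume "d u = 1"
      then have "(v, u) \<in> lean_arcs" using vu D6 by (simp add: lean_arcs_def)
      then show False using lean_arcs vu \<open>d u = 1\<close> dw by auto
    qed
  next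
    fix v assume "v \<in> mediums"
    then have "v = w" using c by (simp add: centred_def)
    then show "\<forall>u. (v, u) \<in> E \<longrightarrow> d u \<noteq> 1" using nb D6 by fastforce
  qed
qed

text \<open>The j neighbours of degree 2 and the one of degree D exhaust the neighbours of w, so w
  lies on exactly j lean edges; the internal leaf condition and the absence of edges between
  vertices of degree 2 exclude any others.\<close>

lemma family3_iff:
  assumes J: "2 \<le> J" "J \<le> D - 2"
  shows "T \<in> family3 \<Delta> k j \<longleftrightarrow> (\<exists>w. centred w \<and> d w = J + 1)"
proof -
  have fam: "T \<in> family3 \<Delta> k j \<longleftrightarrow> fat_ends \<and> m_deg T 2 2 = 0 \<and> m_deg T \<Delta> \<Delta> = 0 \<and>
    (\<exists>w. w \<in> mediums \<and> d w = J + 1 \<and> (\<forall>v\<in>V - {w}. d v \<in> {1, 2, D}) \<and>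
      int (card {u. (w, u) \<in> E \<and> d u = 2}) = J \<and> card {u. (w, u) \<in> E \<and> d u = D} = 1)"
  proof -
    have "medium_vertex T w \<longleftrightarrow> w \<in> mediums" for w
      using maxdeg by (auto simp: medium_vertex_def mediums_def d_def D_def)
    moreover have "deg T w = j + 1 \<longleftrightarrow> d w = J + 1" for w by (auto simp: d_def J_def)
    moreover have "deg T v \<in> {1, 2, \<Delta>} \<longleftrightarrow> d v \<in> {1, 2, D}" for v by (auto simp: d_def D_def)
    moreover have "2 \<le> j" "j \<le> \<Delta> - 2" using J six by (auto simp: J_def D_def)
    moreover have "card X = j \<longleftrightarrow> int (card X) = J" for X :: "'a set" by (simp add: J_def)
    ultimately show ?thesis
      using in_trees unfolding family3_def fat_ends_def by (simp add: deg_d D_def)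
  qed
  show ?thesis
  proof
    assume "T \<in> family3 \<Delta> k j"
    then obtain w where fe: "fat_ends" and m: "m_deg T 2 2 = 0" "m_deg T \<Delta> \<Delta> = 0"
      and w: "w \<in> mediums" "d w = J + 1" "\<forall>v\<in>V - {w}. d v \<in> {1, 2, D}"
        "int (card {u. (w, u) \<in> E \<and> d u = 2}) = J" "card {u. (w, u) \<in> E \<and> d u = D} = 1"
      unfolding fam by blast
    have "v = w" if "v \<in> mediums" for v
    proof (rule ccontr)
      assume "v \<noteq> w"
      then have "v \<in> V - {w}" using that by (simp add: mediums_def)
      from w(3)[rule_format, OF this] show False using that by (auto simp: mediums_def)
    qed
    then have Mw: "mediums = {w}" using w(1) by blast
    have fat_arcs: "fat_arcs = {}" using m(2) m_deg_top_0 by simp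
    have nb: "d u = 2 \<or> d u = D" if "(w, u) \<in> E" for u
    proof -
      let ?A = "{u. (w, u) \<in> E \<and> d u = 2}" and ?B = "{u. (w, u) \<in> E \<and> d u = D}"
      have fin: "finite ?A" "finite ?B" by (rule finite_subset[OF _ finite_nbrs[of w]]; auto)+
      have "card (?A \<union> ?B) = card ?A + card ?B"
        using fin D6 by (intro card_Un_disjoint) auto
      then have "int (card (?A \<union> ?B)) = d w" using w by simp
      then have "card {u. (w, u) \<in> E} \<le> card (?A \<union> ?B)" by (simp add: d_card)
      then have "?A \<union> ?B = {u. (w, u) \<in> E}" by (intro card_seteq finite_nbrs) auto
      then show ?thesis using that by blast
    qed
    have lean_arcs: "u = w \<and> d v = 2 \<or> v = w \<and> d u = 2" if uv: "(u, v) \<in> lean_arcs" for u v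
    proof -
      have E: "(u, v) \<in> E" "(v, u) \<in> E" "d u \<noteq> D" "d v \<noteq> D" using uv symE by (auto simp: lean_arcs_def)
      show ?thesis
      proof (cases "u = w \<or> v = w")
        case True
        then show ?thesis using nb E by blast
      next
        case False
        then show ?thesis using fat_ends_lean_arcs[OF fe uv] Mw m(1) m_deg_22_0 E by auto
      qed
    qed
    have "card lean_arcs = 2 * card {u. (w, u) \<in> E \<and> d u = 2}"
      by (rule centred_lean_arcs) (use lean_arcs w in auto)
    then have c: "int (card lean_arcs) = 2 * J" using w by simp
    then have "num_fat = K" using balance_unique[OF fat_arcs c] \<open>2 \<le> J\<close> \<open>J \<le> D - 2\<close> by simp
    then show "\<exists>w. centred w \<and> d w = J + 1" using Mw lean_arcs c w by (auto simp: centred_def)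
  next
    assume "\<exists>w. centred w \<and> d w = J + 1"
    then obtain w where c: "centred w" and dw: "d w = J + 1" by blast
    note nb = centred_nbrs[OF c]
    have "card {u. (w, u) \<in> E \<and> d u = D} = 1"
    proof -
      let ?A = "{u. (w, u) \<in> E \<and> d u = 2}" and ?B = "{u. (w, u) \<in> E \<and> d u = D}"
      have fin: "finite ?A" "finite ?B" by (rule finite_subset[OF _ finite_nbrs[of w]]; auto)+
      have un: "{u. (w, u) \<in> E} = ?A \<union> ?B" using nb(6) by blast
      have "?A \<inter> ?B = {}" using D6 by auto
      then have "card (?A \<union> ?B) = card ?A + card ?B" by (rule card_Un_disjoint[OF fin])
      then have "int (card {u. (w, u) \<in> E}) = int (card ?A) + int (card ?B)"
        by (simp only: un of_nat_add)
      then show ?thesis using nb(2) dw d_card[of w] by linarith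
    qed
    moreover have "\<forall>v\<in>V - {w}. d v \<in> {1, 2, D}" using c not_mediums_degree by (auto simp: centred_def)
    ultimately show "T \<in> family3 \<Delta> k j" unfolding fam using nb dw by blast
  qed
qed

text \<open>If no edge joins two vertices of degree 2, the condition \<open>m_deg T a 2 = a\<close>
  gives the medium vertex only neighbours of degree 2; it lies on a lean edges, and the balance
  yields a = J, so J \<ge> 3. Otherwise there is no medium vertex, the lean edges are those between
  vertices of degree 2, and J is their number, 1 or 2.\<close>

lemma family1_iff:
  assumes J1: "1 \<le> J"
  shows "T \<in> family1 \<Delta> k j \<longleftrightarrow> (if J \<le> 2 then doubled else \<exists>w. centred w \<and> d w = J)"
proof -
  have fam: "T \<in> family1 \<Delta> k j \<longleftrightarrow> fat_ends \<and> m_deg T 2 2 \<le> 2 \<and> m_deg T \<Delta> \<Delta> = 0 \<and> card mediums \<le> 1 \<and>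
     (m_deg T 2 2 = 0 \<longleftrightarrow> (\<exists>a\<in>{3..<\<Delta>}. card mediums = n_deg T a \<and> n_deg T a = 1)) \<and>
     (m_deg T 2 2 = 0 \<longrightarrow> (\<forall>a\<in>{3..<\<Delta>}. n_deg T a = 1 \<longrightarrow> m_deg T a 2 = a))"
    using in_trees unfolding family1_def fat_ends_def by (simp add: sum_n_deg)
  have single: "(\<exists>a\<in>{3..<\<Delta>}. card mediums = n_deg T a \<and> n_deg T a = 1) \<longleftrightarrow> card mediums = 1"
  proof
    assume "card mediums = 1"
    then obtain w where w: "mediums = {w}" by (auto simp: card_1_singleton_iff)
    then have wM: "w \<in> mediums" by simp
    then have "deg T w \<in> {3..<\<Delta>}" by (auto simp: mediums_def d_def D_def)
    moreover have "{v \<in> V. deg T v = deg T w} = {w}"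
    proof -
      have "v \<in> mediums" if "v \<in> V" "deg T v = deg T w" for v
        using wM that by (auto simp: mediums_def d_def)
      then show ?thesis using w wM by (auto simp: mediums_def)
    qed
    ultimately show "\<exists>a\<in>{3..<\<Delta>}. card mediums = n_deg T a \<and> n_deg T a = 1"
      using w by (intro bexI[of _ "deg T w"]) (simp_all add: n_deg_def)
  qed auto
  have m_a2: "m_deg T a 2 = card {u. (w, u) \<in> E \<and> d u = 2}"
    if w: "mediums = {w}" "d w = int a" for a w
  proof -
    have wM: "w \<in> mediums" using w by simp
    have key: "u = w" if "(u, v) \<in> E" "deg T u = a" for u v
    proof -
      have "u \<in> mediums" using that arc_in[of u v] wM w(2) by (simp add: mediums_def deg_d)
      then show ?thesis using w(1) by simp
    qed
    have "{{u, v} | u v. (u, v) \<in> E \<and> deg T u = a \<and> deg T v = 2} = (\<lambda>v. {w, v}) ` {u. (w, u) \<in> E \<and> d u = 2}"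
    proof (intro equalityI subsetI)
      fix e assume "e \<in> {{u, v} | u v. (u, v) \<in> E \<and> deg T u = a \<and> deg T v = 2}"
      then obtain u v where "e = {u, v}" "(u, v) \<in> E" "deg T u = a" "deg T v = 2" by blast
      then show "e \<in> (\<lambda>v. {w, v}) ` {u. (w, u) \<in> E \<and> d u = 2}" using key by (auto simp: deg_d(1))
    next
      fix e assume "e \<in> (\<lambda>v. {w, v}) ` {u. (w, u) \<in> E \<and> d u = 2}"
      then obtain v where "e = {w, v}" "(w, v) \<in> E" "d v = 2" by blast
      moreover have "deg T w = a" "deg T v = 2" using w(2) \<open>d v = 2\<close> by (simp_all add: deg_d(1))
      ultimately show "e \<in> {{u, v} | u v. (u, v) \<in> E \<and> deg T u = a \<and> deg T v = 2}" by blast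
    qed
    moreover have "inj_on (\<lambda>v. {w, v}) {u. (w, u) \<in> E \<and> d u = 2}"
      by (auto simp: inj_on_def doubleton_eq_iff)
    ultimately show ?thesis by (simp add: m_deg_def card_image)
  qed
  show ?thesis
  proof
    assume T: "T \<in> family1 \<Delta> k j"
    then have fe: "fat_ends" and m22: "m_deg T 2 2 \<le> 2" and fat_arcs: "fat_arcs = {}" and cM: "card mediums \<le> 1"
      and eq: "m_deg T 2 2 = 0 \<longleftrightarrow> card mediums = 1"
      and a2: "\<And>a. m_deg T 2 2 = 0 \<Longrightarrow> a \<in> {3..<\<Delta>} \<Longrightarrow> n_deg T a = 1 \<Longrightarrow> m_deg T a 2 = a"
      unfolding fam single using m_deg_top_0 by auto
    show "if J \<le> 2 then doubled else \<exists>w. centred w \<and> d w = J"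
    proof (cases "m_deg T 2 2 = 0")
      case True
      then have cM1: "card mediums = 1" using eq by simp
      then obtain a where a: "a \<in> {3..<\<Delta>}" "n_deg T a = 1" using single by blast
      obtain w where w: "mediums = {w}" using cM1 by (auto simp: card_1_singleton_iff)
      have dw: "d w = int a"
      proof -
        obtain x where x: "{v \<in> V. deg T v = a} = {x}"
          using a(2) by (auto simp: n_deg_def card_1_singleton_iff)
        then have "x \<in> V" "deg T x = a" by auto
        then have "x \<in> mediums" using a(1) by (auto simp: mediums_def d_def D_def)
        then have "x = w" using w by simp
        then show ?thesis using \<open>deg T x = a\<close> by (simp add: d_def)
      qed
      have ca: "card {u. (w, u) \<in> E \<and> d u = 2} = a" using a2[OF True a] m_a2[OF w dw] by simp
      have nb: "d u = 2" if "(w, u) \<in> E" for u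
      proof -
        have "card {u. (w, u) \<in> E} \<le> card {u. (w, u) \<in> E \<and> d u = 2}" using ca dw by (simp add: d_card)
        then have "{u. (w, u) \<in> E \<and> d u = 2} = {u. (w, u) \<in> E}" by (intro card_seteq finite_nbrs) auto
        then show ?thesis using that by blast
      qed
      have lean_arcs: "u = w \<and> d v = 2 \<or> v = w \<and> d u = 2" if uv: "(u, v) \<in> lean_arcs" for u v
      proof -
        have E: "(u, v) \<in> E" "(v, u) \<in> E" using uv symE by (auto simp: lean_arcs_def)
        show ?thesis
        proof (cases "u = w \<or> v = w")
          case True
          then show ?thesis using nb E by blast
        next
          case False
          then show ?thesis using fat_ends_lean_arcs[OF fe uv] w True m_deg_22_0 E by auto
        qed
      qed
      have "card lean_arcs = 2 * card {u. (w, u) \<in> E \<and> d u = 2}"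
        by (rule centred_lean_arcs) (use lean_arcs w in auto)
      then have c: "int (card lean_arcs) = 2 * int a" using ca by simp
      have "num_fat = K \<and> int a = J"
        by (rule balance_unique[OF fat_arcs c]) (use a in \<open>auto simp: D_def\<close>)
      then show ?thesis using w lean_arcs c dw a by (auto simp: centred_def)
    next
      case False
      then have mediums: "mediums = {}"
        using eq cM finite_mediums by (metis card_0_eq le_antisym less_one not_le)
      have lean_arcs: "d u = 2 \<and> d v = 2" if "(u, v) \<in> lean_arcs" for u v
        using fat_ends_lean_arcs[OF fe that] mediums by simp
      have "lean_arcs = {(u, v) \<in> E. d u = 2 \<and> d v = 2}" using lean_arcs D6 by (auto simp: lean_arcs_def)
      then have c: "int (card lean_arcs) = 2 * int (m_deg T 2 2)" using m_deg_22 by simp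
      have "num_fat = K \<and> int (m_deg T 2 2) = J"
        by (rule balance_unique[OF fat_arcs c]) (use m22 D6 in auto)
      then show ?thesis using mediums lean_arcs c m22 by (auto simp: doubled_def)
    qed
  next
    assume *: "if J \<le> 2 then doubled else \<exists>w. centred w \<and> d w = J"
    show "T \<in> family1 \<Delta> k j"
    proof (cases "J \<le> 2")
      case True
      then have db: "doubled" using * by simp
      then have mediums: "mediums = {}" and lean_arcs: "\<And>u v. (u, v) \<in> lean_arcs \<Longrightarrow> d u = 2 \<and> d v = 2"
        by (auto simp: doubled_def)
      have "fat_ends"
      proof (rule fat_endsI)
        fix v u assume vu: "(v, u) \<in> E" "d v = 2"
        show "d u \<noteq> 1"
        proof
          assume "d u = 1"
          then have "(v, u) \<in> lean_arcs" using vu D6 by (simp add: lean_arcs_def)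
          then show False using lean_arcs[of v u] \<open>d u = 1\<close> by simp
        qed
      next
        fix v assume "v \<in> mediums"
        then show "\<forall>u. (v, u) \<in> E \<longrightarrow> d u \<noteq> 1" using mediums by simp
      qed
      moreover have "lean_arcs = {(u, v) \<in> E. d u = 2 \<and> d v = 2}"
        using lean_arcs D6 by (auto simp: lean_arcs_def)
      then have "int (m_deg T 2 2) = J" using m_deg_22 db by (simp add: doubled_def)
      moreover have "int (card fat_arcs) = 0" using arc_balance db by (simp add: doubled_def)
      then have "m_deg T \<Delta> \<Delta> = 0" using m_deg_top by simp
      ultimately show ?thesis unfolding fam single using mediums True J1 by simp
    next
      case False
      then obtain w where c: "centred w" "d w = J" using * by auto
      have mediums: "mediums = {w}" using c by (simp add: centred_def)
      have "m_deg T a 2 = a" if a: "a \<in> {3..<\<Delta>}" "n_deg T a = 1" for a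
      proof -
        obtain x where x: "{v \<in> V. deg T v = a} = {x}"
          using a(2) by (auto simp: n_deg_def card_1_singleton_iff)
        then have "x \<in> V" "deg T x = a" by auto
        then have "x \<in> mediums" using a(1) by (auto simp: mediums_def d_def D_def)
        then have "x = w" using mediums by simp
        then have "d w = int a" using \<open>deg T x = a\<close> by (simp add: d_def)
        then show ?thesis using m_a2[OF mediums] centred_nbrs(2)[OF c(1)] c(2) by simp
      qed
      then show ?thesis unfolding fam single using centred_nbrs[OF c(1)] mediums by simp
    qed
  qed
qed

end

subsection \<open>Existence of the configurations\<close>

lemma card_nbrs_rooted:
  assumes R: "rooted V E r p h" and v: "v \<in> V"
  shows "card {u. (v, u) \<in> E} = card {u \<in> V - {r}. p u = v} + (if v = r then 0 else 1)"
proof -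
  have p: "\<And>v. v \<in> V - {r} \<Longrightarrow> p v \<in> V \<and> h (p v) < h v" and fin: "finite V"
    and E: "E = (\<lambda>v. (v, p v)) ` (V - {r}) \<union> (\<lambda>v. (p v, v)) ` (V - {r})"
    using R by (auto simp: rooted_def)
  have nb: "{u. (v, u) \<in> E} = {u \<in> V - {r}. p u = v} \<union> (if v = r then {} else {p v})"
    using v unfolding E by auto
  have no: "p v \<notin> {u \<in> V - {r}. p u = v}" if "v \<noteq> r"
  proof
    assume "p v \<in> {u \<in> V - {r}. p u = v}"
    then show False using p[of v] p[of "p v"] that v by auto
  qed
  have fin': "finite {u \<in> V - {r}. p u = v}" using fin by simp
  show ?thesis
  proof (cases "v = r")
    case False
    then have "{u. (v, u) \<in> E} = insert (p v) {u \<in> V - {r}. p u = v}" using nb by simp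
    then show ?thesis using card_insert_disjoint[OF fin' no[OF False]] False by simp
  qed (use nb in simp)
qed

text \<open>A tree is described on any convenient type of nodes and copied injectively into the
  infinite type. Degrees are read off the parent function: the children, plus one for the
  parent.\<close>

lemma realise_rooted:
  fixes V :: "'b set" and p :: "'b \<Rightarrow> 'b" and h :: "'b \<Rightarrow> nat"
  assumes fin: "finite V" and r: "r \<in> V" and p: "\<And>v. v \<in> V - {r} \<Longrightarrow> p v \<in> V \<and> h (p v) < h v"
  shows "\<exists>(T :: 'a::infinite pair_pre_digraph) f p' h'. bij_betw f V (pverts T) \<and> ugraph_tree T \<and>
    rooted (pverts T) (parcs T) (f r) p' h' \<and> (\<forall>v\<in>V - {r}. p' (f v) = f (p v)) \<and>
    (\<forall>v\<in>V. deg T (f v) = card {u \<in> V - {r}. p u = v} + (if v = r then 0 else 1))"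
proof -
  obtain B :: "'a set" where B: "finite B" "card B = card V"
    using infinite_arbitrarily_large[OF infinite_UNIV, where n = "card V"] by blast
  obtain f where f: "bij_betw f V B" using finite_same_card_bij[OF fin B(1)] B(2) by metis
  define g where "g = the_inv_into V f"
  have inj: "inj_on f V" and fV: "f ` V = B" using f by (auto simp: bij_betw_def)
  have g: "g (f v) = v" if "v \<in> V" for v using the_inv_into_f_f[OF inj that] by (simp add: g_def)
  define p' where "p' x = f (p (g x))" for x
  define h' where "h' x = h (g x)" for x
  define E where "E = (\<lambda>v. (v, p' v)) ` (B - {f r}) \<union> (\<lambda>v. (p' v, v)) ` (B - {f r})"
  let ?T = "\<lparr>pverts = B, parcs = E\<rparr>"
  have p': "p' (f v) = f (p v)" if "v \<in> V" for v using g[OF that] by (simp add: p'_def)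
  have Br: "B - {f r} = f ` (V - {r})" using inj fV r by (auto simp: inj_on_def)
  have R: "rooted B E (f r) p' h'"
    unfolding rooted_def
  proof (intro conjI)
    show "\<forall>v\<in>B - {f r}. p' v \<in> B \<and> h' (p' v) < h' v"
    proof
      fix x assume "x \<in> B - {f r}"
      then obtain v where v: "v \<in> V - {r}" "x = f v" unfolding Br by auto
      then show "p' x \<in> B \<and> h' (p' x) < h' x" using p[of v] p'[of v] g fV by (auto simp: h'_def)
    qed
  qed (use B r fV E_def in auto)
  have "deg ?T (f v) = card {u \<in> V - {r}. p u = v} + (if v = r then 0 else 1)" if v: "v \<in> V" for v
  proof -
    have fv: "f v \<in> B" using v fV by auto
    have "deg ?T (f v) = card {u \<in> B - {f r}. p' u = f v} + (if f v = f r then 0 else 1)"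
      using card_nbrs_rooted[OF R fv] by (simp add: deg_eq_card)
    moreover have "f v = f r \<longleftrightarrow> v = r" using inj v r by (auto simp: inj_on_def)
    moreover have "{u \<in> B - {f r}. p' u = f v} = f ` {u \<in> V - {r}. p u = v}"
    proof -
      have "p' (f u) = f v \<longleftrightarrow> p u = v" if "u \<in> V - {r}" for u
        using p'[of u] p[of u] that v inj by (auto simp: inj_on_def)
      then show ?thesis unfolding Br by auto
    qed
    moreover have "card (f ` {u \<in> V - {r}. p u = v}) = card {u \<in> V - {r}. p u = v}"
      by (rule card_image) (use inj in \<open>auto simp: inj_on_def\<close>)
    ultimately show ?thesis by simp
  qed
  moreover have "ugraph_tree ?T" by (rule rooted_imp_ugraph_tree[OF R])
  ultimately show ?thesis using f R p' by (intro exI[of _ ?T] exI[of _ f] exI[of _ p'] exI[of _ h']) simp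
qed

text \<open>\<open>Mid i\<close> is the vertex of degree 2 just before \<open>Spoke i\<close>,
  absent for spokes adjacent to the hub; \<open>Leaf i t\<close> hangs on
  \<open>Spoke i\<close>.\<close>

datatype node = Hub | HubLeaf nat | Mid nat | Spoke nat | Leaf nat nat

text \<open>
  All families are realised by one construction. The hub has \<open>d0\<close> adjacent spokes, \<open>a\<close> spokes at
  distance 2 and \<open>l\<close> leaves; the remaining spokes are strung in a chain behind the last of these,
  consecutive ones at distance 2. All spokes are filled up with leaves to degree \<open>\<Delta>\<close>.
\<close>

locale hub_tree =
  fixes \<Delta> d0 a l s :: nat
  assumes Delta: "6 \<le> \<Delta>" and spokes: "1 \<le> d0 + a" "d0 + a \<le> s"
    and hub: "2 \<le> d0 + a + l" "d0 + a + l \<le> \<Delta>" "d0 + a + l = \<Delta> \<or> l = 0"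
begin

text \<open>Counts the edge from \<open>Spoke i\<close> on to \<open>Mid (i + 1)\<close>, which
  takes the place of one leaf. It exists from i = d0 + a - 1, the last spoke near the hub, to the
  last but one spoke.\<close>

definition chained where "chained i = (if d0 + a \<le> i + 1 \<and> i + 1 < s then 1 else 0 :: nat)"

definition nodes where
  "nodes = {Hub} \<union> HubLeaf ` {..<l} \<union> Mid ` {d0..<s} \<union> Spoke ` {..<s} \<union>
    (\<lambda>(i, t). Leaf i t) ` (SIGMA i:{..<s}. {..<\<Delta> - 1 - chained i})"

fun par :: "node \<Rightarrow> node" where
  "par Hub = Hub"
| "par (HubLeaf t) = Hub"
| "par (Mid i) = (if i < d0 + a then Hub else Spoke (i - 1))"
| "par (Spoke i) = (if i < d0 then Hub else Mid i)"
| "par (Leaf i t) = Spoke i"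

text \<open>The chain runs through \<open>Spoke (i - 1)\<close>, \<open>Mid i\<close>,
  \<open>Spoke i\<close>, hence two levels for each index.\<close>

fun height :: "node \<Rightarrow> nat" where
  "height Hub = 0"
| "height (HubLeaf t) = 1"
| "height (Mid i) = 2 * i + 1"
| "height (Spoke i) = 2 * i + 2"
| "height (Leaf i t) = 2 * i + 3"

definition ndeg where "ndeg v = card {u \<in> nodes - {Hub}. par u = v} + (if v = Hub then 0 else 1)"

lemma finite_nodes: "finite nodes" by (simp add: nodes_def)

lemma par: "v \<in> nodes - {Hub} \<Longrightarrow> par v \<in> nodes \<and> height (par v) < height v"
  using spokes by (auto simp: nodes_def image_iff split: if_splits)

lemma chained_le: "chained i \<le> \<Delta> - 1" using Delta by (auto simp: chained_def)

lemma ndeg_simps: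
  "ndeg Hub = d0 + a + l"
  "HubLeaf t \<in> nodes \<Longrightarrow> ndeg (HubLeaf t) = 1"
  "Mid i \<in> nodes \<Longrightarrow> ndeg (Mid i) = 2"
  "Spoke i \<in> nodes \<Longrightarrow> ndeg (Spoke i) = \<Delta>"
  "Leaf i t \<in> nodes \<Longrightarrow> ndeg (Leaf i t) = 1"
proof -
  have e: "{u \<in> nodes - {Hub}. par u = Hub} = HubLeaf ` {..<l} \<union> (Mid ` {d0..<d0 + a} \<union> Spoke ` {..<d0})"
    using spokes by (auto simp: nodes_def split: if_splits)
  have "card (HubLeaf ` {..<l} \<union> (Mid ` {d0..<d0 + a} \<union> Spoke ` {..<d0})) = l + (a + d0)"
    by (subst card_Un_disjoint; (subst card_Un_disjoint)?) (auto simp: card_image inj_on_def)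
  then show "ndeg Hub = d0 + a + l" unfolding ndeg_def e by simp
  show "ndeg (HubLeaf t) = 1" if "HubLeaf t \<in> nodes"
  proof -
    have e: "{u \<in> nodes - {Hub}. par u = HubLeaf t} = {}" by (auto simp: nodes_def split: if_splits)
    show ?thesis unfolding ndeg_def e by simp
  qed
  show "ndeg (Leaf i t) = 1" if "Leaf i t \<in> nodes"
  proof -
    have e: "{u \<in> nodes - {Hub}. par u = Leaf i t} = {}" by (auto simp: nodes_def split: if_splits)
    show ?thesis unfolding ndeg_def e by simp
  qed
  show "ndeg (Mid i) = 2" if "Mid i \<in> nodes"
  proof -
    have e: "{u \<in> nodes - {Hub}. par u = Mid i} = {Spoke i}"
      using that by (auto simp: nodes_def split: if_splits)
    show ?thesis unfolding ndeg_def e by simp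
  qed
  show "ndeg (Spoke i) = \<Delta>" if "Spoke i \<in> nodes"
  proof -
    have i: "i < s" using that by (auto simp: nodes_def)
    have e: "{u \<in> nodes - {Hub}. par u = Spoke i} = Leaf i ` {..<\<Delta> - 1 - chained i} \<union> (if chained i = 1 then {Mid (i + 1)} else {})"
      using i spokes by (auto simp: nodes_def chained_def image_iff split: if_splits)
    have "card (Leaf i ` {..<\<Delta> - 1 - chained i} \<union> (if chained i = 1 then {Mid (i + 1)} else {})) = \<Delta> - 1 - chained i + chained i"
      by (subst card_Un_disjoint) (auto simp: card_image inj_on_def chained_def)
    then show ?thesis unfolding ndeg_def e using chained_le[of i] Delta by simp
  qed
qed

text \<open>A spoke, its leaves and the \<open>Mid\<close> chained behind it make \<Delta> vertices,
  as a chained spoke has one leaf less. There remain the hub, its l leaves and the a vertices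
  between the hub and spokes at distance 2.\<close>

lemma card_nodes: "card nodes = s * \<Delta> + 1 + a + l"
proof -
  have chain: "(\<Sum>i<s. chained i) = s - (d0 + a)"
  proof -
    have "(\<Sum>i<s. chained i) = card {i \<in> {..<s}. d0 + a \<le> i + 1 \<and> i + 1 < s}"
      unfolding chained_def by (simp add: sum.If_cases Int_def)
    also have "{i \<in> {..<s}. d0 + a \<le> i + 1 \<and> i + 1 < s} = {d0 + a - 1..<s - 1}"
      using spokes by auto
    finally show ?thesis using spokes by simp
  qed
  have leaves: "(\<Sum>i<s. \<Delta> - 1 - chained i) + (s - (d0 + a)) = s * (\<Delta> - 1)"
  proof -
    have "(\<Sum>i<s. \<Delta> - 1 - chained i + chained i) = (\<Sum>i<s. \<Delta> - 1)"
      by (rule sum.cong) (simp_all only: le_add_diff_inverse2[OF chained_le])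
    then show ?thesis unfolding chain[symmetric] by (simp only: sum.distrib) simp
  qed
  let ?L = "SIGMA i:{..<s}. {..<\<Delta> - 1 - chained i}"
  have "card nodes = 1 + l + (s - d0) + s + card ?L"
  proof -
    have "inj_on (\<lambda>(i, t). Leaf i t) ?L" by (auto simp: inj_on_def)
    then have "card ((\<lambda>(i, t). Leaf i t) ` ?L) = card ?L" by (rule card_image)
    moreover have "card (HubLeaf ` {..<l}) = l" "card (Mid ` {d0..<s}) = s - d0" "card (Spoke ` {..<s}) = s"
      by (simp_all add: card_image inj_on_def)
    ultimately show ?thesis unfolding nodes_def
      by (subst card_Un_disjoint; (subst card_Un_disjoint)?; (subst card_Un_disjoint)?; (subst card_Un_disjoint)?) auto
  qed
  also have "card ?L = (\<Sum>i<s. \<Delta> - 1 - chained i)" by simp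
  finally have "card nodes + (s - (d0 + a)) = 1 + l + (s - d0) + s + s * (\<Delta> - 1)" using leaves by simp
  moreover have "s * \<Delta> = s * (\<Delta> - 1) + s" using Delta by (simp add: algebra_simps)
  ultimately show ?thesis using spokes by linarith
qed


lemma ndeg_cases:
  assumes "v \<in> nodes"
  shows "ndeg v \<in> {1, 2, \<Delta>} \<or> v = Hub" "1 \<le> ndeg v" "ndeg v \<le> \<Delta>"
  using assms ndeg_simps hub Delta by (cases v; simp)+

lemma node_in:
  "Hub \<in> nodes" "Spoke i \<in> nodes \<longleftrightarrow> i < s" "Mid i \<in> nodes \<longleftrightarrow> d0 \<le> i \<and> i < s"
  by (auto simp: nodes_def)

text \<open>The nodes whose parent edge becomes a lean edge of the realised tree.\<close>

definition slack where "slack = {v \<in> nodes - {Hub}. ndeg v \<noteq> \<Delta> \<and> ndeg (par v) \<noteq> \<Delta>}"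

text \<open>A hub of degree \<Delta> leaves no lean edge. Otherwise the hub has no leaves, and
  exactly the edges to its a neighbours of degree 2 are lean.\<close>

lemma slack_eq: "slack = (if d0 + a + l = \<Delta> then {} else Mid ` {d0..<d0 + a})"
proof -
  have "v \<in> slack \<longleftrightarrow> d0 + a + l \<noteq> \<Delta> \<and> v \<in> Mid ` {d0..<d0 + a}" for v
  proof (cases v)
    case (HubLeaf t)
    then show ?thesis using hub ndeg_simps(1) by (auto simp: slack_def nodes_def)
  next
    case (Mid i)
    then show ?thesis using spokes ndeg_simps(1) ndeg_simps(3)[of i] ndeg_simps(4)[of "i - 1"] Delta
      by (auto simp: slack_def node_in image_iff)
  next
    case (Spoke i)
    then show ?thesis using ndeg_simps(4) by (auto simp: slack_def)
  next
    case (Leaf i t)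
    then have "v \<in> nodes \<Longrightarrow> Spoke i \<in> nodes" by (auto simp: nodes_def)
    then show ?thesis using ndeg_simps(4) Leaf by (auto simp: slack_def)
  qed (auto simp: slack_def)
  then show ?thesis by auto
qed

lemma card_fat_nodes:
  "card {v \<in> nodes. ndeg v = \<Delta>} = s + (if d0 + a + l = \<Delta> then 1 else 0)"
proof -
  have "v \<in> nodes \<and> ndeg v = \<Delta> \<longleftrightarrow> v \<in> Spoke ` {..<s} \<or> (v = Hub \<and> d0 + a + l = \<Delta>)" for v
    using ndeg_simps Delta by (cases v) (auto simp: node_in image_iff)
  then have "{v \<in> nodes. ndeg v = \<Delta>} = Spoke ` {..<s} \<union> (if d0 + a + l = \<Delta> then {Hub} else {})" by auto
  moreover have "card (Spoke ` {..<s} \<union> (if d0 + a + l = \<Delta> then {Hub} else {})) = s + (if d0 + a + l = \<Delta> then 1 else 0)"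
    by (subst card_Un_disjoint) (auto simp: card_image inj_on_def)
  ultimately show ?thesis by simp
qed

lemma hub_realised:
  assumes n: "s * \<Delta> + a + l = k * \<Delta> + j" and j: "j < \<Delta>"
  shows "\<exists>(T :: 'a::infinite pair_pre_digraph) f. sized_degree_tree T \<Delta> k j \<and> inj_on f nodes \<and>
    pverts T = f ` nodes \<and> (\<forall>v\<in>nodes. deg T (f v) = ndeg v) \<and>
    parcs T = (\<lambda>v. (f v, f (par v))) ` (nodes - {Hub}) \<union> (\<lambda>v. (f (par v), f v)) ` (nodes - {Hub})"
proof -
  obtain T :: "'a pair_pre_digraph" and f p' h' where
    f: "bij_betw f nodes (pverts T)" and T: "ugraph_tree T" and R: "rooted (pverts T) (parcs T) (f Hub) p' h'"
    and p': "\<forall>v\<in>nodes - {Hub}. p' (f v) = f (par v)"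
    and dg: "\<forall>v\<in>nodes. deg T (f v) = card {u \<in> nodes - {Hub}. par u = v} + (if v = Hub then 0 else 1)"
    using realise_rooted[where 'a = 'a, OF finite_nodes node_in(1) par] by blast
  have dg': "deg T (f v) = ndeg v" if "v \<in> nodes" for v using dg that by (simp add: ndeg_def)
  have inj: "inj_on f nodes" and V: "pverts T = f ` nodes" using f by (auto simp: bij_betw_def)
  have "Max (deg T ` pverts T) = \<Delta>"
  proof (rule Max_eqI)
    show "finite (deg T ` pverts T)" using finite_nodes V by simp
    show "x \<le> \<Delta>" if "x \<in> deg T ` pverts T" for x using that V dg' ndeg_cases(3) by auto
    have "Spoke 0 \<in> nodes" using spokes by (simp add: node_in)
    then have "deg T (f (Spoke 0)) = \<Delta>" using dg' ndeg_simps(4) by simp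
    then show "\<Delta> \<in> deg T ` pverts T" using V \<open>Spoke 0 \<in> nodes\<close> by (metis imageI)
  qed
  moreover have "card (pverts T) = k * \<Delta> + 1 + j"
    using card_nodes n inj V by (simp add: card_image)
  ultimately have "sized_degree_tree T \<Delta> k j"
    using T Delta j by unfold_locales (simp_all add: max_deg_def)
  moreover have "parcs T = (\<lambda>v. (f v, f (par v))) ` (nodes - {Hub}) \<union> (\<lambda>v. (f (par v), f v)) ` (nodes - {Hub})"
  proof -
    have "pverts T - {f Hub} = f ` (nodes - {Hub})" using inj V node_in(1) by (auto simp: inj_on_def)
    then show ?thesis using R p' unfolding rooted_def by (auto simp: image_image intro!: image_cong)
  qed
  ultimately show ?thesis using inj V dg' by (intro exI[of _ T] exI[of _ f]) simp
qed

lemma hub_counts: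
  fixes T :: "'a pair_pre_digraph"
  assumes S: "sized_degree_tree T \<Delta> k j" and inj: "inj_on f nodes" and V: "pverts T = f ` nodes"
    and dg: "\<forall>v\<in>nodes. deg T (f v) = ndeg v"
    and E: "parcs T = (\<lambda>v. (f v, f (par v))) ` (nodes - {Hub}) \<union> (\<lambda>v. (f (par v), f v)) ` (nodes - {Hub})"
  shows "degree_tree.mediums T \<Delta> = (if 3 \<le> d0 + a + l \<and> d0 + a + l < \<Delta> then {f Hub} else {})"
    and "degree_tree.num_fat T \<Delta> = int s + (if d0 + a + l = \<Delta> then 1 else 0)"
    and "degree_tree.lean_arcs T \<Delta> = (\<lambda>v. (f v, f (par v))) ` slack \<union> (\<lambda>v. (f (par v), f v)) ` slack"
    and "card (degree_tree.lean_arcs T \<Delta>) = 2 * card slack"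
    and "v \<in> nodes \<Longrightarrow> degree_tree.d T (f v) = int (ndeg v)"
proof -
  interpret sized_degree_tree T \<Delta> k j by (rule S)
  show df: "d (f v) = int (ndeg v)" if "v \<in> nodes" for v using dg that by (simp add: d_def)
  have "v \<in> nodes \<and> 3 \<le> ndeg v \<and> ndeg v < \<Delta> \<longleftrightarrow> v = Hub \<and> 3 \<le> d0 + a + l \<and> d0 + a + l < \<Delta>" for v
    using ndeg_cases(1)[of v] ndeg_simps(1) node_in(1) by auto
  then have "{v \<in> nodes. 3 \<le> ndeg v \<and> ndeg v < \<Delta>} = (if 3 \<le> d0 + a + l \<and> d0 + a + l < \<Delta> then {Hub} else {})" by auto
  moreover have "mediums = f ` {v \<in> nodes. 3 \<le> ndeg v \<and> ndeg v < \<Delta>}"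
    unfolding mediums_def D_def V using df by auto
  ultimately show "mediums = (if 3 \<le> d0 + a + l \<and> d0 + a + l < \<Delta> then {f Hub} else {})" by simp
  have "{x \<in> V. d x = D} = f ` {v \<in> nodes. ndeg v = \<Delta>}" unfolding V D_def using df by auto
  moreover have "card (f ` {v \<in> nodes. ndeg v = \<Delta>}) = card {v \<in> nodes. ndeg v = \<Delta>}"
    by (rule card_image) (use inj in \<open>auto simp: inj_on_def\<close>)
  ultimately show "num_fat = int s + (if d0 + a + l = \<Delta> then 1 else 0)"
    using card_fat_nodes by (simp add: num_fat_def)
  have dD: "d (f v) \<noteq> D \<longleftrightarrow> ndeg v \<noteq> \<Delta>" if "v \<in> nodes" for v using df[OF that] by (simp add: D_def)
  show lean_arcs: "lean_arcs = (\<lambda>v. (f v, f (par v))) ` slack \<union> (\<lambda>v. (f (par v), f v)) ` slack"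
  proof -
    have iff: "(f v, f (par v)) \<in> lean_arcs \<longleftrightarrow> v \<in> slack" "(f (par v), f v) \<in> lean_arcs \<longleftrightarrow> v \<in> slack" if "v \<in> nodes - {Hub}" for v
      using that par[of v] dD E unfolding lean_arcs_def slack_def by auto
    show ?thesis
    proof (intro equalityI subsetI)
      fix e assume e: "e \<in> lean_arcs"
      then have "e \<in> parcs T" by (auto simp: lean_arcs_def)
      then obtain v where v: "v \<in> nodes - {Hub}" "e = (f v, f (par v)) \<or> e = (f (par v), f v)"
        unfolding E by blast
      then have "v \<in> slack" using e iff by auto
      then show "e \<in> (\<lambda>v. (f v, f (par v))) ` slack \<union> (\<lambda>v. (f (par v), f v)) ` slack" using v by blast
    next
      fix e assume "e \<in> (\<lambda>v. (f v, f (par v))) ` slack \<union> (\<lambda>v. (f (par v), f v)) ` slack"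
      then obtain v where v: "v \<in> slack" "e = (f v, f (par v)) \<or> e = (f (par v), f v)" by blast
      then have "v \<in> nodes - {Hub}" by (simp add: slack_def)
      then show "e \<in> lean_arcs" using iff v by auto
    qed
  qed
  have sl: "v \<in> nodes" "par v \<in> nodes" "height (par v) < height v" if "v \<in> slack" for v
    using that par[of v] by (auto simp: slack_def)
  have fin: "finite slack" using finite_nodes by (simp add: slack_def)
  have "(\<lambda>v. (f v, f (par v))) ` slack \<inter> (\<lambda>v. (f (par v), f v)) ` slack = {}"
  proof (rule ccontr)
    assume "\<not> ?thesis"
    then obtain u v where "u \<in> slack" "v \<in> slack" "f u = f (par v)" "f (par u) = f v" by auto
    then have "u = par v" "par u = v" using sl by (auto dest: inj_onD[OF inj])
    then show False using sl(3)[OF \<open>u \<in> slack\<close>] sl(3)[OF \<open>v \<in> slack\<close>] by simp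
  qed
  moreover have "inj_on (\<lambda>v. (f v, f (par v))) slack" "inj_on (\<lambda>v. (f (par v), f v)) slack"
    by (rule inj_onI; use sl in \<open>auto dest: inj_onD[OF inj]\<close>)+
  ultimately show "card lean_arcs = 2 * card slack"
    unfolding lean_arcs using fin by (simp add: card_Un_disjoint card_image)
qed

text \<open>The hub has degree \<Delta> as well, so s + 1 vertices of that degree are
  counted.\<close>

lemma subdivided_exists:
  assumes n: "s * \<Delta> + a + l = k * \<Delta> + j" "j < \<Delta>" "d0 + a + l = \<Delta>" "s + 1 = k + (if j = 0 then 0 else 1)"
  shows "\<exists>T :: 'a::infinite pair_pre_digraph. sized_degree_tree T \<Delta> k j \<and> sized_degree_tree.subdivided T \<Delta> k j"
proof -
  obtain T :: "'a pair_pre_digraph" and f where T: "sized_degree_tree T \<Delta> k j" "inj_on f nodes" "pverts T = f ` nodes"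
    "\<forall>v\<in>nodes. deg T (f v) = ndeg v"
    "parcs T = (\<lambda>v. (f v, f (par v))) ` (nodes - {Hub}) \<union> (\<lambda>v. (f (par v), f v)) ` (nodes - {Hub})"
    using hub_realised[OF n(1,2), where 'a = 'a] by blast
  interpret sized_degree_tree T \<Delta> k j by (rule T)
  note c = hub_counts[OF T]
  have "num_fat = K + (if J = 0 then 0 else 1)"
    using c(2) n(3,4) by (auto simp: K_def J_def split: if_splits)
  then have "subdivided" unfolding subdivided_def using c(1,3) n(3) by (simp add: slack_eq)
  then show ?thesis using T(1) by blast
qed

lemma doubled_exists:
  assumes n: "s = k" "a = j" "d0 + a + l = 2"
  shows "\<exists>T :: 'a::infinite pair_pre_digraph. sized_degree_tree T \<Delta> k j \<and> sized_degree_tree.doubled T \<Delta> k j"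
proof -
  have l: "l = 0" "d0 + a + l \<noteq> \<Delta>" using hub n(3) Delta by auto
  have n': "s * \<Delta> + a + l = k * \<Delta> + j" "j < \<Delta>" using n l Delta by auto
  obtain T :: "'a pair_pre_digraph" and f where T: "sized_degree_tree T \<Delta> k j" "inj_on f nodes" "pverts T = f ` nodes"
    "\<forall>v\<in>nodes. deg T (f v) = ndeg v"
    "parcs T = (\<lambda>v. (f v, f (par v))) ` (nodes - {Hub}) \<union> (\<lambda>v. (f (par v), f v)) ` (nodes - {Hub})"
    using hub_realised[OF n', where 'a = 'a] by blast
  interpret sized_degree_tree T \<Delta> k j by (rule T)
  note c = hub_counts[OF T]
  have sl: "slack = Mid ` {d0..<d0 + a}" unfolding slack_eq using l(2) by simp
  then have "card slack = j" using n by (simp add: card_image inj_on_def)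
  moreover have "d (f v) = 2 \<and> d (f (par v)) = 2" if "v \<in> slack" for v
    using that c(5) n(3) spokes ndeg_simps(1,3) node_in unfolding sl by auto
  ultimately have "doubled" unfolding doubled_def
    using c(1-4) n l(2) by (auto simp: K_def J_def)
  then show ?thesis using T(1) by blast
qed

lemma centred_exists:
  assumes n: "s = k" "a = j" "3 \<le> d0 + a + l" "d0 + a + l < \<Delta>"
  shows "\<exists>(T :: 'a::infinite pair_pre_digraph) w. sized_degree_tree T \<Delta> k j \<and> sized_degree_tree.centred T \<Delta> k j w \<and>
    degree_tree.d T w = int (d0 + a)"
proof -
  have l: "l = 0" "d0 + a + l \<noteq> \<Delta>" using hub n by auto
  have n': "s * \<Delta> + a + l = k * \<Delta> + j" "j < \<Delta>" using n l Delta by auto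
  obtain T :: "'a pair_pre_digraph" and f where T: "sized_degree_tree T \<Delta> k j" "inj_on f nodes" "pverts T = f ` nodes"
    "\<forall>v\<in>nodes. deg T (f v) = ndeg v"
    "parcs T = (\<lambda>v. (f v, f (par v))) ` (nodes - {Hub}) \<union> (\<lambda>v. (f (par v), f v)) ` (nodes - {Hub})"
    using hub_realised[OF n', where 'a = 'a] by blast
  interpret sized_degree_tree T \<Delta> k j by (rule T)
  note c = hub_counts[OF T]
  have sl: "slack = Mid ` {d0..<d0 + a}" unfolding slack_eq using l(2) by simp
  then have "card slack = j" using n by (simp add: card_image inj_on_def)
  moreover have "d (f v) = 2 \<and> f (par v) = f Hub" if "v \<in> slack" for v
    using that c(5) spokes ndeg_simps(3) node_in unfolding sl by auto
  ultimately have "centred (f Hub)" unfolding centred_def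
    using c(1-4) n l(2) by (auto simp: K_def J_def)
  moreover have "d (f Hub) = int (d0 + a)" using c(5)[OF node_in(1)] ndeg_simps(1) l(1) by linarith
  ultimately show ?thesis using T(1) by blast
qed

end

subsection \<open>Maximal trees\<close>

lemma sized_iff:
  assumes "6 \<le> \<Delta>" "j < \<Delta>"
  shows "T \<in> trees (k * \<Delta> + 1 + j) \<Delta> \<longleftrightarrow> sized_degree_tree T \<Delta> k j"
  using assms by (auto simp: trees_def sized_degree_tree_def degree_tree_def sized_degree_tree_axioms_def)

text \<open>The value of \<sigma> at total cost k \<open>vertex_cost\<close> + x, with the vertex
  cost taken at degree \<Delta>. Comparing trees means comparing x in reverse order.\<close>

definition sigma_level :: "nat \<Rightarrow> nat \<Rightarrow> nat \<Rightarrow> int \<Rightarrow> int" where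
  "sigma_level \<Delta> k j x = 2 * (int \<Delta> ^ 2 - 6 * int \<Delta> + 7) * (int k * int \<Delta> + int j)
    + (4 * int \<Delta> - 6) * (int k * int \<Delta> + int j + 1) - int k * vertex_cost (int \<Delta>) (int \<Delta>) - x"

definition family3_cost :: "int \<Rightarrow> int \<Rightarrow> int" where
  "family3_cost D j = star_cost D (j + 1) j"

context sized_degree_tree
begin

lemma sigma_level_iff: "sigma T = sigma_level \<Delta> k j x \<longleftrightarrow> total_cost = K * vertex_cost D D + x"
  unfolding sigma_total_cost sigma_level_def D_def K_def J_def by auto

lemma total_cost_family1:
  assumes "1 \<le> J" "T \<in> family1 \<Delta> k j"
  shows "total_cost = K * vertex_cost D D + family1_cost D J"
proof (cases "J \<le> 2")
  case True
  then have "doubled" using family1_iff[OF assms(1)] assms(2) by simp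
  moreover have "J = 1 \<or> J = 2" using assms(1) True by linarith
  then have "family1_cost D J = 2 * J * (D - 2)^2"
    by (auto simp: family1_cost_def star_cost_def vertex_cost_def power2_eq_square)
  ultimately show ?thesis using total_cost_doubled by simp
next
  case False
  then obtain w where "centred w" "d w = J" using family1_iff[OF assms(1)] assms(2) by auto
  then show ?thesis using total_cost_centred[of w] False by (simp add: family1_cost_def max_def)
qed

lemma total_cost_family2: "T \<in> family2 \<Delta> k j \<Longrightarrow> total_cost = K * vertex_cost D D + family2_cost D J"
  using family2_iff total_cost_subdivided by blast

lemma family3_J: "T \<in> family3 \<Delta> k j \<Longrightarrow> 2 \<le> J \<and> J \<le> D - 2"
  by (auto simp: family3_def J_def D_def)

lemma total_cost_family3: "T \<in> family3 \<Delta> k j \<Longrightarrow> total_cost = K * vertex_cost D D + family3_cost D J"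
  using family3_iff family3_J total_cost_centred unfolding family3_cost_def by metis

lemma optimal_families:
  assumes "total_cost = K * vertex_cost D D + best_cost D J"
  shows "(1 \<le> J \<and> T \<in> family1 \<Delta> k j) \<or> T \<in> family2 \<Delta> k j \<or> T \<in> family3 \<Delta> k j"
  using total_cost_optimal[OF assms]
proof (elim disjE exE conjE)
  fix w assume w: "centred w" "1 \<le> J" "d w = J"
  then have "3 \<le> J" using centred_nbrs(1)[OF w(1)] by (simp add: mediums_def)
  then show ?thesis using w family1_iff by auto
next
  fix w assume w: "centred w" "1 \<le> J" "d w = J + 1" "2 \<le> J"
  then have "J \<le> D - 2" using centred_nbrs(1)[OF w(1)] by (simp add: mediums_def)
  then show ?thesis using w family3_iff by blast
qed (use family2_iff family1_iff in auto)

text \<open>Besides D with 1 or 2, the prescribed differences allow the degrees D - 1 and 1 on an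
  edge. A vertex of degree D - 1 would then have leaves as its only neighbours, and
  \<open>star_centre_degree\<close> excludes that.\<close>

lemma nice_iff:
  assumes "J = 0"
  shows "nice_tree T \<longleftrightarrow> subdivided"
proof
  assume nice: "nice_tree T"
  have gap: "\<bar>d u - d v\<bar> = D - 1 \<or> \<bar>d u - d v\<bar> = D - 2" if "(u, v) \<in> E" for u v
  proof -
    have "(d u - d v)^2 = (D - 1)^2 \<or> (d u - d v)^2 = (D - 2)^2"
      using nice that maxdeg unfolding nice_tree_def d_def D_def by auto
    then show ?thesis using D6 by (auto simp: power2_eq_iff)
  qed
  have rng: "1 \<le> d u" "d u \<le> D" "1 \<le> d v" "d v \<le> D" if "(u, v) \<in> E" for u v
    using that arc_in d_ge1 d_le by blast+
  have near: "d v \<noteq> D - 1" if v: "v \<in> V" for v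
  proof
    assume dv: "d v = D - 1"
    have "d u = 1" if "(v, u) \<in> E" for u using gap[OF that] rng[OF that] dv D6 by (smt (verit))
    then have "d v = D" by (rule star_centre_degree[OF v])
    then show False using dv by simp
  qed
  have ends: "(d u = D \<and> d v \<le> 2) \<or> (d v = D \<and> d u \<le> 2)" if uv: "(u, v) \<in> E" for u v
  proof -
    have "d u \<noteq> D - 1" "d v \<noteq> D - 1" using near arc_in uv by blast+
    then show ?thesis using gap[OF uv] rng[OF uv] by (smt (verit))
  qed
  have mediums: "mediums = {}"
  proof (rule ccontr)
    assume "mediums \<noteq> {}"
    then obtain v where v: "v \<in> V" "3 \<le> d v" "d v < D" by (auto simp: mediums_def)
    then have "card {u. (v, u) \<in> E} \<noteq> 0" using d_card[of v] by auto
    then have "{u. (v, u) \<in> E} \<noteq> {}" by (metis card.empty)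
    then obtain u where "(v, u) \<in> E" by blast
    then show False using ends[of v u] v by linarith
  qed
  have "lean_arcs = {}" "fat_arcs = {}" using ends D6 by (fastforce simp: lean_arcs_def fat_arcs_def)+
  then show "subdivided" using arc_balance mediums assms D6 by (simp add: subdivided_def)
next
  assume s: "subdivided"
  then have "int (card fat_arcs) = 0" using arc_balance assms by (simp add: subdivided_def)
  then have fat_arcs: "fat_arcs = {}" using m_deg_top_0 m_deg_top by simp
  have "(d u - d v)^2 \<in> {(D - 1)^2, (D - 2)^2}" if uv: "(u, v) \<in> E" for u v
  proof -
    have V: "u \<in> V" "v \<in> V" using arc_in uv by blast+
    have "d u = D \<or> d v = D" using s uv by (auto simp: subdivided_def lean_arcs_def)
    moreover have "\<not> (d u = D \<and> d v = D)" using fat_arcs uv by (auto simp: fat_arcs_def)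
    moreover have "mediums = {}" using s by (simp add: subdivided_def)
    ultimately have "(d u = D \<and> (d v = 1 \<or> d v = 2)) \<or> (d v = D \<and> (d u = 1 \<or> d u = 2))"
      using not_mediums_degree V by blast
    then show ?thesis by (auto simp: power2_commute)
  qed
  then show "nice_tree T" unfolding nice_tree_def using tree maxdeg by (auto simp: d_def D_def)
qed

end

lemma nice_sigma_level: "sigma_level \<Delta> k 0 0 = nice_sigma \<Delta> k"
  unfolding sigma_level_def nice_sigma_def vertex_cost_def
  by (simp add: algebra_simps power2_eq_square power3_eq_cube)

lemma family1_nonempty:
  assumes D: "6 \<le> \<Delta>" and j: "1 \<le> j" "j < \<Delta>" and k: "\<Delta> - 1 \<le> k"
  shows "(family1 \<Delta> k j :: 'a::infinite pair_pre_digraph set) \<noteq> {}"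
proof -
  consider "j = 1" | "j = 2" | "3 \<le> j" using j by linarith
  then show ?thesis
  proof cases
    case 1
    \<comment> \<open>A hub of degree 2 next to one spoke and one \<open>Mid\<close>; the edge to
      the latter is the only lean edge.\<close>
    interpret hub_tree \<Delta> 1 1 0 k using D k by unfold_locales auto
    obtain T :: "'a pair_pre_digraph" where T: "sized_degree_tree T \<Delta> k j" "sized_degree_tree.doubled T \<Delta> k j"
      using doubled_exists[of k j, where 'a = 'a] 1 by auto
    interpret sized_degree_tree T \<Delta> k j by (rule T)
    have "1 \<le> J" "J \<le> 2" unfolding J_def using 1 by simp_all
    then have "T \<in> family1 \<Delta> k j" using family1_iff T(2) by presburger
    then show ?thesis by blast
  next
    case 2
    \<comment> \<open>Both neighbours of the hub have degree 2, which gives two lean edges.\<close>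
    interpret hub_tree \<Delta> 0 2 0 k using D k by unfold_locales auto
    obtain T :: "'a pair_pre_digraph" where T: "sized_degree_tree T \<Delta> k j" "sized_degree_tree.doubled T \<Delta> k j"
      using doubled_exists[of k j, where 'a = 'a] 2 by auto
    interpret sized_degree_tree T \<Delta> k j by (rule T)
    have "1 \<le> J" "J \<le> 2" unfolding J_def using 2 by simp_all
    then have "T \<in> family1 \<Delta> k j" using family1_iff T(2) by presburger
    then show ?thesis by blast
  next
    case 3
    \<comment> \<open>The hub is the centre of degree j; enough spokes exist since j \<le> \<Delta>
      - 1 \<le> k.\<close>
    interpret hub_tree \<Delta> 0 j 0 k using D k j 3 by unfold_locales auto
    obtain T :: "'a pair_pre_digraph" and w where T: "sized_degree_tree T \<Delta> k j" "sized_degree_tree.centred T \<Delta> k j w"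
        "degree_tree.d T w = int (0 + j)"
      using centred_exists[of k j, where 'a = 'a] 3 j by auto
    interpret sized_degree_tree T \<Delta> k j by (rule T)
    have "1 \<le> J" "\<not> J \<le> 2" "d w = J" using 3 T(3) by (simp_all add: J_def)
    then have "T \<in> family1 \<Delta> k j" using family1_iff T(2) by metis
    then show ?thesis by blast
  qed
qed

lemma family2_nonempty:
  assumes D: "6 \<le> \<Delta>" and j: "j < \<Delta>" and k: "\<Delta> - 1 \<le> k"
  shows "(family2 \<Delta> k j :: 'a::infinite pair_pre_digraph set) \<noteq> {}"
proof -
  obtain T :: "'a pair_pre_digraph" where T: "sized_degree_tree T \<Delta> k j" "sized_degree_tree.subdivided T \<Delta> k j"
  proof (cases "j = 0")
    case True
    \<comment> \<open>The hub with its \<Delta> - 1 leaves is one of the k vertices of degree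
      \<Delta>, so k - 1 spokes are left.\<close>
    interpret hub_tree \<Delta> 0 1 "\<Delta> - 1" "k - 1" using D k by unfold_locales auto
    have "(k - 1) * \<Delta> + 1 + (\<Delta> - 1) = k * \<Delta> + j" using D k True by (cases k) auto
    then show thesis using subdivided_exists[of k j, where 'a = 'a] True D k that by auto
  next
    case False
    \<comment> \<open>A hub with j leaves and \<Delta> - j adjacent spokes: k + 1 vertices of degree
      \<Delta> and \<Delta> - j edges among them.\<close>
    interpret hub_tree \<Delta> "\<Delta> - j" 0 j k using D k j False by unfold_locales auto
    show thesis using subdivided_exists[of k j, where 'a = 'a] False D j that by auto
  qed
  interpret sized_degree_tree T \<Delta> k j by (rule T)
  have "T \<in> family2 \<Delta> k j" using family2_iff T(2) by simp
  then show ?thesis by blast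
qed

lemma family3_nonempty:
  assumes D: "6 \<le> \<Delta>" and j: "2 \<le> j" "j \<le> \<Delta> - 2" and k: "\<Delta> - 1 \<le> k"
  shows "(family3 \<Delta> k j :: 'a::infinite pair_pre_digraph set) \<noteq> {}"
proof -
  \<comment> \<open>One adjacent spoke and j spokes at distance 2 give the hub degree j + 1, which
    is at most \<Delta> - 1 and hence at most k.\<close>
  interpret hub_tree \<Delta> 1 j 0 k using D k j by unfold_locales auto
  have "3 \<le> 1 + j + 0" "1 + j + 0 < \<Delta>" using D j by auto
  then obtain T :: "'a pair_pre_digraph" and w where T: "sized_degree_tree T \<Delta> k j" "sized_degree_tree.centred T \<Delta> k j w"
      "degree_tree.d T w = int (1 + j)"
    using centred_exists[OF refl refl, where 'a = 'a] by blast
  interpret sized_degree_tree T \<Delta> k j by (rule T)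
  have "2 \<le> J" "J \<le> D - 2" using j D by (auto simp: J_def D_def)
  moreover have "d w = J + 1" using T(3) by (simp add: J_def)
  ultimately have "T \<in> family3 \<Delta> k j" using family3_iff T(2) by metis
  then show ?thesis by blast
qed

lemma image_eq_singleton: "A \<noteq> {} \<Longrightarrow> (\<And>x. x \<in> A \<Longrightarrow> f x = c) \<Longrightarrow> f ` A = {c}"
  by auto

lemma sigma_families:
  assumes D: "6 \<le> \<Delta>" and j: "j < \<Delta>" and k: "\<Delta> - 1 \<le> k"
  shows "1 \<le> j \<Longrightarrow> sigma ` (family1 \<Delta> k j :: 'a::infinite pair_pre_digraph set) = {sigma_level \<Delta> k j (family1_cost (int \<Delta>) (int j))}"
    and "sigma ` (family2 \<Delta> k j :: 'a pair_pre_digraph set) = {sigma_level \<Delta> k j (family2_cost (int \<Delta>) (int j))}"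
    and "2 \<le> j \<Longrightarrow> j \<le> \<Delta> - 2 \<Longrightarrow> sigma ` (family3 \<Delta> k j :: 'a pair_pre_digraph set) = {sigma_level \<Delta> k j (family3_cost (int \<Delta>) (int j))}"
proof -
  have sized: "sized_degree_tree T \<Delta> k j" if "T \<in> family1 \<Delta> k j \<union> family2 \<Delta> k j \<union> family3 \<Delta> k j" for T :: "'a pair_pre_digraph"
    using that sized_iff[OF D j, of T k] by (auto simp: family1_def family2_def family3_def)
  have *: "(1 \<le> j \<longrightarrow> T \<in> family1 \<Delta> k j \<longrightarrow> sigma T = sigma_level \<Delta> k j (family1_cost (int \<Delta>) (int j))) \<and>
     (T \<in> family2 \<Delta> k j \<longrightarrow> sigma T = sigma_level \<Delta> k j (family2_cost (int \<Delta>) (int j))) \<and>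
     (T \<in> family3 \<Delta> k j \<longrightarrow> sigma T = sigma_level \<Delta> k j (family3_cost (int \<Delta>) (int j)))"
    if T: "T \<in> family1 \<Delta> k j \<union> family2 \<Delta> k j \<union> family3 \<Delta> k j" for T :: "'a pair_pre_digraph"
  proof -
    interpret sized_degree_tree T \<Delta> k j using sized[OF T] .
    show ?thesis unfolding sigma_level_iff
      using total_cost_family1 total_cost_family2 total_cost_family3 by (auto simp: D_def J_def)
  qed
  show "1 \<le> j \<Longrightarrow> sigma ` (family1 \<Delta> k j :: 'a pair_pre_digraph set) = {sigma_level \<Delta> k j (family1_cost (int \<Delta>) (int j))}"
    by (rule image_eq_singleton) (use family1_nonempty[OF D _ j k] * in auto)
  show "sigma ` (family2 \<Delta> k j :: 'a pair_pre_digraph set) = {sigma_level \<Delta> k j (family2_cost (int \<Delta>) (int j))}"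
    by (rule image_eq_singleton) (use family2_nonempty[OF D j k] * in auto)
  show "2 \<le> j \<Longrightarrow> j \<le> \<Delta> - 2 \<Longrightarrow> sigma ` (family3 \<Delta> k j :: 'a pair_pre_digraph set) = {sigma_level \<Delta> k j (family3_cost (int \<Delta>) (int j))}"
    by (rule image_eq_singleton) (use family3_nonempty[OF D _ _ k] * in auto)
qed

lemma common_sigmaI: "sigma ` F = {s} \<Longrightarrow> common_sigma F = s"
  unfolding common_sigma_def by auto

text \<open>Isolating the square root compares m = 2j + \<Delta> - 4 with it. As m is nonnegative,
  both sides may be squared, and m^2 - s is four times the quadratic of
  \<open>family1_cost_minus_vertex_cost\<close>.\<close>

lemma r_threshold_iff:
  assumes D: "6 \<le> \<Delta>" and j: "1 \<le> j" "j < \<Delta>"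
  shows "real j < r_threshold \<Delta> \<longleftrightarrow> family1_cost (int \<Delta>) (int j) < vertex_cost (int \<Delta>) (int \<Delta>)"
    and "real j = r_threshold \<Delta> \<longleftrightarrow> family1_cost (int \<Delta>) (int j) = vertex_cost (int \<Delta>) (int \<Delta>)"
proof -
  define q where "q = int j ^ 2 + (int \<Delta> - 4) * int j - int \<Delta> ^ 2 + 6 * int \<Delta> - 7"
  define m where "m = 2 * real j + real \<Delta> - 4"
  define s where "s = 5 * real \<Delta> ^ 2 - 32 * real \<Delta> + 44"
  have m: "0 \<le> m" using D by (simp add: m_def)
  have mq: "m^2 - s = 4 * real_of_int q"
    unfolding m_def s_def q_def by (simp add: algebra_simps power2_eq_square)
  have s: "0 \<le> s"
  proof -
    have "s = (real \<Delta> - 2) * (5 * real \<Delta> - 22)"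
      unfolding s_def by (simp add: algebra_simps power2_eq_square)
    then show ?thesis using D by simp
  qed
  have "real j < r_threshold \<Delta> \<longleftrightarrow> m < sqrt s"
    unfolding r_threshold_def m_def s_def by (auto simp: field_simps)
  also have "\<dots> \<longleftrightarrow> m^2 < s"
    using m s by (metis real_less_rsqrt real_sqrt_less_iff real_sqrt_abs abs_of_nonneg)
  also have "\<dots> \<longleftrightarrow> q < 0" using mq by linarith
  also have "\<dots> \<longleftrightarrow> family1_cost (int \<Delta>) (int j) < vertex_cost (int \<Delta>) (int \<Delta>)"
    using family1_cost_minus_vertex_cost(1)[of "int \<Delta>" "int j"] D j by (simp add: q_def)
  finally show "real j < r_threshold \<Delta> \<longleftrightarrow> family1_cost (int \<Delta>) (int j) < vertex_cost (int \<Delta>) (int \<Delta>)" .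
  have "real j = r_threshold \<Delta> \<longleftrightarrow> m = sqrt s"
    unfolding r_threshold_def m_def s_def by (auto simp: field_simps)
  also have "\<dots> \<longleftrightarrow> m^2 = s" using m s by (metis real_sqrt_unique real_sqrt_pow2)
  also have "\<dots> \<longleftrightarrow> q = 0" using mq by linarith
  also have "\<dots> \<longleftrightarrow> family1_cost (int \<Delta>) (int j) = vertex_cost (int \<Delta>) (int \<Delta>)"
    using family1_cost_minus_vertex_cost(2)[of "int \<Delta>" "int j"] D j by (simp add: q_def)
  finally show "real j = r_threshold \<Delta> \<longleftrightarrow> family1_cost (int \<Delta>) (int j) = vertex_cost (int \<Delta>) (int \<Delta>)" .
qed

text \<open>For j = 2 and \<Delta> \<ge> 7 the third family wins strictly, and the three single
  exceptional pairs are evaluated. Elsewhere the third family is never optimal, so the threshold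
  decides between the other two.\<close>

lemma family_iff_optimal:
  assumes D: "6 \<le> \<Delta>" and j: "1 \<le> j" "j < \<Delta>"
  defines "D \<equiv> int \<Delta>" and "J \<equiv> int j"
  shows "T \<in> family \<Delta> k j \<longleftrightarrow> (T \<in> family1 \<Delta> k j \<and> family1_cost D J = best_cost D J) \<or> (T \<in> family2 \<Delta> k j \<and> family2_cost D J = best_cost D J) \<or>
    (T \<in> family3 \<Delta> k j \<and> family3_cost D J = best_cost D J)"
proof -
  have D6: "6 \<le> D" and J: "1 \<le> J" "J < D" using D j by (auto simp: D_def J_def)
  have best_cost: "best_cost D J = min (min (family1_cost D J) (family2_cost D J)) (if 2 \<le> J \<and> J \<le> D - 2 then family3_cost D J else family2_cost D J)"
    using J by (simp add: best_cost_def family2_cost_def family3_cost_def)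
  have family2_cost: "family2_cost D J = vertex_cost D D" using J by (simp add: family2_cost_def)
  consider (a) "j = 2 \<and> 7 \<le> \<Delta>" | (b) "\<Delta> = 8" "j = 3" | (c) "\<Delta> = 6" "j = 2" | (e) "\<Delta> = 9" "j = 3"
    | (f) "\<not> (j = 2 \<and> 7 \<le> \<Delta>)" "\<not> (\<Delta> = 8 \<and> j = 3)" "\<not> (\<Delta> = 6 \<and> j = 2)" "\<not> (\<Delta> = 9 \<and> j = 3)"
    by blast
  then show ?thesis
  proof cases
    case a
    then have "family3_cost D J < family1_cost D J" "family3_cost D J < family2_cost D J"
      using family3_cost_at_two[of D] family2_cost by (auto simp: family3_cost_def D_def J_def)
    moreover have "2 \<le> J \<and> J \<le> D - 2" using a by (auto simp: D_def J_def)
    ultimately show ?thesis using a unfolding family_def best_cost by auto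
  next
    case b
    then show ?thesis unfolding family_def best_cost
      by (simp add: D_def J_def family1_cost_def family2_cost_def family3_cost_def star_cost_def vertex_cost_def)
  next
    case c
    then show ?thesis unfolding family_def best_cost
      by (simp add: D_def J_def family1_cost_def family2_cost_def family3_cost_def star_cost_def vertex_cost_def)
  next
    case e
    then show ?thesis unfolding family_def best_cost
      by (simp add: D_def J_def family1_cost_def family2_cost_def family3_cost_def star_cost_def vertex_cost_def)
  next
    case f
    have family3_cost: "min (family1_cost D J) (family2_cost D J) < family3_cost D J" if "2 \<le> J \<and> J \<le> D - 2"
      using family3_cost_not_best[OF D6, of J] that f family2_cost D
        unfolding family3_cost_def D_def J_def by force
    have best_cost': "best_cost D J = min (family1_cost D J) (family2_cost D J)"
      unfolding best_cost using family3_cost by auto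
    have F3: "T \<notin> family3 \<Delta> k j \<or> family3_cost D J \<noteq> best_cost D J"
    proof -
      have "2 \<le> J \<and> J \<le> D - 2" if "T \<in> family3 \<Delta> k j"
      proof -
        have "2 \<le> j" "j \<le> \<Delta> - 2" using that by (simp_all add: family3_def)
        then show ?thesis using D unfolding D_def J_def by auto
      qed
      then show ?thesis using family3_cost best_cost' by auto
    qed
    have fam: "family \<Delta> k j = (if real j < r_threshold \<Delta> then family1 \<Delta> k j
      else if real j = r_threshold \<Delta> then family1 \<Delta> k j \<union> family2 \<Delta> k j else family2 \<Delta> k j)"
      using f j by (auto simp: family_def)
    note r = r_threshold_iff[OF D j, folded D_def J_def]
    consider "family1_cost D J < vertex_cost D D" | "family1_cost D J = vertex_cost D D" | "vertex_cost D D < family1_cost D J" by linarith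
    then show ?thesis
    proof cases
      case 1
      then have "family \<Delta> k j = family1 \<Delta> k j" "best_cost D J = family1_cost D J" "family2_cost D J \<noteq> best_cost D J"
        using fam r best_cost' family2_cost by auto
      then show ?thesis using F3 by auto
    next
      case 2
      then have "family \<Delta> k j = family1 \<Delta> k j \<union> family2 \<Delta> k j" "best_cost D J = family1_cost D J" "family2_cost D J = best_cost D J"
        using fam r best_cost' family2_cost by auto
      then show ?thesis using F3 by auto
    next
      case 3
      then have "family \<Delta> k j = family2 \<Delta> k j" "best_cost D J = family2_cost D J" "family1_cost D J \<noteq> best_cost D J"
        using fam r best_cost' family2_cost by auto
      then show ?thesis using F3 by auto
    qed
  qed
qed

lemma sigma_le:
  assumes D: "6 \<le> \<Delta>" and j: "j < \<Delta>" and T: "T \<in> trees (k * \<Delta> + 1 + j) \<Delta>"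
  shows "sigma T \<le> sigma_level \<Delta> k j (best_cost (int \<Delta>) (int j))"
    and "sigma T = sigma_level \<Delta> k j (best_cost (int \<Delta>) (int j)) \<Longrightarrow>
      (1 \<le> j \<and> T \<in> family1 \<Delta> k j) \<or> T \<in> family2 \<Delta> k j \<or> T \<in> family3 \<Delta> k j"
proof -
  interpret sized_degree_tree T \<Delta> k j using sized_iff[OF D j] T by blast
  show "sigma T \<le> sigma_level \<Delta> k j (best_cost (int \<Delta>) (int j))"
    using total_cost_bound unfolding sigma_total_cost sigma_level_def D_def K_def J_def by linarith
  assume "sigma T = sigma_level \<Delta> k j (best_cost (int \<Delta>) (int j))"
  then have "total_cost = K * vertex_cost D D + best_cost D J"
    unfolding sigma_level_iff by (simp add: D_def J_def)
  from optimal_families[OF this]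
  show "(1 \<le> j \<and> T \<in> family1 \<Delta> k j) \<or> T \<in> family2 \<Delta> k j \<or> T \<in> family3 \<Delta> k j"
    by (auto simp: J_def)
qed

lemma sigma_nonneg: "0 \<le> sigma T"
  unfolding sigma_def by (intro pos_imp_zdiv_nonneg_iff[THEN iffD2] sum_nonneg) auto

lemma sigma_level_inj: "sigma_level \<Delta> k j x = sigma_level \<Delta> k j y \<longleftrightarrow> x = y"
  by (simp add: sigma_level_def)

theorem theorem11:
  fixes \<Delta> k j n :: nat
  assumes "\<Delta> \<ge> 6" and "k \<ge> \<Delta> - 1" and "j \<le> \<Delta> - 1" and "n = k * \<Delta> + 1 + j"
  shows "Max (sigma ` (trees n \<Delta> :: 'a::infinite pair_pre_digraph set)) =
      (if j = 0 then nice_sigma \<Delta> k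
       else if 2 \<le> j \<and> j \<le> \<Delta> - 2 then
         Max {common_sigma (family1 \<Delta> k j :: 'a pair_pre_digraph set),
              common_sigma (family2 \<Delta> k j :: 'a pair_pre_digraph set),
              common_sigma (family3 \<Delta> k j :: 'a pair_pre_digraph set)}
       else
         Max {common_sigma (family1 \<Delta> k j :: 'a pair_pre_digraph set),
              common_sigma (family2 \<Delta> k j :: 'a pair_pre_digraph set)})
    \<and> (j = 0 \<longrightarrow>
        sigma ` {T \<in> (trees n \<Delta> :: 'a pair_pre_digraph set). nice_tree T} = {nice_sigma \<Delta> k})
    \<and> (\<forall>T \<in> (trees n \<Delta> :: 'a pair_pre_digraph set).
        maximal_tree T \<longleftrightarrow> T \<in> family \<Delta> k j)"
proof -
  note D = assms(1) and k = assms(2)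
  have j: "j < \<Delta>" using assms(1,3) by simp
  let ?g = "best_cost (int \<Delta>) (int j)"
  let ?F1 = "family1 \<Delta> k j :: 'a pair_pre_digraph set"
  let ?F2 = "family2 \<Delta> k j :: 'a pair_pre_digraph set"
  let ?F3 = "family3 \<Delta> k j :: 'a pair_pre_digraph set"
  let ?trees = "trees n \<Delta> :: 'a pair_pre_digraph set"
  let ?lev = "sigma_level \<Delta> k j"
  have sub: "?F1 \<subseteq> ?trees" "?F2 \<subseteq> ?trees" "?F3 \<subseteq> ?trees"
    using assms(4) by (auto simp: family1_def family2_def family3_def)
  note fam = sigma_families[OF D j k, where 'a = 'a]
  have le: "sigma T \<le> ?lev ?g" if "T \<in> ?trees" for T
    using sigma_le(1)[OF D j, of T k] that assms(4) by simp
  have opt: "(1 \<le> j \<and> T \<in> ?F1) \<or> T \<in> ?F2 \<or> T \<in> ?F3" if "T \<in> ?trees" "sigma T = ?lev ?g" for T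
    using sigma_le(2)[OF D j, of T k] that assms(4) by simp
  have best_cost: "?g = (if j = 0 then 0 else min (min (family1_cost (int \<Delta>) (int j)) (family2_cost (int \<Delta>) (int j)))
     (if 2 \<le> j \<and> j \<le> \<Delta> - 2 then family3_cost (int \<Delta>) (int j) else family2_cost (int \<Delta>) (int j)))"
    using D by (auto simp: best_cost_def family3_cost_def family2_cost_def)
  have attained: "?lev ?g \<in> sigma ` ?trees"
  proof -
    consider "j = 0" | "1 \<le> j" "?g = family1_cost (int \<Delta>) (int j)" | "?g = family2_cost (int \<Delta>) (int j)"
      | "2 \<le> j" "j \<le> \<Delta> - 2" "?g = family3_cost (int \<Delta>) (int j)"
      using best_cost by (auto simp: min_def split: if_splits)
    then have "?lev ?g \<in> sigma ` ?F1 \<or> ?lev ?g \<in> sigma ` ?F2 \<or> ?lev ?g \<in> sigma ` ?F3"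
    proof cases
      case 1
      then show ?thesis using fam(2) by (simp add: best_cost_def family2_cost_def)
    next
      case 2
      then show ?thesis using fam(1) by simp
    next
      case 3
      then show ?thesis using fam(2) by simp
    next
      case 4
      then show ?thesis using fam(3) by simp
    qed
    then show ?thesis using sub by blast
  qed
  \<comment> \<open>The trees over an infinite type form an infinite set, so the finiteness needed
    for \<open>Max\<close> comes from the bounded range of the values.\<close>
  have "sigma ` ?trees \<subseteq> {0..?lev ?g}" using le sigma_nonneg by auto
  then have "finite (sigma ` ?trees)" using finite_subset by blast
  then have Max: "Max (sigma ` ?trees) = ?lev ?g"
    by (rule Max_eqI) (use le attained in auto)
  \<comment> \<open>Cost enters with a negative sign, so the minimum of the costs becomes the
    maximum of the common values.\<close>
  have anti: "?lev (min x y) = max (?lev x) (?lev y)" for x y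
    by (auto simp: sigma_level_def min_def max_def)
  have maxeq: "maximal_tree T \<longleftrightarrow> sigma T = ?lev ?g" if T: "T \<in> ?trees" for T
  proof -
    have "maximal_tree T \<longleftrightarrow> (\<forall>T'\<in>?trees. sigma T' \<le> sigma T)"
      using T by (auto simp: maximal_tree_def trees_def)
    also have "\<dots> \<longleftrightarrow> sigma T = ?lev ?g"
      using le[OF T] le attained by (metis (no_types, lifting) imageE order_antisym)
    finally show ?thesis .
  qed
  have part3: "maximal_tree T \<longleftrightarrow> T \<in> family \<Delta> k j" if T: "T \<in> ?trees" for T
  proof (cases "j = 0")
    case True
    then have "T \<notin> ?F3" by (auto simp: family3_def)
    then have "sigma T = ?lev ?g \<longleftrightarrow> T \<in> ?F2"
      using opt[OF T] True fam(2) by (auto simp: best_cost_def family2_cost_def)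
    then show ?thesis using maxeq[OF T] True by (simp add: family_def)
  next
    case False
    then have j1: "1 \<le> j" by simp
    have range: "2 \<le> j \<and> j \<le> \<Delta> - 2" if "T \<in> ?F3" using that by (simp add: family3_def)
    have v: "T \<in> ?F1 \<Longrightarrow> sigma T = ?lev (family1_cost (int \<Delta>) (int j))" "T \<in> ?F2 \<Longrightarrow> sigma T = ?lev (family2_cost (int \<Delta>) (int j))"
      "T \<in> ?F3 \<Longrightarrow> sigma T = ?lev (family3_cost (int \<Delta>) (int j))"
      using fam(1)[OF j1] fam(2) fam(3)[OF conjunct1[OF range] conjunct2[OF range]] by blast+
    show ?thesis unfolding maxeq[OF T] family_iff_optimal[OF D j1 j]
      using opt[OF T] v sigma_level_inj by metis
  qed
  have part1: "Max (sigma ` ?trees) =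
      (if j = 0 then nice_sigma \<Delta> k
       else if 2 \<le> j \<and> j \<le> \<Delta> - 2 then Max {common_sigma ?F1, common_sigma ?F2, common_sigma ?F3}
       else Max {common_sigma ?F1, common_sigma ?F2})"
  proof (cases "j = 0")
    case True
    then show ?thesis using Max nice_sigma_level[of \<Delta> k] by (simp add: best_cost_def)
  next
    case False
    then have c: "common_sigma ?F1 = ?lev (family1_cost (int \<Delta>) (int j))" "common_sigma ?F2 = ?lev (family2_cost (int \<Delta>) (int j))"
      "2 \<le> j \<and> j \<le> \<Delta> - 2 \<Longrightarrow> common_sigma ?F3 = ?lev (family3_cost (int \<Delta>) (int j))"
      using fam by (auto intro!: common_sigmaI)
    show ?thesis
    proof (cases "2 \<le> j \<and> j \<le> \<Delta> - 2")
      case True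
      then have "?lev ?g = max (max (common_sigma ?F1) (common_sigma ?F2)) (common_sigma ?F3)"
        using best_cost False c by (simp add: anti)
      then show ?thesis using Max True False by (simp add: max.assoc)
    next
      case 2: False
      then have "?g = min (family1_cost (int \<Delta>) (int j)) (family2_cost (int \<Delta>) (int j))"
        using best_cost False by auto
      then have "?lev ?g = max (common_sigma ?F1) (common_sigma ?F2)" using c by (simp add: anti)
      moreover have "Max {common_sigma ?F1, common_sigma ?F2} = max (common_sigma ?F1) (common_sigma ?F2)" by simp
      ultimately show ?thesis using Max 2 False by presburger
    qed
  qed
  have part2: "sigma ` {T \<in> ?trees. nice_tree T} = {nice_sigma \<Delta> k}" if "j = 0"
  proof -
    have "nice_tree T \<longleftrightarrow> T \<in> ?F2" if "T \<in> ?trees" for T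
    proof -
      interpret sized_degree_tree T \<Delta> k j using sized_iff[OF D j] that assms(4) by blast
      have "J = 0" unfolding J_def using \<open>j = 0\<close> by simp
      then show ?thesis using nice_iff family2_iff by blast
    qed
    then have "{T \<in> ?trees. nice_tree T} = ?F2" using sub(2) by blast
    then show ?thesis using fam(2) that nice_sigma_level[of \<Delta> k] by (simp add: family2_cost_def)
  qed
  show ?thesis using part1 part2 part3 by blast
qed

end
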